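(* Let $(X,\alpha)$ and $(Y,\beta)$ be Cantor minimal systems and let $\phi:X\to\operatorname{Isom}(\mathbb{T})$ and $\psi:Y\to\operatorname{Isom}(\mathbb{T})$ be continuous maps. The following are equivalent. (1) There exist homeomorphisms $\sigma_n:X\times\mathbb{T}\to Y\times\mathbb{T}$ such that $\sigma_n(\alpha\times\phi)\sigma_n^{-1}$ converges to $\beta\times\psi$ in $\operatorname{Homeo}(Y\times\mathbb{T})$. (2) $PS(\beta)\subset PS(\alpha)$, and one of the following holds: (a) $[o(\psi)]_\beta=0$ and $[o(\phi)]_\alpha=0$; (b) $[o(\psi)]_\beta\neq0$ and there exist $n\in\mathbb{N}$, $f\in C(X,\mathbb{Z})$ and $g\in C(Y,\mathbb{Z})$ such that $2^{n-1}[f]_\alpha=[1_X]_\alpha$, $[f]_\alpha+2K^0(X,\alpha)=[o(\phi)]_\alpha$, $2^{n-1}[g]_\beta=[1_Y]_\beta$ and $[g]_\beta+2K^0(Y,\beta)=[o(\psi)]_\beta$; (c) $[o(\psi)]_\beta\neq0$ and $PS(\beta\times o(\psi))=PS(\beta)$.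
   Context: A Cantor minimal system $(X,\alpha)$ is a Cantor set $X$ with a homeomorphism $\alpha$ having no nontrivial closed invariant subsets. $\mathbb{N}=\{1,2,\dots\}$, $\mathbb{T}=\mathbb{R}/\mathbb{Z}$, $\operatorname{Isom}(\mathbb{T})=\{R_t\}\cup\{R_t\lambda\}$ with $R_t(s)=s+t$, $\lambda(s)=-s$, topologized by uniform convergence. For compact metrizable $Z$, $\operatorname{Homeo}(Z)$ carries the topology of uniform convergence. $\alpha\times\phi$ is $(x,t)\mapsto(\alpha(x),\phi_x(t))$ on $X\times\mathbb{T}$. $o(\phi):X\to\mathbb{Z}_2$ is $0$ at $x$ if $\phi_x$ preserves orientation, $1$ otherwise; $\beta\times o(\psi)$ is the homeomorphism $(y,k)\mapsto(\beta(y),k+o(\psi)(y))$ of $Y\times\mathbb{Z}_2$. $K^0(X,\alpha)=C(X,\mathbb{Z})/\{f-f\circ\alpha^{-1}\}$ with classes $[f]_\alpha$; $K^0(X,\alpha)/2K^0(X,\alpha)$ is identified with $C(X,\mathbb{Z}_2)/\{f-f\circ\alpha^{-1}:f\in C(X,\mathbb{Z}_2)\}$ and $[o(\phi)]_\alpha$ is the class of $o(\phi)$ there (similarly for $\beta,\psi$). For a homeomorphism $\gamma$ of a compact space $Z$, $PS(\gamma)$ is the set of $p\in\mathbb{N}$ such that there is a clopen $U\subset Z$ with $U,\gamma(U),\dots,\gamma^{p-1}(U)$ pairwise disjoint and covering $Z$. *)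

theory Defs
  imports "HOL-Analysis.Analysis"
begin

definition cantor_set :: "'a::metric_space set \<Rightarrow> bool" where
  "cantor_set X \<longleftrightarrow> X \<noteq> {} \<and> compact X \<and> (\<forall>x\<in>X. x islimpt X)
     \<and> (\<forall>x\<in>X. connected_component_set X x = {x})"

definition cantor_minimal :: "'a::metric_space set \<Rightarrow> ('a \<Rightarrow> 'a) \<Rightarrow> bool" where
  "cantor_minimal X \<alpha> \<longleftrightarrow> cantor_set X \<and> homeomorphism X X \<alpha> (inv_into X \<alpha>)
     \<and> (\<forall>C. closed C \<and> C \<subseteq> X \<and> \<alpha> ` C = C \<longrightarrow> C = {} \<or> C = X)"

text \<open>The circle T = R/Z, realised as the unit circle in C via t \<mapsto> exp(2 pi i t).\<close>
abbreviation circle :: "complex set" where "circle \<equiv> sphere 0 1"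

definition Isom_T :: "(complex \<Rightarrow> complex) set" where
  "Isom_T = {f. \<exists>a. cmod a = 1 \<and> (f = (\<lambda>z. a * z) \<or> f = (\<lambda>z. a * cnj z))}"

definition orient_pres :: "(complex \<Rightarrow> complex) \<Rightarrow> bool" where
  "orient_pres f \<longleftrightarrow> (\<exists>a. cmod a = 1 \<and> f = (\<lambda>z. a * z))"

definition isom_cocycle :: "'a::metric_space set \<Rightarrow> ('a \<Rightarrow> complex \<Rightarrow> complex) \<Rightarrow> bool" where
  "isom_cocycle X \<phi> \<longleftrightarrow> (\<forall>x\<in>X. \<phi> x \<in> Isom_T) \<and>
     (\<forall>x\<in>X. \<forall>e>0. \<exists>d>0. \<forall>x'\<in>X. dist x' x < d \<longrightarrow> (\<forall>z\<in>circle. dist (\<phi> x' z) (\<phi> x z) < e))"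

text \<open>o(\<phi>) : X \<rightarrow> Z_2, with Z_2 = {0,1} \<subseteq> int (arithmetic mod 2).\<close>
definition orient :: "('a \<Rightarrow> complex \<Rightarrow> complex) \<Rightarrow> 'a \<Rightarrow> int" where
  "orient \<phi> x = (if orient_pres (\<phi> x) then 0 else 1)"

definition skew :: "('a \<Rightarrow> 'a) \<Rightarrow> ('a \<Rightarrow> complex \<Rightarrow> complex) \<Rightarrow> 'a \<times> complex \<Rightarrow> 'a \<times> complex" where
  "skew \<alpha> \<phi> = (\<lambda>(x, t). (\<alpha> x, \<phi> x t))"

text \<open>Equality of classes in K^0(X,\<alpha>) = C(X,Z)/{h - h \<circ> \<alpha>^{-1}}.\<close>
definition K0_eq :: "'a::metric_space set \<Rightarrow> ('a \<Rightarrow> 'a) \<Rightarrow> ('a \<Rightarrow> int) \<Rightarrow> ('a \<Rightarrow> int) \<Rightarrow> bool" where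
  "K0_eq X \<alpha> f g \<longleftrightarrow> (\<exists>h::'a \<Rightarrow> int. continuous_on X h \<and>
      (\<forall>x\<in>X. f x - g x = h x - h (inv_into X \<alpha> x)))"

text \<open>Equality of classes in C(X,Z_2)/{h - h \<circ> \<alpha>^{-1} : h \<in> C(X,Z_2)}
  (identified with K^0/2K^0); integer functions are read mod 2.\<close>
definition K0mod2_eq :: "'a::metric_space set \<Rightarrow> ('a \<Rightarrow> 'a) \<Rightarrow> ('a \<Rightarrow> int) \<Rightarrow> ('a \<Rightarrow> int) \<Rightarrow> bool" where
  "K0mod2_eq X \<alpha> f g \<longleftrightarrow> (\<exists>h::'a \<Rightarrow> int. continuous_on X h \<and> h ` X \<subseteq> {0, 1} \<and>
      (\<forall>x\<in>X. (f x - g x - (h x - h (inv_into X \<alpha> x))) mod 2 = 0))"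

definition PS :: "'a::topological_space set \<Rightarrow> ('a \<Rightarrow> 'a) \<Rightarrow> nat set" where
  "PS Z \<gamma> = {p. p \<ge> 1 \<and> (\<exists>U. openin (top_of_set Z) U \<and> closedin (top_of_set Z) U \<and>
      (\<forall>i<p. \<forall>j<p. i \<noteq> j \<longrightarrow> (\<gamma> ^^ i) ` U \<inter> (\<gamma> ^^ j) ` U = {}) \<and>
      (\<Union>i<p. (\<gamma> ^^ i) ` U) = Z)}"

definition skew2 :: "('a \<Rightarrow> 'a) \<Rightarrow> ('a \<Rightarrow> int) \<Rightarrow> 'a \<times> int \<Rightarrow> 'a \<times> int" where
  "skew2 \<beta> c = (\<lambda>(y, k). (\<beta> y, (k + c y) mod 2))"

end

theory Submission
  imports Defs
begin

text \<open>
  Fibres of the circle bundles are connected components and the bases are totally disconnected, so a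
  homeomorphism \<open>\<sigma>\<close> covers a homeomorphism \<open>s\<close> of the bases; comparing degrees on fibres, \<open>\<sigma>\<close> conjugates
  \<open>\<alpha> \<times> \<phi>\<close> to a small perturbation of \<open>\<beta> \<times> \<psi>\<close> only if \<open>s \<circ> \<alpha>\<close> is close to \<open>\<beta> \<circ> s\<close> and \<open>o(\<psi>) \<circ> s\<close> is
  cohomologous to \<open>o(\<phi>)\<close> modulo two. Conversely, such an \<open>s\<close> lifts, because over a minimal system the remaining
  rotation valued cohomological equation is approximately solvable: the defect of an exact solution
  along a high Kakutani--Rokhlin tower is spread over its levels.

  The invariants pull back along \<open>s\<close>, since a locally constant function does not see the difference
  between \<open>s \<circ> \<alpha>\<close> and \<open>\<beta> \<circ> s\<close>. To construct \<open>s\<close> from the invariants, take a fine clopen partition of \<open>Y\<close>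
  and the strongly connected graph of transitions of \<open>\<beta>\<close> between its pieces. The pairs (length,
  orientation) of closed walks at a vertex form a subsemigroup of the naturals times the group of order two, which
  from some length on consists of all multiples of a period \<open>p\<close> together with (i) even orientation,
  (ii) any orientation, or (iii) the orientation \<open>L / p\<close> modulo two. The hypotheses say exactly that the towers of
  \<open>\<alpha>\<close> over a small base have lengths and orientations of this form, so that they can be labelled by closed
  walks; a homeomorphism of Cantor sets that respects the labels is the required \<open>s\<close>.
\<close>

section \<open>Locally constant maps\<close>

text \<open>The alternatives of the theorem are not the types of closed walks: the type depends on
  the partition of \<open>Y\<close>, which must be fine enough to resolve the functions that witness
  (a) or (b). Type (i) makes the orientation of \<psi> a coboundary and so belongs to (a). Type (ii)
  asks of \<alpha> only the period \<open>p\<close>, which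
  \<open>PS Y \<beta> \<subseteq> PS X \<alpha>\<close> supplies. Type (iii) is the obstacle, since
  \<alpha> must then show the same link between length and orientation. Under (b) it does: summing
  \<open>f\<close> along a return word of length \<open>L\<close> gives
  \<open>L / 2 ^ (n - 1)\<close>, an integer with the parity of the orientation. Under (c) type
  (iii) cannot occur, because it would give the double cover the period \<open>2 * p\<close>, which
  the base lacks. The power of two in (b) comes from the converse: a period of the double cover that
  is no period of the base is even, say \<open>2 * P\<close>, and its eigenfunction exhibits 1 as
  \<open>P\<close> times an integer function congruent to the orientation, up to a coboundary. The
  odd part of \<open>P\<close> can be moved into that function without changing parities. Finite
  clopen partitions appear throughout as locally constant maps, whose values label the
  pieces.\<close>

definition lc :: "'a::topological_space set \<Rightarrow> ('a \<Rightarrow> 'c) \<Rightarrow> bool" where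
  "lc X f \<longleftrightarrow> (\<forall>x\<in>X. \<exists>U. open U \<and> x \<in> U \<and> (\<forall>x'\<in>U \<inter> X. f x' = f x))"

lemma lcI:
  assumes "\<And>x. x \<in> X \<Longrightarrow> \<exists>U. open U \<and> x \<in> U \<and> (\<forall>x'\<in>U \<inter> X. f x' = f x)"
  shows "lc X f"
  using assms by (auto simp: lc_def)

lemma lcE:
  assumes "lc X f" "x \<in> X"
  obtains U where "open U" "x \<in> U" "\<And>x'. x' \<in> U \<Longrightarrow> x' \<in> X \<Longrightarrow> f x' = f x"
  using assms unfolding lc_def by (metis IntI)

lemma lc_const [simp]: "lc X (\<lambda>_. c)"
  unfolding lc_def by (metis UNIV_I open_UNIV)

lemma lc_discrete: "lc X (\<lambda>x::'a::discrete_topology. f x)"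
  unfolding lc_def by (metis Int_iff open_discrete singletonD singletonI)

lemma lc_comp2:
  assumes "lc X f" "lc X g"
  shows "lc X (\<lambda>x. H (f x) (g x))"
proof (rule lcI)
  fix x assume x: "x \<in> X"
  obtain U where U: "open U" "x \<in> U" "\<And>x'. x' \<in> U \<Longrightarrow> x' \<in> X \<Longrightarrow> f x' = f x"
    using lcE[OF assms(1) x] by metis
  obtain V where V: "open V" "x \<in> V" "\<And>x'. x' \<in> V \<Longrightarrow> x' \<in> X \<Longrightarrow> g x' = g x"
    using lcE[OF assms(2) x] by metis
  show "\<exists>U. open U \<and> x \<in> U \<and> (\<forall>x'\<in>U \<inter> X. H (f x') (g x') = H (f x) (g x))"
    by (rule exI[of _ "U \<inter> V"]) (use U V in auto)
qed

lemma lc_comp1: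
  assumes "lc X f"
  shows "lc X (\<lambda>x. H (f x))"
  using lc_comp2[OF assms assms, of "\<lambda>a _. H a"] .

text \<open>Lets the parameter of a family vary with the point, as long as it does so in a locally
  constant way. Towers need this: the number of iterates in their formulas depends on the
  point.\<close>

lemma lc_param:
  assumes "\<And>p. lc X (G p)" "lc X q"
  shows "lc X (\<lambda>x. G (q x) x)"
proof (rule lcI)
  fix x assume x: "x \<in> X"
  obtain U where U: "open U" "x \<in> U" "\<And>x'. x' \<in> U \<Longrightarrow> x' \<in> X \<Longrightarrow> q x' = q x"
    by (fact lcE[OF assms(2) x])
  obtain V where V: "open V" "x \<in> V" "\<And>x'. x' \<in> V \<Longrightarrow> x' \<in> X \<Longrightarrow> G (q x) x' = G (q x) x"
    by (fact lcE[OF assms(1) x])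
  show "\<exists>U. open U \<and> x \<in> U \<and> (\<forall>x'\<in>U \<inter> X. G (q x') x' = G (q x) x)"
    by (rule exI[of _ "U \<inter> V"]) (use U V in auto)
qed

lemma lc_pullback:
  assumes "continuous_on X g" "g ` X \<subseteq> Y" "lc Y f"
  shows "lc X (\<lambda>x. f (g x))"
proof (rule lcI)
  fix x assume x: "x \<in> X"
  then obtain U where U: "open U" "g x \<in> U" "\<And>y. y \<in> U \<Longrightarrow> y \<in> Y \<Longrightarrow> f y = f (g x)"
    using lcE[OF assms(3), of "g x"] assms(2) by (metis image_subset_iff)
  obtain A where A: "open A" "A \<inter> X = g -` U \<inter> X"
    using assms(1) U(1) unfolding continuous_on_open_invariant by blast
  show "\<exists>U. open U \<and> x \<in> U \<and> (\<forall>x'\<in>U \<inter> X. f (g x') = f (g x))"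
  proof (rule exI[of _ A], intro conjI ballI)
    show "x \<in> A" using A x U by blast
    fix x' assume "x' \<in> A \<inter> X"
    then have "x' \<in> X" "g x' \<in> U" using A by auto
    then show "f (g x') = f (g x)" using U(3) assms(2) by auto
  qed (use A in auto)
qed

lemma lc_imp_continuous_on:
  assumes "lc X f"
  shows "continuous_on X f"
  unfolding continuous_on_topological
proof (intro ballI allI impI)
  fix x B assume x: "x \<in> X" "open B" "f x \<in> B"
  obtain U where U: "open U" "x \<in> U" "\<And>x'. x' \<in> U \<Longrightarrow> x' \<in> X \<Longrightarrow> f x' = f x"
    using lcE[OF assms x(1)] by metis
  then show "\<exists>A. open A \<and> x \<in> A \<and> (\<forall>y\<in>X. y \<in> A \<longrightarrow> f y \<in> B)"
    using x(3) by metis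
qed

lemma continuous_on_discrete_imp_lc:
  fixes f :: "'a::topological_space \<Rightarrow> 'b::discrete_topology"
  assumes "continuous_on X f"
  shows "lc X f"
  using lc_pullback[OF assms, of UNIV "\<lambda>y. y"] lc_discrete[of UNIV "\<lambda>y. y"] by simp

lemma lc_iff_continuous_on_int: "lc X (f :: _ \<Rightarrow> int) \<longleftrightarrow> continuous_on X f"
  using lc_imp_continuous_on continuous_on_discrete_imp_lc by blast

lemma lc_finite_family:
  assumes "finite I" "\<And>i. i \<in> I \<Longrightarrow> lc X (f i)"
  shows "lc X (\<lambda>x. \<lambda>i\<in>I. f i x)"
proof (rule lcI)
  fix x assume x: "x \<in> X"
  have "\<forall>i\<in>I. \<exists>U. open U \<and> x \<in> U \<and> (\<forall>x'\<in>U \<inter> X. f i x' = f i x)"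
    using assms(2) x unfolding lc_def by blast
  then obtain U where U: "\<And>i. i \<in> I \<Longrightarrow> open (U i) \<and> x \<in> U i \<and> (\<forall>x'\<in>U i \<inter> X. f i x' = f i x)"
    by metis
  show "\<exists>U. open U \<and> x \<in> U \<and> (\<forall>x'\<in>U \<inter> X. (\<lambda>i\<in>I. f i x') = (\<lambda>i\<in>I. f i x))"
    by (rule exI[of _ "\<Inter>i\<in>I. U i"]) (use U assms(1) in \<open>auto intro!: restrict_ext open_INT\<close>)
qed

lemma lc_map:
  assumes "\<And>i. lc X (f i)"
  shows "lc X (\<lambda>x. map (\<lambda>i. f i x) [0..<n])"
proof -
  have "lc X (\<lambda>x. map (\<lambda>i\<in>{..<n}. f i x) [0..<n])"
    using lc_comp1[OF lc_finite_family[of "{..<n}" X f], of "\<lambda>F. map F [0..<n]"] assms by blast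
  moreover have "map (\<lambda>i\<in>{..<n}. f i x) [0..<n] = map (\<lambda>i. f i x) [0..<n]" for x
    by auto
  ultimately show ?thesis by simp
qed

text \<open>Near \<open>x\<close> only the finitely many conditions up to the minimum at
  \<open>x\<close> matter, and these are constant on a common neighbourhood. First hitting times are
  minima of this form.\<close>

lemma lc_Least:
  fixes Q :: "nat \<Rightarrow> 'a::topological_space \<Rightarrow> bool"
  assumes "\<And>i. lc X (Q i)" "\<And>x. x \<in> X \<Longrightarrow> \<exists>i. Q i x"
  shows "lc X (\<lambda>x. LEAST i. Q i x)"
proof (rule lcI)
  fix x assume x: "x \<in> X"
  define n where "n = (LEAST i. Q i x)"
  have Qn: "Q n x" unfolding n_def using assms(2)[OF x] by (metis LeastI)
  have Qm: "\<not> Q m x" if "m < n" for m using that not_less_Least unfolding n_def by blast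
  have "lc X (\<lambda>x. map (\<lambda>i. Q i x) [0..<Suc n])" by (intro lc_map assms)
  then obtain U where U: "open U" "x \<in> U"
    "\<And>x'. x' \<in> U \<Longrightarrow> x' \<in> X \<Longrightarrow> map (\<lambda>i. Q i x') [0..<Suc n] = map (\<lambda>i. Q i x) [0..<Suc n]"
    by (rule lcE[OF _ x]) blast
  have "(LEAST i. Q i x') = n" if "x' \<in> U" "x' \<in> X" for x'
  proof (rule Least_equality)
    have eq: "Q i x' = Q i x" if "i \<le> n" for i
      using U(3)[OF \<open>x' \<in> U\<close> \<open>x' \<in> X\<close>] that by (metis (no_types, lifting) map_eq_conv atLeastLessThan_iff le0 less_Suc_eq_le set_upt)
    show "Q n x'" using eq Qn by simp
    show "n \<le> m" if "Q m x'" for m using eq Qm that by (metis leI less_imp_le)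
  qed
  then show "\<exists>U. open U \<and> x \<in> U \<and> (\<forall>x'\<in>U \<inter> X. (LEAST i. Q i x') = (LEAST i. Q i x))"
    using U unfolding n_def by (metis IntD1 IntD2)
qed

lemma lc_finite_image:
  assumes "compact X" "lc X f"
  shows "finite (f ` X)"
proof -
  have "\<forall>x\<in>X. \<exists>U. open U \<and> x \<in> U \<and> (\<forall>x'\<in>U \<inter> X. f x' = f x)"
    using assms(2) by (simp add: lc_def)
  then obtain U where U: "\<And>x. x \<in> X \<Longrightarrow> open (U x) \<and> x \<in> U x \<and> (\<forall>x'\<in>U x \<inter> X. f x' = f x)"
    by metis
  obtain D where D: "D \<subseteq> X" "finite D" "X \<subseteq> (\<Union>x\<in>D. U x)"
    using compactE_image[OF assms(1), of X U] U by (metis UN_I subsetI)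
  have "f ` X \<subseteq> f ` D"
  proof
    fix c assume "c \<in> f ` X"
    then obtain x where x: "x \<in> X" "c = f x" by blast
    then obtain z where "z \<in> D" "x \<in> U z" using D(3) by blast
    then show "c \<in> f ` D" using U[of z] D(1) x by blast
  qed
  then show ?thesis using D(2) finite_surj by blast
qed

lemma lc_closed_fibre:
  fixes X :: "'a::t2_space set"
  assumes "compact X" "lc X f"
  shows "closed {x\<in>X. f x = c}"
proof -
  have "lc X (\<lambda>x. if f x = c then 0 else 1::real)"
    using lc_comp1[OF assms(2), of "\<lambda>v. if v = c then 0 else 1::real"] .
  from lc_imp_continuous_on[OF this]
  have "closed (X \<inter> (\<lambda>x. if f x = c then 0 else 1::real) -` {0})"
    by (rule continuous_closed_preimage) (auto simp: compact_imp_closed[OF assms(1)])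
  moreover have "X \<inter> (\<lambda>x. if f x = c then 0 else 1::real) -` {0} = {x\<in>X. f x = c}" by (auto split: if_splits)
  ultimately show ?thesis by simp
qed

text \<open>\<open>d\<close> is a Lebesgue number of the cover by open sets of constancy.\<close>

lemma lc_uniform:
  fixes X :: "'a::metric_space set"
  assumes "compact X" "lc X f"
  obtains d where "d > 0" "\<And>x y. x \<in> X \<Longrightarrow> y \<in> X \<Longrightarrow> dist x y < d \<Longrightarrow> f x = f y"
proof -
  have "\<forall>x\<in>X. \<exists>U. open U \<and> x \<in> U \<and> (\<forall>x'\<in>U \<inter> X. f x' = f x)"
    using assms(2) by (simp add: lc_def)
  then obtain U where U: "\<And>x. x \<in> X \<Longrightarrow> open (U x) \<and> x \<in> U x \<and> (\<forall>x'\<in>U x \<inter> X. f x' = f x)"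
    by metis
  obtain d where d: "0 < d" "\<And>x. x \<in> X \<Longrightarrow> \<exists>G\<in>U ` X. ball x d \<subseteq> G"
    using Heine_Borel_lemma[OF assms(1), of "U ` X"] U by (metis UN_I imageE subsetI)
  show thesis
  proof (rule that[OF d(1)])
    fix x y assume xy: "x \<in> X" "y \<in> X" "dist x y < d"
    obtain z where z: "z \<in> X" "ball x d \<subseteq> U z" using d(2)[OF xy(1)] by blast
    then have "x \<in> U z" "y \<in> U z" using xy d(1) by (auto simp: subset_iff)
    then show "f x = f y" using U[OF z(1)] xy by (metis IntI)
  qed
qed

section \<open>Cantor sets\<close>

locale cantor =
  fixes X :: "'a::metric_space set"
  assumes cpt: "compact X" and ne: "X \<noteq> {}"
    and perfect: "\<And>x. x \<in> X \<Longrightarrow> x islimpt X"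
    and components: "\<And>x. x \<in> X \<Longrightarrow> connected_component_set X x = {x}"
begin

lemma connected_subset_point:
  assumes "connected S" "S \<subseteq> X" "x \<in> S" "y \<in> S"
  shows "x = y"
proof -
  have "S \<subseteq> connected_component_set X x"
    using assms by (intro connected_component_maximal) auto
  moreover have "x \<in> X" using assms by blast
  ultimately have "S \<subseteq> {x}" using components[of x] by simp
  then show ?thesis using assms(4) by auto
qed

text \<open>In a compact Hausdorff space, components and quasi-components coincide. As connected
  subsets of \<open>X\<close> are points, none joins \<open>x\<close> to the complement of the ball,
  and the cut wire fence theorem separates the two by a clopen set.\<close>

lemma small_clopen:
  assumes x: "x \<in> X" and "e > 0"
  obtains U where "lc X (\<lambda>y. y \<in> U)" "x \<in> U" "U \<subseteq> X" "\<And>y. y \<in> U \<Longrightarrow> dist y x < e"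
proof -
  have "separated_between (top_of_set X) {x} (X - ball x e)"
  proof (rule cut_wire_fence_theorem_gen)
    show "compact_space (top_of_set X)"
      by (simp add: compact_space_subtopology cpt)
    show "Hausdorff_space (top_of_set X) \<or> regular_space (top_of_set X) \<or> normal_space (top_of_set X)"
      by (simp add: Hausdorff_space_subtopology)
    show "compactin (top_of_set X) {x}" using x by simp
    show "closedin (top_of_set X) (X - ball x e)"
      unfolding closedin_closed by (rule exI[of _ "- ball x e"]) auto
    fix C assume "connectedin (top_of_set X) C"
    then have C: "connected C" "C \<subseteq> X" by (auto simp: connectedin_subtopology)
    then show "disjnt C {x} \<or> disjnt C (X - ball x e)"
      using connected_subset_point[OF C, of x] \<open>e > 0\<close> unfolding disjnt_iff by (metis DiffE centre_in_ball singletonD)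
  qed
  then obtain U V where UV: "openin (top_of_set X) U" "openin (top_of_set X) V" "U \<union> V = X" "disjnt U V"
    "{x} \<subseteq> U" "X - ball x e \<subseteq> V"
    unfolding separated_between_def by auto
  obtain U' V' where o: "open U'" "U = X \<inter> U'" "open V'" "V = X \<inter> V'"
    using UV(1,2) by (auto simp: openin_open)
  have "lc X (\<lambda>y. y \<in> U)"
  proof (rule lcI)
    fix y assume "y \<in> X"
    then consider "y \<in> U" | "y \<in> V" using UV by blast
    then show "\<exists>T. open T \<and> y \<in> T \<and> (\<forall>x'\<in>T \<inter> X. (x' \<in> U) = (y \<in> U))"
    proof cases
      case 1
      then show ?thesis using o by (intro exI[of _ U']) auto
    next
      case 2
      then have "x' \<notin> U" if "x' \<in> V" for x' using UV(4) that by (auto simp: disjnt_iff)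
      with 2 show ?thesis using o by (intro exI[of _ V']) auto
    qed
  qed
  moreover have "dist y x < e" if "y \<in> U" for y
  proof -
    have "y \<in> X" "y \<notin> V" using that UV(3,4) by (auto simp: disjnt_iff)
    then have "y \<in> ball x e" using UV(6) by blast
    then show ?thesis by (simp add: dist_commute)
  qed
  moreover have "x \<in> U" "U \<subseteq> X" using UV by auto
  ultimately show thesis using that[of U] by blast
qed

lemma fine_lc_map:
  assumes "e > 0"
  obtains r where "lc X r" "\<And>x. x \<in> X \<Longrightarrow> r x \<in> X" "\<And>x. x \<in> X \<Longrightarrow> dist x (r x) < e"
proof -
  have "\<forall>x\<in>X. \<exists>U. lc X (\<lambda>y. y \<in> U) \<and> x \<in> U \<and> (\<forall>y\<in>U. dist y x < e)"
    using small_clopen[OF _ assms] by metis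
  then obtain U where U: "\<And>x. x \<in> X \<Longrightarrow> lc X (\<lambda>y. y \<in> U x) \<and> x \<in> U x \<and> (\<forall>y\<in>U x. dist y x < e)"
    by metis
  have "\<forall>x\<in>X. \<exists>T. open T \<and> x \<in> T \<and> (\<forall>y\<in>T \<inter> X. y \<in> U x)"
    using U unfolding lc_def by metis
  then obtain T where T: "\<And>x. x \<in> X \<Longrightarrow> open (T x) \<and> x \<in> T x \<and> (\<forall>y\<in>T x \<inter> X. y \<in> U x)"
    by metis
  obtain D where D: "D \<subseteq> X" "finite D" "X \<subseteq> (\<Union>x\<in>D. T x)"
    using compactE_image[OF cpt, of X T] T by (metis UN_I subsetI)
  \<comment> \<open>\<open>M y\<close> records membership in every set of the finite subcover.
    Whatever is chosen from \<open>M y\<close> alone is locally constant in \<open>y\<close>, so the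
    overlapping cover need not be made disjoint.\<close>
  define M where "M y = (\<lambda>z\<in>D. y \<in> U z)" for y
  have "lc X M"
    unfolding M_def using D U by (intro lc_finite_family) auto
  define r where "r y = (SOME z. z \<in> D \<and> M y z)" for y
  have "lc X r" unfolding r_def using \<open>lc X M\<close> by (rule lc_comp1)
  have r: "r x \<in> D \<and> M x (r x)" if x: "x \<in> X" for x
  proof -
    obtain z where z: "z \<in> D" "x \<in> T z" using D(3) x by auto
    then have "z \<in> D \<and> M x z" using T D(1) x by (auto simp: M_def)
    then show ?thesis unfolding r_def by (metis (mono_tags, lifting) someI)
  qed
  show thesis
  proof (rule that[OF \<open>lc X r\<close>])
    fix x assume x: "x \<in> X"
    then show "r x \<in> X" using r D by blast
    have "x \<in> U (r x)" using r[OF x] by (auto simp: M_def)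
    then show "dist x (r x) < e" using U[of "r x"] \<open>r x \<in> X\<close> by blast
  qed
qed

lemma lc_fibre_infinite:
  assumes "lc X f" "x \<in> X"
  shows "infinite {y\<in>X. f y = f x}"
proof -
  obtain U where U: "open U" "x \<in> U" "\<And>x'. x' \<in> U \<Longrightarrow> x' \<in> X \<Longrightarrow> f x' = f x"
    using lcE[OF assms] by metis
  have "infinite (X \<inter> U)"
    using perfect[OF assms(2)] U(1,2) by (simp add: islimpt_eq_acc_point Int_commute)
  moreover have "X \<inter> U \<subseteq> {y\<in>X. f y = f x}" using U(3) by auto
  ultimately show ?thesis using finite_subset by blast
qed

lemma lc_injective_on_finite:
  assumes "finite B" "B \<subseteq> X"
  obtains r :: "'a \<Rightarrow> 'a" where "lc X r" "inj_on r B"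
proof -
  obtain e where e: "e > 0" "\<And>u v. u \<in> B \<Longrightarrow> v \<in> B \<Longrightarrow> u \<noteq> v \<Longrightarrow> e \<le> dist u v"
  proof (rule that)
    \<comment> \<open>The entry 1 keeps the set nonempty when \<open>B\<close> has fewer than two
      points.\<close>
    let ?S = "insert 1 ((\<lambda>(u,v). dist u v) ` {(u,v). u \<in> B \<and> v \<in> B \<and> u \<noteq> v})"
    have fin: "finite ?S"
      using assms(1) by (intro finite.insertI finite_imageI) (auto intro: finite_subset[of _ "B \<times> B"])
    show "Min ?S > 0" using fin by (subst Min_gr_iff) auto
    fix u v assume "u \<in> B" "v \<in> B" "u \<noteq> v"
    then have "dist u v \<in> ?S" by auto
    then show "Min ?S \<le> dist u v" using fin Min_le by blast
  qed
  obtain r where r: "lc X r" "\<And>x. x \<in> X \<Longrightarrow> r x \<in> X" "\<And>x. x \<in> X \<Longrightarrow> dist x (r x) < e/2"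
    using fine_lc_map[of "e/2"] e(1) by auto
  have "inj_on r B"
  proof (rule inj_onI, rule ccontr)
    fix u v assume uv: "u \<in> B" "v \<in> B" "r u = r v" "u \<noteq> v"
    then have "e \<le> dist u v" using e(2) by blast
    moreover have "dist u v \<le> dist u (r u) + dist v (r v)"
      by (metis dist_triangle2 uv(3))
    moreover have "dist u (r u) < e/2" "dist v (r v) < e/2" using r(3)[of u] r(3)[of v] assms(2) uv by blast+
    ultimately show False by linarith
  qed
  with r(1) show thesis by (rule that)
qed

text \<open>Perfectness puts \<open>card D\<close> points into the fibre, and a partition that
  separates them is coloured by \<open>D\<close>. In this way a clopen set is cut into a prescribed
  number of nonempty clopen pieces.\<close>

lemma lc_onto_finite:
  assumes "lc X f" "x \<in> X" "finite D" "D \<noteq> {}"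
  obtains k where "lc X k" "k ` {y\<in>X. f y = f x} = D"
proof -
  obtain B where B: "B \<subseteq> {y\<in>X. f y = f x}" "finite B" "card B = card D"
    using infinite_arbitrarily_large[OF lc_fibre_infinite[OF assms(1,2)]] by metis
  obtain j where j: "bij_betw j D B"
    using finite_same_card_bij[OF assms(3) B(2)] B(3) by metis
  obtain d0 where d0: "d0 \<in> D" using assms(4) by blast
  obtain r :: "'a \<Rightarrow> 'a" where r: "lc X r" "inj_on r B"
    using lc_injective_on_finite[of B] B by blast
  define H where "H c = (if \<exists>d\<in>D. c = r (j d) then THE d. d \<in> D \<and> c = r (j d) else d0)" for c
  define k where "k y = H (r y)" for y
  have kj: "k (j d) = d" if "d \<in> D" for d
  proof -
    have "(THE d'. d' \<in> D \<and> r (j d) = r (j d')) = d"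
    proof (rule the_equality)
      fix d' assume d': "d' \<in> D \<and> r (j d) = r (j d')"
      then have "j d = j d'" using inj_onD[OF r(2)] j that by (metis bij_betwE)
      then show "d' = d" using j d' that by (metis bij_betw_inv_into_left)
    qed (use that in simp)
    then show ?thesis unfolding k_def H_def using that by auto
  qed
  have kD: "k y \<in> D" for y
  proof (cases "\<exists>d\<in>D. r y = r (j d)")
    case True
    then obtain d where d: "d \<in> D" "r y = r (j d)" by blast
    then have "k y = k (j d)" unfolding k_def by simp
    then show ?thesis using kj d by simp
  qed (use d0 in \<open>simp add: k_def H_def\<close>)
  have "lc X k"
    unfolding k_def using r(1) by (rule lc_comp1)
  moreover have "k ` {y\<in>X. f y = f x} = D"
  proof
    show "D \<subseteq> k ` {y \<in> X. f y = f x}"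
    proof
      fix d assume d: "d \<in> D"
      then have "j d \<in> {y \<in> X. f y = f x}" using j B(1) by (meson bij_betwE subsetD)
      then show "d \<in> k ` {y \<in> X. f y = f x}" using kj[OF d] by (metis image_eqI)
    qed
  qed (use kD in auto)
  ultimately show thesis using that by blast
qed

end

text \<open>The refinement \<open>f'\<close> on \<open>X\<close> is copied to \<open>Y\<close> by
  cutting each fibre of \<open>g\<close> into one nonempty piece for every value of
  \<open>f'\<close> above it. Equality of the two images is what allows the next step of a
  back-and-forth argument.\<close>

lemma lift_refinement:
  fixes X :: "'a::metric_space set" and Y :: "'b::metric_space set"
  assumes "cantor X" "cantor Y" "lc X f'" "lc Y g" "(\<lambda>x. p (f' x)) ` X = g ` Y"
  obtains g' where "lc Y g'" "g' ` Y = f' ` X" "\<And>y. y \<in> Y \<Longrightarrow> p (g' y) = g y"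
proof -
  interpret X: cantor X by fact
  interpret Y: cantor Y by fact
  define D where "D c = {d \<in> f' ` X. p d = c}" for c
  have finD: "finite (D c)" for c
    using lc_finite_image[OF X.cpt assms(3)] by (simp add: D_def)
  have neD: "D (g y) \<noteq> {}" if "y \<in> Y" for y
  proof -
    have "g y \<in> (\<lambda>x. p (f' x)) ` X" using that assms(5) by auto
    then show ?thesis by (auto simp: D_def)
  qed
  have "\<forall>c\<in>g ` Y. \<exists>k. lc Y k \<and> k ` {y\<in>Y. g y = c} = D c"
  proof
    fix c assume "c \<in> g ` Y"
    then obtain y where y: "y \<in> Y" "c = g y" by blast
    obtain k where "lc Y k" "k ` {y'\<in>Y. g y' = g y} = D (g y)"
      by (fact Y.lc_onto_finite[OF assms(4) y(1) finD neD[OF y(1)]])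
    then show "\<exists>k. lc Y k \<and> k ` {y\<in>Y. g y = c} = D c" using y(2) by blast
  qed
  then obtain k where k: "\<And>c. c \<in> g ` Y \<Longrightarrow> lc Y (k c) \<and> k c ` {y\<in>Y. g y = c} = D c"
    by metis
  define g' where "g' y = k (g y) y" for y
  have g'D: "g' y \<in> D (g y)" if "y \<in> Y" for y
    using k[of "g y"] that unfolding g'_def by blast
  have "lc Y g'"
  proof (rule lcI)
    fix y assume y: "y \<in> Y"
    obtain U where U: "open U" "y \<in> U" "\<And>x'. x' \<in> U \<Longrightarrow> x' \<in> Y \<Longrightarrow> g x' = g y"
      by (fact lcE[OF assms(4) y])
    obtain V where V: "open V" "y \<in> V" "\<And>x'. x' \<in> V \<Longrightarrow> x' \<in> Y \<Longrightarrow> k (g y) x' = k (g y) y"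
      by (fact lcE[OF conjunct1[OF k[OF imageI[OF y]]] y])
    show "\<exists>U. open U \<and> y \<in> U \<and> (\<forall>x'\<in>U \<inter> Y. g' x' = g' y)"
      by (rule exI[of _ "U \<inter> V"]) (use U V in \<open>auto simp: g'_def\<close>)
  qed
  moreover have "g' ` Y = f' ` X"
  proof
    show "g' ` Y \<subseteq> f' ` X" using g'D by (auto simp: D_def)
    show "f' ` X \<subseteq> g' ` Y"
    proof
      fix d assume d: "d \<in> f' ` X"
      then have "p d \<in> g ` Y" using assms(5) by auto
      moreover from d have "d \<in> D (p d)" by (auto simp: D_def)
      ultimately obtain y where "y \<in> Y" "g y = p d" "d = k (p d) y"
        using k[of "p d"] by blast
      then show "d \<in> g' ` Y" unfolding g'_def image_iff by metis
    qed
  qed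
  moreover have "p (g' y) = g y" if "y \<in> Y" for y using g'D[OF that] by (auto simp: D_def)
  ultimately show thesis using that by blast
qed

text \<open>Natural numbers serve as codes so that all successive refinements have one type and can
  be chosen by recursion.\<close>

lemma lc_fine_code:
  fixes X :: "'a::metric_space set"
  assumes "cantor X" "lc X (f :: 'a \<Rightarrow> 'c)" "e > 0"
  obtains f' :: "'a \<Rightarrow> nat" and p where "lc X f'" "\<And>x. x \<in> X \<Longrightarrow> p (f' x) = f x"
    "\<And>x y. x \<in> X \<Longrightarrow> y \<in> X \<Longrightarrow> f' x = f' y \<Longrightarrow> dist x y < e"
proof -
  interpret cantor X by fact
  obtain r where r: "lc X r" "\<And>x. x \<in> X \<Longrightarrow> r x \<in> X" "\<And>x. x \<in> X \<Longrightarrow> dist x (r x) < e/2"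
    using fine_lc_map[of "e/2"] assms(3) by auto
  have l: "lc X (\<lambda>x. (f x, r x))" using lc_comp2[OF assms(2) r(1)] .
  obtain c :: "'c \<times> 'a \<Rightarrow> nat" where c: "inj_on c ((\<lambda>x. (f x, r x)) ` X)"
    using finite_imp_inj_to_nat_seg[OF lc_finite_image[OF cpt l]] by metis
  let ?q = "inv_into ((\<lambda>x. (f x, r x)) ` X) c"
  have q: "?q (c (f x, r x)) = (f x, r x)" if "x \<in> X" for x
    using inv_into_f_f[OF c, of "(f x, r x)"] that by auto
  show thesis
  proof (rule that[of "\<lambda>x. c (f x, r x)" "\<lambda>n. fst (?q n)"])
    show "lc X (\<lambda>x. c (f x, r x))" using lc_comp1[OF l] .
    fix x assume x: "x \<in> X"
    then show "fst (?q (c (f x, r x))) = f x" using q by simp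
    fix y assume y: "y \<in> X" "c (f x, r x) = c (f y, r y)"
    then have "(f x, r x) = (f y, r y)" using q[OF x] q[OF y(1)] by argo
    then have "dist x y \<le> dist x (r x) + dist y (r y)" by (metis dist_triangle2 snd_conv)
    moreover have "dist x (r x) < e/2" "dist y (r y) < e/2" using r(3) x y(1) by blast+
    ultimately show "dist x y < e" by linarith
  qed
qed

text \<open>Copying a partition to the other space gives no control of its mesh there. So one
  refines on \<open>X\<close>, copies to \<open>Y\<close>, refines on \<open>Y\<close> and copies
  back; the final map on \<open>X\<close> still has small mesh because it refines
  \<open>f1\<close>.\<close>

lemma matched_refinement:
  fixes X :: "'a::metric_space set" and Y :: "'b::metric_space set"
    and f :: "'a \<Rightarrow> 'c" and g :: "'b \<Rightarrow> 'c"
  assumes "cantor X" "cantor Y" "lc X f" "lc Y g" "f ` X = g ` Y" "e > 0"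
  obtains f' :: "'a \<Rightarrow> nat" and g' :: "'b \<Rightarrow> nat" and p where "lc X f'" "lc Y g'" "f' ` X = g' ` Y"
    "\<And>x. x \<in> X \<Longrightarrow> p (f' x) = f x" "\<And>y. y \<in> Y \<Longrightarrow> p (g' y) = g y"
    "\<And>x y. x \<in> X \<Longrightarrow> y \<in> X \<Longrightarrow> f' x = f' y \<Longrightarrow> dist x y < e"
    "\<And>x y. x \<in> Y \<Longrightarrow> y \<in> Y \<Longrightarrow> g' x = g' y \<Longrightarrow> dist x y < e"
proof -
  obtain f1 :: "'a \<Rightarrow> nat" and p1 where f1: "lc X f1" "\<And>x. x \<in> X \<Longrightarrow> p1 (f1 x) = f x"
    "\<And>x y. x \<in> X \<Longrightarrow> y \<in> X \<Longrightarrow> f1 x = f1 y \<Longrightarrow> dist x y < e"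
    by (fact lc_fine_code[OF assms(1,3,6)])
  have eq1: "(\<lambda>x. p1 (f1 x)) ` X = g ` Y"
    unfolding assms(5)[symmetric] by (rule image_cong) (auto simp: f1(2))
  obtain g1 where g1: "lc Y g1" "g1 ` Y = f1 ` X" "\<And>y. y \<in> Y \<Longrightarrow> p1 (g1 y) = g y"
    by (fact lift_refinement[OF assms(1,2) f1(1) assms(4) eq1])
  obtain g2 :: "'b \<Rightarrow> nat" and p2 where g2: "lc Y g2" "\<And>x. x \<in> Y \<Longrightarrow> p2 (g2 x) = g1 x"
    "\<And>x y. x \<in> Y \<Longrightarrow> y \<in> Y \<Longrightarrow> g2 x = g2 y \<Longrightarrow> dist x y < e"
    by (fact lc_fine_code[OF assms(2) g1(1) assms(6)])
  have eq2: "(\<lambda>x. p2 (g2 x)) ` Y = f1 ` X"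
    unfolding g1(2)[symmetric] by (rule image_cong) (auto simp: g2(2))
  obtain f2 where f2: "lc X f2" "f2 ` X = g2 ` Y" "\<And>y. y \<in> X \<Longrightarrow> p2 (f2 y) = f1 y"
    by (fact lift_refinement[OF assms(2,1) g2(1) f1(1) eq2])
  show thesis
  proof (rule that[of f2 g2 "\<lambda>n. p1 (p2 n)"])
    fix x y assume "x \<in> X" "y \<in> X" "f2 x = f2 y"
    then show "dist x y < e" using f1(3) f2(3) by metis
  qed (use f1 g1 g2 f2 in auto)
qed

text \<open>Brouwer's theorem that Cantor sets are homeomorphic, relative to given finite clopen partitions.\<close>
theorem cantor_homeomorphism:
  fixes X :: "'a::metric_space set" and Y :: "'b::metric_space set"
    and f :: "'a \<Rightarrow> 'c" and g :: "'b \<Rightarrow> 'c"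
  assumes cX: "cantor X" and cY: "cantor Y" and "lc X f" "lc Y g" "f ` X = g ` Y"
  obtains s where "continuous_on X s" "s ` X = Y" "inj_on s X" "\<And>x. x \<in> X \<Longrightarrow> g (s x) = f x"
proof -
  interpret X: cantor X by fact
  interpret Y: cantor Y by fact
  define good :: "nat \<Rightarrow> ('a \<Rightarrow> nat) \<times> ('b \<Rightarrow> nat) \<Rightarrow> bool" where
    "good n = (\<lambda>(u,v). lc X u \<and> lc Y v \<and> u ` X = v ` Y \<and>
       (\<forall>x\<in>X. \<forall>y\<in>X. u x = u y \<longrightarrow> dist x y < 1/(real n+1)) \<and> (\<forall>x\<in>Y. \<forall>y\<in>Y. v x = v y \<longrightarrow> dist x y < 1/(real n+1)))" for n
  define refines :: "('a \<Rightarrow> nat) \<times> ('b \<Rightarrow> nat) \<Rightarrow> ('a \<Rightarrow> nat) \<times> ('b \<Rightarrow> nat) \<Rightarrow> bool" where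
    "refines = (\<lambda>(u,v) (u',v'). \<exists>p. (\<forall>x\<in>X. p (u' x) = u x) \<and> (\<forall>y\<in>Y. p (v' y) = v y))"
  obtain f0 :: "'a \<Rightarrow> nat" and g0 :: "'b \<Rightarrow> nat" and p0 where 0: "lc X f0" "lc Y g0" "f0 ` X = g0 ` Y"
    "\<And>x. x \<in> X \<Longrightarrow> p0 (f0 x) = f x" "\<And>y. y \<in> Y \<Longrightarrow> p0 (g0 y) = g y"
    "\<And>x y. x \<in> X \<Longrightarrow> y \<in> X \<Longrightarrow> f0 x = f0 y \<Longrightarrow> dist x y < 1"
    "\<And>x y. x \<in> Y \<Longrightarrow> y \<in> Y \<Longrightarrow> g0 x = g0 y \<Longrightarrow> dist x y < 1"
    by (fact matched_refinement[OF assms zero_less_one])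
  have "\<exists>F. F 0 = (f0, g0) \<and> (\<forall>n. good n (F n) \<and> refines (F n) (F (Suc n)))"
  proof -
    have "\<exists>w'. good (Suc n) w' \<and> refines w w'" if "good n w" for w n
    proof -
      obtain u v where w: "w = (u,v)" by fastforce
      have g: "lc X u" "lc Y v" "u ` X = v ` Y" using that by (auto simp: good_def w)
      have pos: "1 / (real (Suc n) + 1) > 0" by simp
      obtain u' :: "'a \<Rightarrow> nat" and v' :: "'b \<Rightarrow> nat" and p where "lc X u'" "lc Y v'" "u' ` X = v' ` Y"
        "\<And>x. x \<in> X \<Longrightarrow> p (u' x) = u x" "\<And>y. y \<in> Y \<Longrightarrow> p (v' y) = v y"
        "\<And>x y. x \<in> X \<Longrightarrow> y \<in> X \<Longrightarrow> u' x = u' y \<Longrightarrow> dist x y < 1 / (real (Suc n) + 1)"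
        "\<And>x y. x \<in> Y \<Longrightarrow> y \<in> Y \<Longrightarrow> v' x = v' y \<Longrightarrow> dist x y < 1 / (real (Suc n) + 1)"
        by (fact matched_refinement[OF cX cY g pos])
      then show ?thesis
        by (intro exI[of _ "(u',v')"]) (auto simp: good_def refines_def w)
    qed
    moreover have "good 0 (f0,g0)" using 0 by (auto simp: good_def)
    ultimately show ?thesis
      using dependent_nat_choice[of "\<lambda>n w. good n w \<and> (n = 0 \<longrightarrow> w = (f0,g0))" "\<lambda>n. refines"]
      by (metis nat.distinct(1))
  qed
  then obtain F where F0: "F 0 = (f0, g0)" and F: "\<And>n. good n (F n)" "\<And>n. refines (F n) (F (Suc n))"
    by blast
  define u where "u n = fst (F n)" for n
  define v where "v n = snd (F n)" for n
  have Fuv: "F n = (u n, v n)" for n by (simp add: u_def v_def)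
  have uv: "lc X (u n)" "lc Y (v n)" "u n ` X = v n ` Y"
    "\<And>x y. x \<in> X \<Longrightarrow> y \<in> X \<Longrightarrow> u n x = u n y \<Longrightarrow> dist x y < 1/(real n+1)"
    "\<And>x y. x \<in> Y \<Longrightarrow> y \<in> Y \<Longrightarrow> v n x = v n y \<Longrightarrow> dist x y < 1/(real n+1)" for n
    using F(1)[of n] by (auto simp: good_def Fuv)
  have small: "\<exists>n. 1/(real n+1) < e" if "e > 0" for e :: real
    using reals_Archimedean[OF that] by (auto simp: inverse_eq_divide add.commute)
  have eqI: "a = b" if "\<And>n. dist a b < 1/(real n+1)" for a b :: "'z::metric_space"
    using small[of "dist a b"] that by (metis less_asym zero_less_dist_iff)
  have down1: "u n x = v n y" if "x \<in> X" "y \<in> Y" "u (Suc n) x = v (Suc n) y" for n x y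
    using F(2)[of n] that by (auto simp: refines_def Fuv)
  have down: "u m x = v m y" if "m \<le> n" "x \<in> X" "y \<in> Y" "u n x = v n y" for m n x y
    using that by (induction n rule: dec_induct) (use down1 in blast)+
  \<comment> \<open>The partner of \<open>x\<close> lies in the cells of \<open>Y\<close> with the
    same labels as the cells of \<open>x\<close>. By \<open>down\<close> these closed nonempty cells
    are nested, and their diameters tend to 0.\<close>
  have ex: "\<exists>y\<in>Y. \<forall>n. u n x = v n y" if x: "x \<in> X" for x
  proof -
    define K where "K n = {y\<in>Y. v n y = u n x}" for n
    have cl: "closed (K n)" for n
      unfolding K_def by (rule lc_closed_fibre[OF Y.cpt uv(2)])
    have "Y \<inter> (\<Inter>n\<in>UNIV. K n) \<noteq> {}"
    proof (rule compact_imp_fip_image[OF Y.cpt])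
      fix I :: "nat set" assume I: "finite I"
      define N where "N = (if I = {} then 0 else Max I)"
      have N: "i \<le> N" if "i \<in> I" for i using that I by (auto simp: N_def)
      have "u N x \<in> v N ` Y" using x uv(3) by blast
      then obtain y where "y \<in> Y" "u N x = v N y" by blast
      then have "y \<in> Y \<inter> (\<Inter>n\<in>I. K n)" using down[of _ N x y] N x by (auto simp: K_def)
      then show "Y \<inter> (\<Inter>n\<in>I. K n) \<noteq> {}" by blast
    qed (use cl in auto)
    then show ?thesis unfolding K_def by fastforce
  qed
  have exX: "\<exists>x\<in>X. \<forall>n. u n x = v n y" if y: "y \<in> Y" for y
  proof -
    define K where "K n = {x\<in>X. u n x = v n y}" for n
    have cl: "closed (K n)" for n
      unfolding K_def by (rule lc_closed_fibre[OF X.cpt uv(1)])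
    have "X \<inter> (\<Inter>n\<in>UNIV. K n) \<noteq> {}"
    proof (rule compact_imp_fip_image[OF X.cpt])
      fix I :: "nat set" assume I: "finite I"
      define N where "N = (if I = {} then 0 else Max I)"
      have N: "i \<le> N" if "i \<in> I" for i using that I by (auto simp: N_def)
      have "v N y \<in> u N ` X" using y uv(3) by blast
      then obtain x where "x \<in> X" "u N x = v N y" by fastforce
      then have "x \<in> X \<inter> (\<Inter>n\<in>I. K n)" using down[of _ N x y] N y by (auto simp: K_def)
      then show "X \<inter> (\<Inter>n\<in>I. K n) \<noteq> {}" by blast
    qed (use cl in auto)
    then show ?thesis by (auto simp: K_def)
  qed
  obtain s where s: "\<And>x. x \<in> X \<Longrightarrow> s x \<in> Y" "\<And>x n. x \<in> X \<Longrightarrow> u n x = v n (s x)"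
    using ex by metis
  show thesis
  proof (rule that[of s])
    show "continuous_on X s"
      unfolding continuous_on_iff
    proof (intro ballI allI impI)
      fix x and e :: real assume x: "x \<in> X" and "e > 0"
      then obtain n where n: "1/(real n+1) < e" using small by blast
      obtain d where d: "d > 0" "\<And>x y. x \<in> X \<Longrightarrow> y \<in> X \<Longrightarrow> dist x y < d \<Longrightarrow> u n x = u n y"
        using lc_uniform[OF X.cpt uv(1)] by metis
      have "dist (s x') (s x) < e" if "x' \<in> X" "dist x' x < d" for x'
      proof -
        have "v n (s x') = v n (s x)" using d(2)[OF that(1) x that(2)] s(2) x that by metis
        then have "dist (s x') (s x) < 1/(real n+1)" using uv(5) s(1) that x by blast
        then show ?thesis using n by linarith
      qed
      then show "\<exists>d>0. \<forall>x'\<in>X. dist x' x < d \<longrightarrow> dist (s x') (s x) < e" using d(1) by blast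
    qed
    show "inj_on s X"
    proof (rule inj_onI)
      fix x y assume xy: "x \<in> X" "y \<in> X" "s x = s y"
      then have "u n x = u n y" for n using s(2) by metis
      then show "x = y" using eqI[of x y] uv(4) xy by blast
    qed
    show "s ` X = Y"
    proof
      show "Y \<subseteq> s ` X"
      proof
        fix y assume y: "y \<in> Y"
        then obtain x where x: "x \<in> X" "\<And>n. u n x = v n y" using exX by blast
        then have "v n (s x) = v n y" for n using s(2) by metis
        then have "s x = y" using eqI[of "s x" y] uv(5) s(1) x(1) y by blast
        then show "y \<in> s ` X" using x by blast
      qed
    qed (use s in auto)
    show "g (s x) = f x" if "x \<in> X" for x
      using s(1)[OF that] s(2)[OF that, of 0] 0(4)[OF that] 0(5)[OF s(1)[OF that]] F0
      by (simp add: u_def v_def)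
  qed
qed

section \<open>Minimal homeomorphisms\<close>

text \<open>The inverse \<open>b\<close> is a parameter, so that \<open>inverse_minsys\<close> makes
  every result available for backward orbits.\<close>

locale minsys = cantor X for X :: "'a::metric_space set" +
  fixes a b :: "'a \<Rightarrow> 'a"
  assumes ca: "continuous_on X a" and cb: "continuous_on X b"
    and aX: "\<And>x. x \<in> X \<Longrightarrow> a x \<in> X" and bX: "\<And>x. x \<in> X \<Longrightarrow> b x \<in> X"
    and ab: "\<And>x. x \<in> X \<Longrightarrow> a (b x) = x" and ba: "\<And>x. x \<in> X \<Longrightarrow> b (a x) = x"
    and minimal: "\<And>C. closed C \<Longrightarrow> C \<subseteq> X \<Longrightarrow> a ` C = C \<Longrightarrow> C = {} \<or> C = X"
begin

lemma inverse_minsys: "minsys X b a"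
proof (unfold_locales)
  fix C assume C: "closed C" "C \<subseteq> X" "b ` C = C"
  have "a ` (b ` C) = C" using C(2) ab by (force simp: image_image)
  then show "C = {} \<or> C = X" using minimal C by metis
qed (use ca cb aX bX ab ba in auto)

lemma funpow_in: "x \<in> X \<Longrightarrow> (a ^^ n) x \<in> X"
  by (induction n) (auto simp: aX)

lemma continuous_funpow: "continuous_on X (a ^^ n)"
proof (induction n)
  case (Suc n)
  have "(a ^^ n) ` X \<subseteq> X" using funpow_in by auto
  then have "continuous_on X (a \<circ> (a ^^ n))"
    using Suc ca continuous_on_compose continuous_on_subset by metis
  then show ?case by simp
qed (simp add: id_def)

lemma lc_funpow: "lc X f \<Longrightarrow> lc X (\<lambda>x. f ((a ^^ n) x))"
  using lc_pullback[OF continuous_funpow, of n X f] funpow_in by auto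

lemma lc_shift: "lc X f \<Longrightarrow> lc X (\<lambda>x. f (a x))"
  using lc_pullback[OF ca, of X f] aX by auto

lemma hits:
  assumes U: "lc X (\<lambda>y. y \<in> U)" "U \<inter> X \<noteq> {}" and x: "x \<in> X"
  shows "\<exists>n. (a ^^ n) x \<in> U"
proof (rule ccontr)
  assume neg: "\<nexists>n. (a ^^ n) x \<in> U"
  define K where "K = {x\<in>X. \<forall>n. (a ^^ n) x \<notin> U}"
  define L where "L n = (a ^^ n) ` K" for n
  have KX: "K \<subseteq> X" by (auto simp: K_def)
  have aK: "a z \<in> K" if "z \<in> K" for z
    using that unfolding K_def by (auto simp: aX) (metis funpow_swap1 funpow.simps(2) o_apply)
  have apK: "(a ^^ n) z \<in> K" if "z \<in> K" for z n using that by (induction n) (auto simp: aK)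
  have "K = X \<inter> (\<Inter>n. {x\<in>X. ((a ^^ n) x \<in> U) = False})" by (auto simp: K_def)
  moreover have "closed {x\<in>X. ((a ^^ n) x \<in> U) = False}" for n
    using lc_closed_fibre[OF cpt lc_funpow[OF U(1), of n], of False] .
  ultimately have "closed K" using compact_imp_closed[OF cpt] by (metis (no_types, lifting) closed_INT closed_Int)
  then have "compact K" using KX cpt compact_Int_closed by (metis inf.absorb_iff2)
  then have cL: "closed (L n)" for n
    unfolding L_def using continuous_on_subset[OF continuous_funpow KX]
    by (intro compact_imp_closed compact_continuous_image)
  have Ldec: "L n \<subseteq> L m" if "m \<le> n" for m n
  proof
    fix z assume "z \<in> L n"
    then obtain k where k: "k \<in> K" "z = (a ^^ n) k" by (auto simp: L_def)
    then have "z = (a ^^ m) ((a ^^ (n - m)) k)" using that by (metis funpow_add le_add_diff_inverse o_apply)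
    then show "z \<in> L m" using apK[OF k(1)] by (auto simp: L_def)
  qed
  have "x \<in> K" using x neg by (simp add: K_def)
  define C where "C = X \<inter> (\<Inter>n\<in>UNIV. L n)"
  have "C \<noteq> {}"
    unfolding C_def
  proof (rule compact_imp_fip_image[OF cpt])
    fix I :: "nat set" assume I: "finite I"
    define N where "N = (if I = {} then 0 else Max I)"
    have N: "i \<le> N" if "i \<in> I" for i using that I by (auto simp: N_def)
    have "(a ^^ N) x \<in> X \<inter> (\<Inter>n\<in>I. L n)"
      using Ldec[OF N] funpow_in[OF x] \<open>x \<in> K\<close> by (auto simp: L_def)
    then show "X \<inter> (\<Inter>n\<in>I. L n) \<noteq> {}" by blast
  qed (use cL in auto)
  have "a ` C = C"
  proof
    show "a ` C \<subseteq> C"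
    proof
      fix w assume "w \<in> a ` C"
      then obtain z where z: "z \<in> X" "\<And>n. z \<in> L n" "w = a z" by (auto simp: C_def)
      have "w \<in> L n" for n
      proof (cases n)
        case 0
        then show ?thesis using z(2)[of 0] z(3) aK by (auto simp: L_def)
      next
        case (Suc m)
        then show ?thesis using z(2)[of m] z(3) by (auto simp: L_def)
      qed
      then show "w \<in> C" using z aX by (auto simp: C_def)
    qed
    show "C \<subseteq> a ` C"
    proof
      fix z assume z: "z \<in> C"
      then have zX: "z \<in> X" by (simp add: C_def)
      have "b z \<in> L n" for n
      proof -
        have "z \<in> L (Suc n)" using z by (auto simp: C_def)
        then obtain k where k: "k \<in> K" "z = a ((a ^^ n) k)" by (auto simp: L_def)
        then have "b z = (a ^^ n) k" using ba funpow_in KX by blast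
        then show ?thesis using k by (auto simp: L_def)
      qed
      then have "b z \<in> C" using bX zX by (auto simp: C_def)
      then show "z \<in> a ` C" using ab[OF zX] by (metis imageI)
    qed
  qed
  moreover have "closed C" unfolding C_def using cL compact_imp_closed[OF cpt] by blast
  moreover have "C \<subseteq> X" by (simp add: C_def)
  ultimately have "C = X" using minimal \<open>C \<noteq> {}\<close> by blast
  moreover have "C \<subseteq> L 0" by (auto simp: C_def)
  then have "C \<subseteq> K" by (simp add: L_def)
  moreover have "K \<inter> U = {}" unfolding K_def by (auto dest: spec[of _ 0])
  ultimately show False using U(2) by blast
qed

text \<open>A periodic orbit is finite, hence closed and invariant, whereas \<open>X\<close> is
  infinite. Absence of periodic points is what permits towers of arbitrary height.\<close>

lemma aperiodic:
  assumes x: "x \<in> X" and "n > 0"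
  shows "(a ^^ n) x \<noteq> x"
proof
  assume eq: "(a ^^ n) x = x"
  define C where "C = (\<lambda>i. (a ^^ i) x) ` {..<n}"
  have "a ` C = C"
  proof
    show "a ` C \<subseteq> C"
    proof
      fix w assume "w \<in> a ` C"
      then obtain i where i: "i < n" "w = (a ^^ Suc i) x" by (auto simp: C_def)
      show "w \<in> C"
      proof (cases "Suc i < n")
        case False
        then have "Suc i = n" using i by simp
        then have "w = (a ^^ 0) x" using i eq by simp
        then show ?thesis unfolding C_def using \<open>n > 0\<close> by (intro image_eqI[of _ _ 0]) auto
      qed (use i in \<open>auto simp: C_def intro: image_eqI[of _ _ "Suc i"]\<close>)
    qed
    show "C \<subseteq> a ` C"
    proof
      fix w assume "w \<in> C"
      then obtain i where i: "i < n" "w = (a ^^ i) x" by (auto simp: C_def)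
      show "w \<in> a ` C"
      proof (cases i)
        case 0
        then have "w = a ((a ^^ (n - 1)) x)" using i eq \<open>n > 0\<close>
          by (metis Suc_diff_1 funpow.simps(1) funpow.simps(2) id_apply o_apply)
        then show ?thesis using \<open>n > 0\<close> by (auto simp: C_def)
      qed (use i in \<open>auto simp: C_def\<close>)
    qed
  qed
  moreover have fin: "finite C" by (simp add: C_def)
  moreover have "C \<subseteq> X" using funpow_in[OF x] by (auto simp: C_def)
  moreover have "C \<noteq> {}" using \<open>n > 0\<close> by (auto simp: C_def)
  ultimately have "C = X" using minimal finite_imp_closed by blast
  then have "finite X" using fin by simp
  moreover have "infinite {y\<in>X. () = ()}" using lc_fibre_infinite[of "\<lambda>_. ()" x] x by simp
  ultimately show False by simp
qed

text \<open>The orbit of \<open>x\<close> enters the clopen fibre of \<open>f\<close> through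
  \<open>y\<close>, and \<open>f\<close> does not change along it.\<close>

lemma invariant_constant:
  assumes "lc X f" "\<And>x. x \<in> X \<Longrightarrow> f (a x) = f x" "x \<in> X" "y \<in> X"
  shows "f x = f y"
proof -
  have *: "lc X (\<lambda>z. z \<in> {z. f z = f y})"
    using lc_comp1[OF assms(1), of "\<lambda>c. c = f y"] by simp
  obtain n where "(a ^^ n) x \<in> {z. f z = f y}"
    using hits[OF * _ assms(3)] assms(4) by blast
  moreover have "f ((a ^^ n) x) = f x" for n
    by (induction n) (auto simp: assms(2) funpow_in[OF assms(3)])
  ultimately show ?thesis by simp
qed

text \<open>A Kakutani--Rokhlin partition: \<open>T x\<close> records the values of \<open>F\<close> along the tower through \<open>x\<close>,
  and \<open>i x\<close> is the level of \<open>x\<close> in it.\<close>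
lemma tower_code:
  assumes F: "lc X F"
  obtains T i c where "lc X T" "lc X i"
    "\<And>x. x \<in> X \<Longrightarrow> i x < length (T x)" "\<And>x. x \<in> X \<Longrightarrow> M \<le> length (T x)" "\<And>x. x \<in> X \<Longrightarrow> T x ! i x = F x"
    "\<And>x. x \<in> X \<Longrightarrow> Suc (i x) < length (T x) \<Longrightarrow> T (a x) = T x \<and> i (a x) = Suc (i x)"
    "\<And>x. x \<in> X \<Longrightarrow> Suc (i x) = length (T x) \<Longrightarrow> i (a x) = 0"
    "\<And>x. x \<in> X \<Longrightarrow> \<exists>y\<in>X. F y = c \<and> F ((a ^^ length (T x)) y) = c \<and> (\<forall>j<length (T x). T x ! j = F ((a ^^ j) y))"
proof -
  interpret inv: minsys X b a by (rule inverse_minsys)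
  obtain x0 where x0: "x0 \<in> X" using ne by blast
  obtain r :: "'a \<Rightarrow> 'a" where r: "lc X r" "inj_on r ((\<lambda>i. (a ^^ i) x0) ` {..M})"
    using lc_injective_on_finite[of "(\<lambda>i. (a ^^ i) x0) ` {..M}"] funpow_in[OF x0] by blast
  \<comment> \<open>The base of the towers: a clopen neighbourhood of \<open>x0\<close> on which
    \<open>F\<close> is constant and to which no point returns before time \<open>M\<close>. The
    point \<open>x0\<close> satisfies the condition because \<open>r\<close> separates its iterates
    up to time \<open>M\<close>.\<close>
  define C where "C = {y\<in>X. F y = F x0 \<and> r y = r x0 \<and> (\<forall>i\<in>{0<..<M}. r ((a ^^ i) y) \<noteq> r x0)}"
  have x0C: "x0 \<in> C"
  proof -
    have "r ((a ^^ i) x0) \<noteq> r x0" if "i \<in> {0<..<M}" for i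
    proof
      assume eq: "r ((a ^^ i) x0) = r x0"
      have "(a ^^ i) x0 = (a ^^ 0) x0"
        by (rule inj_onD[OF r(2)]) (use eq that in \<open>auto intro!: imageI image_eqI[of _ _ "0::nat"]\<close>)
      then show False using aperiodic[OF x0, of i] that by simp
    qed
    then show ?thesis using x0 by (simp add: C_def)
  qed
  have lcC: "lc X (\<lambda>y. y \<in> C)"
  proof -
    have "lc X (\<lambda>y. (F y, r y, \<lambda>i\<in>{0<..<M}. r ((a ^^ i) y)))"
      by (intro lc_comp2[of X _ _ Pair] F r(1) lc_finite_family lc_funpow) simp
    then have "lc X (\<lambda>y. (\<lambda>(u,v,w). u = F x0 \<and> v = r x0 \<and> (\<forall>i\<in>{0<..<M}. w i \<noteq> r x0)) (F y, r y, \<lambda>i\<in>{0<..<M}. r ((a ^^ i) y)))"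
      by (rule lc_comp1)
    then show ?thesis
      unfolding lc_def C_def by (simp del: greaterThanLessThan_iff cong: conj_cong)
  qed
  have CX: "C \<subseteq> X" by (auto simp: C_def)
  have ret: "(a ^^ j) y \<notin> C" if "y \<in> C" "0 < j" "j < M" for y j
    using that by (auto simp: C_def)
  have hitb: "\<exists>n. (b ^^ n) x \<in> C" if "x \<in> X" for x
    using inv.hits[OF lcC _ that] x0C x0 by blast
  have hita: "\<exists>n. (a ^^ Suc n) x \<in> C" if x: "x \<in> X" for x
  proof -
    obtain n where "(a ^^ n) (a x) \<in> C" using hits[OF lcC _ aX[OF x]] x0C x0 by blast
    then show ?thesis by (metis funpow_Suc_right o_apply)
  qed
  \<comment> \<open>\<open>dn x\<close> counts the levels below \<open>x\<close>, back to the last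
    visit to \<open>C\<close>; \<open>up x\<close> counts the levels above \<open>x\<close>, hence
    the \<open>Suc\<close> in its definition: the point after the top lies in \<open>C\<close>
    again.\<close>
  define dn where "dn x = (LEAST n. (b ^^ n) x \<in> C)" for x
  define up where "up x = (LEAST n. (a ^^ Suc n) x \<in> C)" for x
  have lcdn: "lc X dn"
    unfolding dn_def by (rule lc_Least) (use hitb inv.lc_funpow[OF lcC] in auto)
  have lcup: "lc X up"
    unfolding up_def by (rule lc_Least) (use hita lc_funpow[OF lcC] in blast)+
  define base where "base x = (b ^^ dn x) x" for x
  define len where "len x = dn x + up x + 1" for x
  define T where "T x = map (\<lambda>j. F ((a ^^ j) (base x))) [0..<len x]" for x
  have lenT: "length (T x) = len x" for x by (simp add: T_def)
  define G where "G q x = map (\<lambda>j. F ((a ^^ j) ((b ^^ fst q) x))) [0..<snd q]" for q :: "nat \<times> nat" and x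
  have "lc X (\<lambda>x. G (dn x, len x) x)"
  proof (rule lc_param[of X G "\<lambda>x. (dn x, len x)"])
    show "lc X (G q)" for q
      unfolding G_def by (intro lc_map inv.lc_funpow[OF lc_funpow[OF F]])
    show "lc X (\<lambda>x. (dn x, len x))"
      using lc_comp2[OF lcdn lcup, of "\<lambda>d u. (d, d + u + 1)"] by (simp add: len_def)
  qed
  then have lcT: "lc X T" unfolding T_def base_def G_def by simp
  have dnC: "(b ^^ dn x) x \<in> C" if "x \<in> X" for x
    unfolding dn_def using hitb[OF that] by (rule LeastI_ex)
  have upC: "(a ^^ Suc (up x)) x \<in> C" if "x \<in> X" for x
    unfolding up_def using hita[OF that] by (rule LeastI_ex)
  have dnN: "(b ^^ j) x \<notin> C" if "j < dn x" for x j
    using that unfolding dn_def by (rule not_less_Least)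
  have upN: "(a ^^ Suc j) x \<notin> C" if "j < up x" for x j
    using that unfolding up_def by (rule not_less_Least)
  have abp: "(a ^^ n) ((b ^^ n) x) = x" if "x \<in> X" for x n
  proof (induction n)
    case (Suc n)
    have "(a ^^ Suc n) ((b ^^ Suc n) x) = (a ^^ n) (a (b ((b ^^ n) x)))"
      by (metis funpow.simps(2) funpow_Suc_right o_apply)
    then show ?case using Suc ab inv.funpow_in[OF that] by simp
  qed simp
  have orb1: "(a ^^ j) (base x) = (b ^^ (dn x - j)) x" if "x \<in> X" "j \<le> dn x" for x j
  proof -
    have "base x = (b ^^ j) ((b ^^ (dn x - j)) x)"
      unfolding base_def using that by (metis funpow_add le_add_diff_inverse o_apply)
    then show ?thesis using abp inv.funpow_in that by metis
  qed
  have orb2: "(a ^^ (dn x + k)) (base x) = (a ^^ k) x" if "x \<in> X" for x k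
    using orb1[OF that, of "dn x"] by (simp add: funpow_add add.commute[of "dn x"])
  show thesis
  proof (rule that[where c = "F x0", OF lcT lcdn])
    fix x assume x: "x \<in> X"
    have "dn x < len x" by (simp add: len_def)
    then show "dn x < length (T x)" "T x ! dn x = F x"
      using orb1[OF x, of "dn x"] by (simp_all add: T_def)
    have baseC: "base x \<in> C" using dnC[OF x] by (simp add: base_def)
    \<comment> \<open>This return gives two things: the height is at least \<open>M\<close>, and
      \<open>F\<close> takes the same value at the foot of a tower and just after its top.\<close>
    have topC: "(a ^^ len x) (base x) \<in> C"
      using orb2[OF x, of "Suc (up x)"] upC[OF x] by (simp add: len_def)
    show "M \<le> length (T x)"
      using ret[OF baseC, of "len x"] topC by (force simp: lenT len_def not_le)
    show "\<exists>y\<in>X. F y = F x0 \<and> F ((a ^^ length (T x)) y) = F x0 \<and> (\<forall>j<length (T x). T x ! j = F ((a ^^ j) y))"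
      by (rule bexI[of _ "base x"]) (use baseC topC in \<open>auto simp: C_def lenT T_def\<close>)
    show "T (a x) = T x \<and> dn (a x) = Suc (dn x)" if "Suc (dn x) < length (T x)"
    proof -
      have up0: "up x > 0" using that by (simp add: lenT len_def)
      then have axC: "a x \<notin> C" using upN[of 0 x] by simp
      have "(LEAST n. (b ^^ n) (a x) \<in> C) = Suc (LEAST n. (b ^^ Suc n) (a x) \<in> C)"
        by (rule Least_Suc[of _ "Suc (dn x)"]) (use axC dnC[OF x] ba[OF x] in \<open>auto simp: funpow_swap1\<close>)
      moreover have "(b ^^ Suc n) (a x) = (b ^^ n) x" for n
        using ba[OF x] by (simp add: funpow_swap1)
      ultimately have dn: "dn (a x) = Suc (dn x)" unfolding dn_def by simp
      have "(LEAST n. (a ^^ Suc n) x \<in> C) = Suc (LEAST n. (a ^^ Suc (Suc n)) x \<in> C)"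
        by (rule Least_Suc[of _ "up x"]) (use axC upC[OF x] in auto)
      moreover have "(a ^^ Suc (Suc n)) x = (a ^^ Suc n) (a x)" for n
        by (simp add: funpow_swap1)
      ultimately have up: "up x = Suc (up (a x))" unfolding up_def by simp
      have "base (a x) = base x" unfolding base_def dn using ba[OF x] by (simp add: funpow_swap1)
      moreover have "len (a x) = len x" using dn up by (simp add: len_def)
      ultimately show ?thesis using dn by (simp add: T_def)
    qed
    show "dn (a x) = 0" if "Suc (dn x) = length (T x)"
    proof -
      have "up x = 0" using that by (simp add: lenT len_def)
      then have "a x \<in> C" using upC[OF x] by simp
      then show ?thesis unfolding dn_def by (intro Least_eq_0) simp
    qed
  qed
qed

end

section \<open>The twisted cohomological equation over a minimal system\<close>

text \<open>An entry \<open>(d, c)\<close> stands for the isometry that multiplies by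
  \<open>d\<close>, after conjugation if \<open>c\<close> holds. The value at \<open>i\<close> is
  the image of 1 under the first \<open>i\<close> isometries, that is, the exact solution with value
  1 at the foot.\<close>

fun lift_value :: "(complex \<times> bool) list \<Rightarrow> nat \<Rightarrow> complex" where
  "lift_value T 0 = 1"
| "lift_value T (Suc i) = fst (T ! i) * (if snd (T ! i) then cnj (lift_value T i) else lift_value T i)"

text \<open>The effect of the reflections passed so far on angles: starting from
  \<open>cis t\<close> instead of 1 would multiply the value at \<open>i\<close> by
  \<open>cis (lift_sign T i * t)\<close>.\<close>

fun lift_sign :: "(complex \<times> bool) list \<Rightarrow> nat \<Rightarrow> real" where
  "lift_sign T 0 = 1"
| "lift_sign T (Suc i) = (if snd (T ! i) then - lift_sign T i else lift_sign T i)"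

text \<open>The defect at the top of a tower is spread evenly over its levels.\<close>
definition closed_lift :: "(complex \<times> bool) list \<Rightarrow> nat \<Rightarrow> complex" where
  "closed_lift T i = lift_value T i *
     cis (- (lift_sign T i * lift_sign T (length T) * Arg (lift_value T (length T)) * real i / real (length T)))"

lemma lift_sign_square: "lift_sign T i * lift_sign T i = 1"
  by (induction i) auto

lemma abs_lift_sign: "\<bar>lift_sign T i\<bar> = 1"
  by (induction i) auto

lemma norm_lift_value:
  assumes "\<And>q. q \<in> set T \<Longrightarrow> cmod (fst q) = 1" "i \<le> length T"
  shows "cmod (lift_value T i) = 1"
  using assms(2) by (induction i) (auto simp: norm_mult assms(1))

lemma norm_cis_diff: "cmod (cis s - cis t) \<le> \<bar>s - t\<bar>"
proof -
  have "cis s - cis t = cis t * (exp (\<i> * of_real (s - t)) - 1)"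
    by (simp add: cis_conv_exp exp_add[symmetric] algebra_simps)
  then have "cmod (cis s - cis t) = 2 * \<bar>sin ((s - t) / 2)\<bar>"
    using dist_exp_i_1[of "s - t"] by (simp add: norm_mult)
  also have "\<dots> \<le> 2 * \<bar>(s - t) / 2\<bar>"
    using abs_sin_x_le_abs_x[of "(s - t) / 2"] by simp
  finally show ?thesis by simp
qed

text \<open>At the top the two sign factors cancel, so the correction is the inverse of the defect.
  Beginning and ending with 1 lets towers follow each other in any order.\<close>

lemma closed_lift_ends:
  assumes "\<And>q. q \<in> set T \<Longrightarrow> cmod (fst q) = 1" "T \<noteq> []"
  shows "closed_lift T 0 = 1" "closed_lift T (length T) = 1"
proof -
  have "lift_value T (length T) = cis (Arg (lift_value T (length T)))"
    using norm_lift_value[of T "length T", OF assms(1)]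
    by (metis cis_Arg norm_zero order_refl sgn_eq div_by_1 of_real_1 zero_neq_one)
  then show "closed_lift T (length T) = 1"
    using assms(2) by (simp add: closed_lift_def lift_sign_square) (metis cis_mult cis_zero add.right_inverse)
qed (simp add: closed_lift_def)

text \<open>The sign in the correction follows the reflections, so the isometry at level
  \<open>i\<close> carries the correction angle \<open>i * k / n\<close>, up to sign, into the frame
  of level \<open>i + 1\<close>. There it meets the angle \<open>(i + 1) * k / n\<close>, and the
  discrepancy is \<open>\<bar>k\<bar> / n\<close>, where \<open>\<bar>k\<bar>\<close> is the modulus
  of an argument and so at most \<open>pi\<close>.\<close>

lemma closed_lift_step:
  assumes "\<And>q. q \<in> set T \<Longrightarrow> cmod (fst q) = 1" "i < length T"
  shows "cmod (closed_lift T (Suc i) - fst (T ! i) * (if snd (T ! i) then cnj (closed_lift T i) else closed_lift T i))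
    \<le> pi / real (length T)"
proof -
  define n where "n = length T"
  define \<theta> where "\<theta> = Arg (lift_value T n)"
  define k where "k = lift_sign T (Suc i) * lift_sign T n * \<theta>"
  have n: "n > 0" using assms(2) by (auto simp: n_def)
  have "fst (T ! i) * (if snd (T ! i) then cnj (closed_lift T i) else closed_lift T i)
      = lift_value T (Suc i) * cis (- (k * real i / real n))"
    by (simp add: closed_lift_def k_def n_def \<theta>_def cis_cnj)
  moreover have "closed_lift T (Suc i) = lift_value T (Suc i) * cis (- (k * real (Suc i) / real n))"
    by (simp add: closed_lift_def k_def n_def \<theta>_def)
  ultimately have "cmod (closed_lift T (Suc i) - fst (T ! i) * (if snd (T ! i) then cnj (closed_lift T i) else closed_lift T i))
      = cmod (lift_value T (Suc i)) * cmod (cis (- (k * real (Suc i) / real n)) - cis (- (k * real i / real n)))"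
    by (simp add: norm_mult[symmetric] algebra_simps del: lift_value.simps)
  also have "\<dots> \<le> \<bar>- (k * real (Suc i) / real n) - - (k * real i / real n)\<bar>"
    using norm_lift_value[of T "Suc i", OF assms(1)] assms(2)
      norm_cis_diff[of "- (k * real (Suc i) / real n)" "- (k * real i / real n)"]
    by (simp del: lift_value.simps of_nat_Suc)
  also have "- (k * real (Suc i) / real n) - - (k * real i / real n) = - k / real n"
    using n by (simp add: field_simps)
  also have "\<bar>- k / real n\<bar> = \<bar>\<theta>\<bar> / real n"
    using abs_lift_sign by (simp add: k_def abs_mult del: lift_sign.simps)
  also have "\<dots> \<le> pi / real n"
  proof (rule divide_right_mono)
    show "\<bar>\<theta>\<bar> \<le> pi" unfolding \<theta>_def using Arg_bounded[of "lift_value T n"] by auto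
  qed simp
  finally show ?thesis by (simp add: n_def)
qed

context minsys
begin

text \<open>Half of the error is spent on replacing \<open>d\<close> by a locally constant function,
  so that tower words determine it. The other half is the step error \<open>pi / M\<close> on towers
  of height at least \<open>M\<close>, whence the bound \<open>2 * pi / e\<close>. Passing from a
  top to the next foot is harmless, as both values are 1.\<close>

lemma approximate_cohomological_equation:
  assumes d: "continuous_on X d" "\<And>x. x \<in> X \<Longrightarrow> cmod (d x) = 1" and c: "lc X c" and e: "e > 0"
  obtains u where "lc X u" "\<And>x. x \<in> X \<Longrightarrow> cmod (u x) = 1"
    "\<And>x. x \<in> X \<Longrightarrow> cmod (u (a x) - d x * (if c x then cnj (u x) else u x)) < e"
proof -
  obtain \<delta> where \<delta>: "\<delta> > 0" "\<And>x y. x \<in> X \<Longrightarrow> y \<in> X \<Longrightarrow> dist x y < \<delta> \<Longrightarrow> dist (d x) (d y) < e/2"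
    using compact_uniformly_continuous[OF d(1) cpt] e unfolding uniformly_continuous_on_def
    by (metis dist_commute half_gt_zero)
  obtain r where r: "lc X r" "\<And>x. x \<in> X \<Longrightarrow> r x \<in> X" "\<And>x. x \<in> X \<Longrightarrow> dist x (r x) < \<delta>"
    by (fact fine_lc_map[OF \<delta>(1)])
  define F where "F x = (d (r x), c x)" for x
  have F: "lc X F" unfolding F_def using lc_comp2[OF r(1) c, of "\<lambda>u v. (d u, v)"] .
  obtain M :: nat where M: "real M > 2 * pi / e" using reals_Archimedean2 by blast
  have M0: "real M > 0" using M e by (smt (verit) divide_pos_pos pi_gt_zero)
  obtain T i c' where T: "lc X T" "lc X i"
    "\<And>x. x \<in> X \<Longrightarrow> i x < length (T x)" "\<And>x. x \<in> X \<Longrightarrow> M \<le> length (T x)" "\<And>x. x \<in> X \<Longrightarrow> T x ! i x = F x"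
    "\<And>x. x \<in> X \<Longrightarrow> Suc (i x) < length (T x) \<Longrightarrow> T (a x) = T x \<and> i (a x) = Suc (i x)"
    "\<And>x. x \<in> X \<Longrightarrow> Suc (i x) = length (T x) \<Longrightarrow> i (a x) = 0"
    "\<And>x. x \<in> X \<Longrightarrow> \<exists>y\<in>X. F y = c' \<and> F ((a ^^ length (T x)) y) = c' \<and> (\<forall>j<length (T x). T x ! j = F ((a ^^ j) y))"
    by (fact tower_code[OF F])
  have unit: "cmod (fst q) = 1" if x: "x \<in> X" and "q \<in> set (T x)" for x q
  proof -
    obtain j where j: "j < length (T x)" "q = T x ! j" using \<open>q \<in> set (T x)\<close> by (metis in_set_conv_nth)
    obtain y where "y \<in> X" "T x ! j = F ((a ^^ j) y)" using T(8)[OF x] j(1) by blast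
    then show ?thesis using j d(2) r(2) funpow_in by (simp add: F_def)
  qed
  define u where "u x = closed_lift (T x) (i x)" for x
  show thesis
  proof (rule that[of u])
    show "lc X u" unfolding u_def using lc_comp2[OF T(1,2)] .
    fix x assume x: "x \<in> X"
    show "cmod (u x) = 1"
      using norm_lift_value[of "T x" "i x", OF unit[OF x]] T(3)[OF x] by (simp add: u_def closed_lift_def norm_mult)
    have ne: "T z \<noteq> []" if "z \<in> X" for z using T(3)[OF that] by auto
    have "u (a x) = closed_lift (T x) (Suc (i x))"
    proof (cases "Suc (i x) < length (T x)")
      case True
      then show ?thesis using T(6)[OF x] by (simp add: u_def)
    next
      case False
      then have "Suc (i x) = length (T x)" using T(3)[OF x] by simp
      then show ?thesis
        using T(7)[OF x] closed_lift_ends[OF unit[OF x] ne[OF x]] closed_lift_ends(1)[OF unit[OF aX[OF x]] ne[OF aX[OF x]]]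
        by (simp add: u_def)
    qed
    then have "cmod (u (a x) - d (r x) * (if c x then cnj (u x) else u x)) \<le> pi / real (length (T x))"
      using closed_lift_step[OF unit[OF x] T(3)[OF x]] T(5)[OF x] by (auto simp: u_def F_def)
    also have "\<dots> \<le> pi / real M" using T(4)[OF x] M0 by (intro divide_left_mono mult_pos_pos) auto
    also have "\<dots> < e/2" using M M0 e by (simp add: field_simps)
    finally have 1: "cmod (u (a x) - d (r x) * (if c x then cnj (u x) else u x)) < e/2" .
    have "cmod (d (r x) * (if c x then cnj (u x) else u x) - d x * (if c x then cnj (u x) else u x))
        = cmod (d (r x) - d x) * cmod (u x)"
      by (simp add: norm_mult left_diff_distrib[symmetric])
    also have "\<dots> < e/2"
      using \<delta>(2)[OF x r(2)[OF x] r(3)[OF x]] \<open>cmod (u x) = 1\<close> by (simp add: dist_norm norm_minus_commute)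
    finally show "cmod (u (a x) - d x * (if c x then cnj (u x) else u x)) < e"
      using 1 norm_triangle_ineq[of "u (a x) - d (r x) * (if c x then cnj (u x) else u x)"
        "d (r x) * (if c x then cnj (u x) else u x) - d x * (if c x then cnj (u x) else u x)"] by simp
  qed
qed

end

section \<open>Periodic clopen partitions and cohomology classes\<close>

lemma openin_lc_fibre:
  assumes "lc X f"
  shows "openin (top_of_set X) {x\<in>X. f x \<in> A}"
proof (subst openin_subopen, intro ballI)
  fix x assume x: "x \<in> {x\<in>X. f x \<in> A}"
  then obtain U where U: "open U" "x \<in> U" "\<And>x'. x' \<in> U \<Longrightarrow> x' \<in> X \<Longrightarrow> f x' = f x"
    using lcE[OF assms, of x] by blast
  show "\<exists>T. openin (top_of_set X) T \<and> x \<in> T \<and> T \<subseteq> {x \<in> X. f x \<in> A}"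
  proof (intro exI[of _ "X \<inter> U"] conjI subsetI)
    show "openin (top_of_set X) (X \<inter> U)" using U(1) by (rule openin_open_Int)
    show "x \<in> X \<inter> U" using U(2) x by blast
    fix y assume "y \<in> X \<inter> U"
    then have "y \<in> X" "f y = f x" using U(3) by blast+
    then show "y \<in> {x \<in> X. f x \<in> A}" using x by simp
  qed
qed

lemma clopen_lc_fibre:
  assumes "lc X f"
  shows "openin (top_of_set X) {x\<in>X. f x \<in> A}" "closedin (top_of_set X) {x\<in>X. f x \<in> A}"
proof -
  show "openin (top_of_set X) {x\<in>X. f x \<in> A}" using assms by (rule openin_lc_fibre)
  have "X - {x\<in>X. f x \<in> A} = {x\<in>X. f x \<in> - A}" by auto
  then show "closedin (top_of_set X) {x\<in>X. f x \<in> A}"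
    using openin_lc_fibre[OF assms, of "- A"] by (auto simp: closedin_def)
qed

lemma clopen_imp_lc:
  assumes "openin (top_of_set X) U" "closedin (top_of_set X) U"
  shows "lc X (\<lambda>x. x \<in> U)"
proof -
  obtain V where V: "open V" "U = X \<inter> V" using assms(1) by (auto simp: openin_open)
  obtain W where W: "closed W" "U = X \<inter> W" using assms(2) by (auto simp: closedin_closed)
  show ?thesis
  proof (rule lcI)
    fix x assume x: "x \<in> X"
    show "\<exists>T. open T \<and> x \<in> T \<and> (\<forall>x'\<in>T \<inter> X. (x' \<in> U) = (x \<in> U))"
    proof (cases "x \<in> U")
      case True
      then show ?thesis using V by (intro exI[of _ V]) auto
    next
      case False
      then show ?thesis using W x by (intro exI[of _ "- W"]) auto
    qed
  qed
qed

lemma funpow_bij_betw: "bij_betw g Z Z \<Longrightarrow> bij_betw (g ^^ n) Z Z"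
proof (induction n)
  case (Suc n)
  then show ?case unfolding funpow.simps using bij_betw_trans by blast
qed (simp add: bij_betw_def)

text \<open>A cyclic clopen partition is an eigenfunction with values in the integers modulo \<open>p\<close>.\<close>
lemma PS_iff:
  assumes bij: "bij_betw g Z Z" and cont: "continuous_on Z g"
  shows "p \<in> PS Z g \<longleftrightarrow> p \<ge> 1 \<and> (\<exists>k::_ \<Rightarrow> int. lc Z k \<and> (\<forall>z\<in>Z. int p dvd k (g z) - k z - 1))"
proof
  have gZ: "(g ^^ n) z \<in> Z" if "z \<in> Z" for z n
    using funpow_bij_betw[OF bij, of n] that by (meson bij_betwE)
  have ginj: "inj_on (g ^^ n) Z" for n
    using funpow_bij_betw[OF bij, of n] by (simp add: bij_betw_def)
  have gcont: "continuous_on Z (g ^^ n)" for n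
  proof (induction n)
    case (Suc n)
    have "(g ^^ n) ` Z \<subseteq> Z" using gZ by auto
    then have "continuous_on Z (g \<circ> (g ^^ n))"
      using Suc cont continuous_on_compose continuous_on_subset by metis
    then show ?case by simp
  qed (simp add: id_def)
  show "p \<in> PS Z g" if ex: "p \<ge> 1 \<and> (\<exists>k::_ \<Rightarrow> int. lc Z k \<and> (\<forall>z\<in>Z. int p dvd k (g z) - k z - 1))"
  proof -
    obtain k :: "_ \<Rightarrow> int" where p: "p \<ge> 1" and k: "lc Z k" "\<And>z. z \<in> Z \<Longrightarrow> int p dvd k (g z) - k z - 1"
      using ex by blast
    have kn: "int p dvd k ((g ^^ n) z) - k z - int n" if "z \<in> Z" for n z
    proof (induction n)
      case (Suc n)
      have "int p dvd (k (g ((g ^^ n) z)) - k ((g ^^ n) z) - 1) + (k ((g ^^ n) z) - k z - int n)"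
        using Suc k(2)[OF gZ[OF that]] by (intro dvd_add)
      then show ?case by (simp add: algebra_simps)
    qed simp
    define U where "U = {z\<in>Z. k z \<in> {m. int p dvd m}}"
    have img: "(g ^^ i) ` U = {z\<in>Z. int p dvd k z - int i}" for i
    proof
      show "(g ^^ i) ` U \<subseteq> {z\<in>Z. int p dvd k z - int i}"
      proof
        fix w assume "w \<in> (g ^^ i) ` U"
        then obtain z where z: "z \<in> Z" "int p dvd k z" "w = (g ^^ i) z" by (auto simp: U_def)
        have "int p dvd (k w - k z - int i) + k z"
          by (rule dvd_add) (use kn[OF z(1), of i] z in auto)
        then show "w \<in> {z\<in>Z. int p dvd k z - int i}" using z gZ by (simp add: algebra_simps)
      qed
      show "{z\<in>Z. int p dvd k z - int i} \<subseteq> (g ^^ i) ` U"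
      proof
        fix w assume w: "w \<in> {z\<in>Z. int p dvd k z - int i}"
        then obtain z where z: "z \<in> Z" "w = (g ^^ i) z"
          using funpow_bij_betw[OF bij, of i] unfolding bij_betw_def by blast
        have "int p dvd (k w - int i) - (k w - k z - int i)"
          by (rule dvd_diff) (use kn[OF z(1), of i] w z in auto)
        then show "w \<in> (g ^^ i) ` U" using z by (auto simp: U_def)
      qed
    qed
    have eq: "i = j" if "i < p" "j < p" "int p dvd m - int i" "int p dvd m - int j" for i j m
    proof -
      have "int p dvd (m - int j) - (m - int i)" using that(4,3) by (rule dvd_diff)
      then have "int i mod int p = int j mod int p" by (simp add: mod_eq_dvd_iff)
      then show ?thesis using that by simp
    qed
    have "(\<Union>i<p. (g ^^ i) ` U) = Z"
    proof
      show "Z \<subseteq> (\<Union>i<p. (g ^^ i) ` U)"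
      proof
        fix z assume z: "z \<in> Z"
        define i where "i = nat (k z mod int p)"
        have i: "i < p" "int i = k z mod int p" using p by (auto simp: i_def nat_less_iff)
        then have "int p dvd k z - int i" by (simp add: minus_mod_eq_mult_div)
        then show "z \<in> (\<Union>i<p. (g ^^ i) ` U)" using img z i(1) by blast
      qed
    qed (use img in auto)
    moreover have "\<forall>i<p. \<forall>j<p. i \<noteq> j \<longrightarrow> (g ^^ i) ` U \<inter> (g ^^ j) ` U = {}"
      unfolding img using eq by blast
    moreover have "openin (top_of_set Z) U" "closedin (top_of_set Z) U"
      unfolding U_def using clopen_lc_fibre[OF k(1)] by blast+
    ultimately show ?thesis using p unfolding PS_def by blast
  qed
  show "p \<ge> 1 \<and> (\<exists>k::_ \<Rightarrow> int. lc Z k \<and> (\<forall>z\<in>Z. int p dvd k (g z) - k z - 1))" if PS: "p \<in> PS Z g"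
  proof -
    obtain U where p: "p \<ge> 1" and U: "openin (top_of_set Z) U" "closedin (top_of_set Z) U"
      and disj: "\<And>i j. i < p \<Longrightarrow> j < p \<Longrightarrow> i \<noteq> j \<Longrightarrow> (g ^^ i) ` U \<inter> (g ^^ j) ` U = {}"
      and cover: "(\<Union>i<p. (g ^^ i) ` U) = Z"
      using PS unfolding PS_def by blast
    have UZ: "U \<subseteq> Z" using openin_imp_subset[OF U(1)] .
    have lcU: "lc Z (\<lambda>z. z \<in> U)" using clopen_imp_lc[OF U] .
    \<comment> \<open>If the \<open>p\<close>-th iterate of \<open>u\<close> lay in the
      \<open>j\<close>-th image of \<open>U\<close> with \<open>j > 0\<close>, cancelling one
      application of \<open>g\<close> would make the images numbered \<open>p - 1\<close> and
      \<open>j - 1\<close> meet.\<close>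
    have ret: "(g ^^ p) u \<in> U" if u: "u \<in> U" for u
    proof -
      have "(g ^^ p) u \<in> Z" using gZ UZ u by blast
      then have "(g ^^ p) u \<in> (\<Union>i<p. (g ^^ i) ` U)" unfolding cover .
      then obtain j u' where j: "j < p" "u' \<in> U" "(g ^^ p) u = (g ^^ j) u'" by blast
      show ?thesis
      proof (cases j)
        case (Suc i)
        have "g ((g ^^ (p - 1)) u) = g ((g ^^ i) u')"
          using j(3) Suc p by (metis Suc_diff_1 funpow.simps(2) less_eq_Suc_le o_apply One_nat_def)
        then have "(g ^^ (p - 1)) u = (g ^^ i) u'"
          using ginj[of 1] gZ UZ u j(2) by (auto simp: inj_on_def subset_iff)
        then have "(g ^^ (p - 1)) ` U \<inter> (g ^^ i) ` U \<noteq> {}" using u j(2) by blast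
        then show ?thesis using disj[of "p - 1" i] j(1) Suc p by fastforce
      qed (use j in simp)
    qed
    have ex: "\<exists>n. (g ^^ n) z \<in> U" if z: "z \<in> Z" for z
    proof -
      obtain i u where i: "i < p" "u \<in> U" "z = (g ^^ i) u" using cover z by blast
      have "(g ^^ (p - i)) ((g ^^ i) u) = (g ^^ (p - i + i)) u" by (simp only: funpow_add o_apply)
      then have "(g ^^ (p - i)) z = (g ^^ p) u" using i by simp
      then show ?thesis using ret[OF i(2)] by metis
    qed
    \<comment> \<open>The time until the next visit to \<open>U\<close>. Its negative grows by 1 off
      \<open>U\<close> and drops from 0 to \<open>1 - p\<close> on \<open>U\<close>, which is again
      growth by 1 modulo \<open>p\<close>.\<close>
    define n where "n z = (LEAST n. (g ^^ n) z \<in> U)" for z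
    have lcn: "lc Z n"
      unfolding n_def
    proof (rule lc_Least)
      fix i
      have "(g ^^ i) ` Z \<subseteq> Z" using gZ by auto
      then show "lc Z (\<lambda>z. (g ^^ i) z \<in> U)" using lc_pullback[OF gcont _ lcU] by blast
    qed (rule ex)
    have "int p dvd - int (n (g z)) - - int (n z) - 1" if z: "z \<in> Z" for z
    proof (cases "z \<in> U")
      case True
      have "n z = 0" unfolding n_def using True by (intro Least_eq_0) simp
      moreover have "n (g z) = p - 1"
        unfolding n_def
      proof (rule Least_equality)
        show "(g ^^ (p - 1)) (g z) \<in> U"
          using ret[OF True] p by (metis Suc_diff_1 funpow_Suc_right less_eq_Suc_le o_apply One_nat_def)
        fix m assume m: "(g ^^ m) (g z) \<in> U"
        show "p - 1 \<le> m"
        proof (rule ccontr)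
          assume "\<not> p - 1 \<le> m"
          then have mp: "Suc m < p" by simp
          have "(g ^^ Suc m) z \<in> U" using m by (simp add: funpow_swap1)
          then have "(g ^^ 0) ` U \<inter> (g ^^ Suc m) ` U \<noteq> {}" using True by auto
          then show False using disj[of 0 "Suc m"] mp by simp
        qed
      qed
      ultimately show ?thesis using p by (simp add: of_nat_diff)
    next
      case False
      obtain N where N: "(g ^^ N) z \<in> U" using ex[OF z] by blast
      have "(LEAST n. (g ^^ n) z \<in> U) = Suc (LEAST n. (g ^^ Suc n) z \<in> U)"
        by (rule Least_Suc[of _ N]) (use False N in simp_all)
      moreover have "(g ^^ Suc m) z = (g ^^ m) (g z)" for m by (simp add: funpow_swap1)
      ultimately have "n z = Suc (n (g z))" unfolding n_def by simp
      then show ?thesis by simp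
    qed
    moreover have "lc Z (\<lambda>z. - int (n z))" using lc_comp1[OF lcn] .
    ultimately show ?thesis using p by blast
  qed
qed

lemma skew2_bij_betw:
  assumes "bij_betw b Y Y"
  shows "bij_betw (skew2 b q) (Y \<times> {0,1}) (Y \<times> {0,1})"
proof -
  have inj: "inj_on (skew2 b q) (Y \<times> {0,1})"
  proof (rule inj_onI)
    fix z w assume zw: "z \<in> Y \<times> {0,1}" "w \<in> Y \<times> {0,1}" "skew2 b q z = skew2 b q w"
    obtain y k y' k' where e: "z = (y,k)" "w = (y',k')" by fastforce
    have "b y = b y'" using zw e by (simp add: skew2_def)
    then have "y = y'" using zw e assms by (auto simp: bij_betw_def inj_on_def)
    moreover have "(k + q y) mod 2 = (k' + q y) mod 2" using zw e \<open>y = y'\<close> by (simp add: skew2_def)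
    then have "k = k'" using zw e by auto presburger+
    ultimately show "z = w" using e by simp
  qed
  have "skew2 b q ` (Y \<times> {0,1}) = Y \<times> {0,1}"
  proof
    show "skew2 b q ` (Y \<times> {0,1}) \<subseteq> Y \<times> {0,1}"
    proof
      fix w assume "w \<in> skew2 b q ` (Y \<times> {0,1})"
      then obtain y k where "y \<in> Y" "w = (b y, (k + q y) mod 2)" by (auto simp: skew2_def)
      moreover have "(k + q y) mod 2 \<in> {0,1}" by auto
      ultimately show "w \<in> Y \<times> {0,1}" using assms by (auto simp: bij_betw_def)
    qed
    show "Y \<times> {0,1} \<subseteq> skew2 b q ` (Y \<times> {0,1})"
    proof
      fix w assume w: "w \<in> Y \<times> {0::int,1}"
      obtain z l where wl: "w = (z,l)" by fastforce
      then obtain y where y: "y \<in> Y" "z = b y" using w assms by (auto simp: bij_betw_def)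
      have "l = ((l - q y) mod 2 + q y) mod 2" using w wl by auto presburger+
      moreover have "(l - q y) mod 2 \<in> {0,1}" by auto
      ultimately show "w \<in> skew2 b q ` (Y \<times> {0,1})"
        using y wl by (intro image_eqI[of _ _ "(y, (l - q y) mod 2)"]) (auto simp: skew2_def)
    qed
  qed
  then show ?thesis using inj by (simp add: bij_betw_def)
qed

lemma skew2_continuous_on:
  assumes "continuous_on Y b" "lc Y q"
  shows "continuous_on (Y \<times> {0,1}) (skew2 b q)"
proof -
  have "lc (Y \<times> {0,1}) (\<lambda>z. q (fst z))"
    by (rule lc_pullback[OF _ _ assms(2)]) (auto intro: continuous_intros)
  moreover have "lc (Y \<times> {0,1}) (\<lambda>z. snd z :: int)"
    by (intro continuous_on_discrete_imp_lc continuous_intros)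
  ultimately have "lc (Y \<times> {0,1}) (\<lambda>z. (snd z + q (fst z)) mod 2)"
    using lc_comp2[of "Y \<times> {0,1}" "\<lambda>z. snd z" "\<lambda>z. q (fst z)" "\<lambda>u v. (u + v) mod 2"] by simp
  then have "continuous_on (Y \<times> {0,1}) (\<lambda>z. (snd z + q (fst z)) mod 2)" by (rule lc_imp_continuous_on)
  moreover have "continuous_on (Y \<times> {0::int,1}) (\<lambda>z. b (fst z))"
    by (rule continuous_on_compose2[OF assms(1)]) (auto intro: continuous_intros)
  ultimately have "continuous_on (Y \<times> {0,1}) (\<lambda>z. (b (fst z), (snd z + q (fst z)) mod 2))"
    by (intro continuous_on_Pair)
  then show ?thesis by (simp add: skew2_def case_prod_beta')
qed

context minsys
begin

lemma bij_betw_self: "bij_betw a X X"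
  unfolding bij_betw_def inj_on_def image_def using ab ba aX bX by (auto; metis)

lemma inv_into_eq: "x \<in> X \<Longrightarrow> inv_into X a x = b x"
  using bij_betw_inv_into_left[OF bij_betw_self bX] ab by simp

lemma PS_base_iff:
  "p \<in> PS X a \<longleftrightarrow> p \<ge> 1 \<and> (\<exists>k::_ \<Rightarrow> int. lc X k \<and> (\<forall>x\<in>X. int p dvd k (a x) - k x - 1))"
  by (fact PS_iff[OF bij_betw_self ca])

lemma PS_skew2_iff:
  assumes "lc X q"
  shows "p \<in> PS (X \<times> {0,1}) (skew2 a q) \<longleftrightarrow> p \<ge> 1 \<and> (\<exists>k::_ \<Rightarrow> int. lc (X \<times> {0,1}) k \<and>
    (\<forall>z\<in>X \<times> {0,1}. int p dvd k (skew2 a q z) - k z - 1))"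
  by (fact PS_iff[OF skew2_bij_betw[OF bij_betw_self] skew2_continuous_on[OF ca assms]])

text \<open>The forward form of coboundaries suits sums along orbits. The new transfer function is
  \<open>h\<close> composed with \<open>b\<close> or with \<open>a\<close>; written as
  \<open>h\<close> minus or plus \<open>f - g\<close> it is visibly locally constant.\<close>

lemma K0_eq_iff:
  assumes "lc X f" "lc X g"
  shows "K0_eq X a f g \<longleftrightarrow> (\<exists>h::_ \<Rightarrow> int. lc X h \<and> (\<forall>x\<in>X. f x - g x = h (a x) - h x))"
proof
  assume "K0_eq X a f g"
  then obtain h :: "_ \<Rightarrow> int" where h: "lc X h" "\<And>x. x \<in> X \<Longrightarrow> f x - g x = h x - h (b x)"
    unfolding K0_eq_def lc_iff_continuous_on_int by (metis inv_into_eq)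
  have "lc X (\<lambda>x. h x - (f x - g x))" using lc_comp2[OF h(1) lc_comp2[OF assms]] .
  moreover have "f x - g x = (h (a x) - (f (a x) - g (a x))) - (h x - (f x - g x))" if "x \<in> X" for x
    using h(2)[OF aX[OF that]] ba[OF that] by simp
  ultimately show "\<exists>h::_ \<Rightarrow> int. lc X h \<and> (\<forall>x\<in>X. f x - g x = h (a x) - h x)" by blast
next
  assume "\<exists>h::_ \<Rightarrow> int. lc X h \<and> (\<forall>x\<in>X. f x - g x = h (a x) - h x)"
  then obtain h :: "_ \<Rightarrow> int" where h: "lc X h" "\<And>x. x \<in> X \<Longrightarrow> f x - g x = h (a x) - h x" by blast
  have "lc X (\<lambda>x. h x + (f x - g x))" using lc_comp2[OF h(1) lc_comp2[OF assms]] .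
  moreover have "f x - g x = (h x + (f x - g x)) - (h (b x) + (f (b x) - g (b x)))" if "x \<in> X" for x
    using h(2)[OF bX[OF that]] ab[OF that] by simp
  ultimately show "K0_eq X a f g"
    unfolding K0_eq_def lc_iff_continuous_on_int by (metis (no_types, lifting) inv_into_eq)
qed

lemma K0mod2_eq_iff:
  assumes "lc X f" "lc X g"
  shows "K0mod2_eq X a f g \<longleftrightarrow> (\<exists>h::_ \<Rightarrow> int. lc X h \<and> (\<forall>x\<in>X. even (f x - g x - (h (a x) - h x))))"
proof
  assume "K0mod2_eq X a f g"
  then obtain h :: "_ \<Rightarrow> int" where h: "lc X h" "\<And>x. x \<in> X \<Longrightarrow> (f x - g x - (h x - h (b x))) mod 2 = 0"
    unfolding K0mod2_eq_def lc_iff_continuous_on_int by (metis inv_into_eq)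
  have "lc X (\<lambda>x. h x - (f x - g x))" using lc_comp2[OF h(1) lc_comp2[OF assms]] .
  moreover have "even (f x - g x - ((h (a x) - (f (a x) - g (a x))) - (h x - (f x - g x))))" if "x \<in> X" for x
    using h(2)[OF aX[OF that]] ba[OF that] by simp presburger
  ultimately show "\<exists>h::_ \<Rightarrow> int. lc X h \<and> (\<forall>x\<in>X. even (f x - g x - (h (a x) - h x)))" by blast
next
  assume "\<exists>h::_ \<Rightarrow> int. lc X h \<and> (\<forall>x\<in>X. even (f x - g x - (h (a x) - h x)))"
  then obtain h :: "_ \<Rightarrow> int" where h: "lc X h" "\<And>x. x \<in> X \<Longrightarrow> even (f x - g x - (h (a x) - h x))" by blast
  \<comment> \<open>\<open>K0mod2_eq\<close> wants values 0 and 1; only the parity of a transfer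
    function matters, so the remainder modulo 2 serves.\<close>
  define h' where "h' x = (h x + (f x - g x)) mod 2" for x
  have "lc X h'" unfolding h'_def
    using lc_comp2[OF h(1) lc_comp2[OF assms, of "\<lambda>u v. u - v"], of "\<lambda>u v. (u + v) mod 2"] .
  moreover have "h' ` X \<subseteq> {0,1}" by (auto simp: h'_def)
  moreover have "(f x - g x - (h' x - h' (b x))) mod 2 = 0" if "x \<in> X" for x
    using h(2)[OF bX[OF that]] ab[OF that] unfolding h'_def by simp presburger
  ultimately show "K0mod2_eq X a f g"
    unfolding K0mod2_eq_def lc_iff_continuous_on_int by (metis (no_types, lifting) inv_into_eq)
qed

end

section \<open>Subsemigroups of the product of the naturals with the group of order two\<close>

text \<open>The greatest common divisor \<open>q\<close> appears as the least positive difference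
  \<open>x - y\<close> of two elements. With \<open>y = q * m\<close>, any
  \<open>t \<ge> m * m\<close> is \<open>u * m + w\<close> with \<open>w < m \<le> u\<close>, and
  then \<open>q * t = (u - w) * y + w * x\<close>.\<close>

lemma semigroup_multiples:
  fixes S :: "nat set"
  assumes "0 \<in> S" and add: "\<And>x y. x \<in> S \<Longrightarrow> y \<in> S \<Longrightarrow> x + y \<in> S" and "s \<in> S" "s > 0"
  obtains q N where "q \<ge> 1" "\<And>x. x \<in> S \<Longrightarrow> q dvd x" "\<And>x. x \<ge> N \<Longrightarrow> q dvd x \<Longrightarrow> x \<in> S"
proof -
  have mult: "k * x \<in> S" if "x \<in> S" for k x using that assms(1) by (induction k) (auto intro: add)
  define q where "q = (LEAST q. q > 0 \<and> (\<exists>x\<in>S. \<exists>y\<in>S. x = y + q))"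
  have "\<exists>q. q > 0 \<and> (\<exists>x\<in>S. \<exists>y\<in>S. x = y + q)" using assms by (metis add_0)
  then have q: "q > 0 \<and> (\<exists>x\<in>S. \<exists>y\<in>S. x = y + q)" unfolding q_def by (rule LeastI_ex)
  then obtain x1 y1 where xy1: "x1 \<in> S" "y1 \<in> S" "x1 = y1 + q" by blast
  \<comment> \<open>Adding \<open>s\<close> keeps the difference and makes \<open>y\<close>
    positive, as division by \<open>m\<close> requires.\<close>
  define x y where "x = x1 + s" and "y = y1 + s"
  have xy: "x \<in> S" "y \<in> S" "x = y + q" "y > 0" using xy1 assms(3,4) add by (auto simp: x_def y_def)
  have min: "q \<le> r" if "r > 0" "u \<in> S" "v \<in> S" "u = v + r" for r u v
    unfolding q_def by (rule Least_le) (use that in blast)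
  have dvd: "q dvd z" if z: "z \<in> S" for z
  proof (rule ccontr)
    assume "\<not> q dvd z"
    then have r: "z mod q > 0" by (simp add: mod_greater_zero_iff_not_dvd)
    define k where "k = z div q"
    have "z + k * y = k * x + z mod q"
      using xy(3) div_mult_mod_eq[of z q] by (simp add: k_def algebra_simps)
    then have "q \<le> z mod q" using min[OF r, of "z + k * y" "k * x"] z mult xy add by blast
    then show False using q mod_less_divisor[of q z] by linarith
  qed
  obtain m where m: "y = q * m" using dvd[OF xy(2)] by (auto simp: dvd_def)
  show thesis
  proof (rule that[of q "q * (m * m)"])
    show "q \<ge> 1" using q by simp
    show "q dvd z" if "z \<in> S" for z using dvd that by blast
    fix z assume z: "z \<ge> q * (m * m)" "q dvd z"
    then obtain t where t: "z = q * t" by (auto simp: dvd_def)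
    then have tm: "t \<ge> m * m" using z q by simp
    have m0: "m > 0" using m xy(4) by (metis bot_nat_0.not_eq_extremum mult_0_right)
    define u w where "u = t div m" and "w = t mod m"
    have tuw: "t = u * m + w" by (simp add: u_def w_def)
    have "w < m" using m0 by (simp add: w_def)
    have "m \<le> u" unfolding u_def using tm m0 by (simp add: less_eq_div_iff_mult_less_eq)
    then obtain l where l: "u = w + l" using \<open>w < m\<close> by (metis le_add_diff_inverse less_imp_le order_trans)
    have "z = l * y + w * x" unfolding t tuw l xy(3) m by (simp add: algebra_simps)
    then show "z \<in> S" using mult xy add by simp
  qed
qed

text \<open>The lengths with even orientation form a semigroup with period \<open>q\<close>. Two odd
  pairs add up to an even one, so \<open>q\<close> divides \<open>2 * L1\<close> for an odd pair of
  length \<open>L1\<close>. If \<open>q\<close> divides \<open>L1\<close>, both orientations occur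
  at all large multiples of \<open>q\<close>; otherwise \<open>q = 2 * p\<close> and the odd pairs
  sit at odd multiples of \<open>p\<close>.\<close>

lemma parity_semigroup_cases:
  fixes S :: "nat \<Rightarrow> bool \<Rightarrow> bool"
  assumes S0: "S 0 False" and add: "\<And>L e M f. S L e \<Longrightarrow> S M f \<Longrightarrow> S (L + M) (e \<noteq> f)"
    and pos: "S s e" "s > 0"
  obtains
    (even) p N where "p \<ge> 1" "\<And>L e. S L e \<Longrightarrow> p dvd L \<and> \<not> e" "\<And>L. L \<ge> N \<Longrightarrow> p dvd L \<Longrightarrow> S L False"
  | (free) p N where "p \<ge> 1" "\<And>L e. S L e \<Longrightarrow> p dvd L" "\<And>L e. L \<ge> N \<Longrightarrow> p dvd L \<Longrightarrow> S L e"
  | (linked) p N where "p \<ge> 1" "\<And>L e. S L e \<Longrightarrow> p dvd L \<and> e = odd (L div p)"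
      "\<And>L. L \<ge> N \<Longrightarrow> p dvd L \<Longrightarrow> S L (odd (L div p))"
proof -
  have "S (s + s) False" using add[OF pos(1) pos(1)] by simp
  then obtain q N where q: "q \<ge> 1" "\<And>L. S L False \<Longrightarrow> q dvd L" "\<And>L. L \<ge> N \<Longrightarrow> q dvd L \<Longrightarrow> S L False"
    using semigroup_multiples[of "{L. S L False}" "s + s"] S0 add[of _ False _ False] pos(2)
    by (metis add_gr_0 mem_Collect_eq)
  show thesis
  proof (cases "\<exists>L. S L True")
    case False
    show thesis
    proof (rule even[of q N])
      fix L e assume "S L e"
      then show "q dvd L \<and> \<not> e" using False q(2) by (cases e) auto
    qed (use q in auto)
  next
    case True
    then obtain L1 where L1: "S L1 True" by blast
    have sum: "q dvd L + L1" if "S L True" for L using add[OF that L1] q(2) by simp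
    show thesis
    proof (cases "q dvd L1")
      case True
      show thesis
      proof (rule free[of q "N + L1"])
        fix L e assume "S L e"
        then show "q dvd L" using q(2) sum[of L] True by (cases e) (auto simp: dvd_add_left_iff)
      next
        fix L e assume L: "N + L1 \<le> L" "q dvd L"
        then have "S (L - L1) False" using q(3)[of "L - L1"] True by (simp add: dvd_diff_nat)
        then have "S (L - L1 + L1) True" using add L1 by fastforce
        then show "S L e" using q(3)[of L] L by (cases e) auto
      qed (use q in auto)
    next
      case False
      \<comment> \<open>\<open>L1\<close> is half of \<open>q * k\<close>. Since \<open>q\<close>
        does not divide \<open>L1\<close>, the factor \<open>k\<close> is odd and \<open>q\<close>
        is even.\<close>
      obtain k where k: "L1 + L1 = q * k" using sum[OF L1] by (auto simp: dvd_def)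
      have "odd k"
      proof
        assume "even k"
        then obtain j where "k = 2 * j" by blast
        then have "L1 = q * j" using k by simp
        then show False using False by simp
      qed
      then have "even q" using k by (metis even_add even_mult_iff)
      then obtain p where p: "q = 2 * p" by blast
      have L1p: "L1 = p * k" using k p by simp
      have p1: "p \<ge> 1" using q(1) p by simp
      show thesis
      proof (rule linked[of p "N + L1"])
        fix L e assume S: "S L e"
        show "p dvd L \<and> e = odd (L div p)"
        proof (cases e)
          case True
          then obtain j where "L + p * k = 2 * p * j" using sum[of L] S L1p p by (auto simp: dvd_def)
          then have "L = p * (2 * j - k)" by (metis add_diff_cancel_right' diff_mult_distrib2 mult.assoc mult.left_commute)
          moreover have "odd (2 * j - k)"
          proof -
            have "p * k \<le> p * (2 * j)" using \<open>L + p * k = 2 * p * j\<close> by (metis le_add2 mult.assoc mult.left_commute)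
            then have "k \<le> 2 * j" using p1 by simp
            then show ?thesis using \<open>odd k\<close> by simp
          qed
          ultimately show ?thesis using True p1 by simp
        next
          case False
          then obtain j where "L = 2 * p * j" using q(2)[of L] S p by (auto simp: dvd_def)
          then have "L = p * (2 * j)" by simp
          then show ?thesis using False p1 by simp
        qed
      next
        fix L assume L: "N + L1 \<le> L" "p dvd L"
        then obtain j where j: "L = p * j" by (auto simp: dvd_def)
        show "S L (odd (L div p))"
        proof (cases "even j")
          case True
          then have "q dvd L" using j p by (auto simp: dvd_def)
          then show ?thesis using q(3)[of L] L True j p1 by simp
        next
          case False
          have "k \<le> j" using L j L1p p1 by (metis add_leD2 mult_le_cancel1 less_eq_Suc_le One_nat_def)
          then have "L - L1 = p * (j - k)" using j L1p by (simp add: diff_mult_distrib2)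
          moreover have "even (j - k)" using False \<open>odd k\<close> \<open>k \<le> j\<close> by simp
          ultimately have "q dvd L - L1" using p by (auto simp: dvd_def)
          then have "S (L - L1) False" using q(3) L by simp
          then have "S (L - L1 + L1) True" using add L1 by fastforce
          then show ?thesis using L False j p1 by simp
        qed
      qed (use p1 in auto)
    qed
  qed
qed

section \<open>Walks in a directed graph\<close>

text \<open>The list holds the vertices that are left, without the final one. So its length is the
  number of edges, and composition of walks is \<open>@\<close>.\<close>

fun walk :: "('v \<Rightarrow> 'v \<Rightarrow> bool) \<Rightarrow> 'v \<Rightarrow> 'v list \<Rightarrow> 'v \<Rightarrow> bool" where
  "walk E v [] w \<longleftrightarrow> v = w"
| "walk E v (u # us) w \<longleftrightarrow> u = v \<and> (\<exists>v'. E v v' \<and> walk E v' us w)"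

lemma walk_append: "walk E v us w \<Longrightarrow> walk E w ws z \<Longrightarrow> walk E v (us @ ws) z"
  by (induction us arbitrary: v) auto

lemma walk_hd: "walk E v us w \<Longrightarrow> us \<noteq> [] \<Longrightarrow> us ! 0 = v"
  by (cases us) auto

lemma walk_edge: "walk E v us w \<Longrightarrow> Suc i < length us \<Longrightarrow> E (us ! i) (us ! Suc i)"
proof (induction us arbitrary: v i)
  case (Cons u us)
  then obtain v' where v': "u = v" "E v v'" "walk E v' us w" by auto
  show ?case
  proof (cases i)
    case 0
    then show ?thesis using v' walk_hd[OF v'(3)] Cons.prems by auto
  next
    case (Suc j)
    then show ?thesis using Cons.IH[OF v'(3), of j] Cons.prems by auto
  qed
qed simp

lemma walk_last_edge: "walk E v us w \<Longrightarrow> Suc i = length us \<Longrightarrow> E (us ! i) w"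
proof (induction us arbitrary: v i)
  case (Cons u us)
  then obtain v' where v': "u = v" "E v v'" "walk E v' us w" by auto
  show ?case
  proof (cases i)
    case 0
    then show ?thesis using v' Cons.prems by auto
  next
    case (Suc j)
    then have "E (us ! j) w" using Cons.IH[OF v'(3), of j] Cons.prems(2) by simp
    then show ?thesis unfolding Suc nth_Cons_Suc .
  qed
qed simp

lemma walk_potential:
  fixes F k :: "'v \<Rightarrow> int"
  assumes "\<And>v w. E v w \<Longrightarrow> F v = k w - k v" "walk E v us w"
  shows "sum_list (map F us) = k w - k v"
  using assms(2)
proof (induction us arbitrary: v)
  case (Cons u us)
  then obtain v' where v': "u = v" "E v v'" "walk E v' us w" by auto
  then show ?case using Cons.IH[OF v'(3)] assms(1)[OF v'(2)] by simp
qed simp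

lemma walk_potential_parity:
  fixes F k :: "'v \<Rightarrow> int"
  assumes "\<And>v w. E v w \<Longrightarrow> even (F v - (k w - k v))" "walk E v us w"
  shows "even (sum_list (map F us) - (k w - k v))"
  using assms(2)
proof (induction us arbitrary: v)
  case (Cons u us)
  then obtain v' where v': "u = v" "E v v'" "walk E v' us w" by auto
  have "even ((sum_list (map F us) - (k w - k v')) + (F v - (k v' - k v)))"
    using Cons.IH[OF v'(3)] assms(1)[OF v'(2)] by (intro dvd_add)
  moreover have "(sum_list (map F us) - (k w - k v')) + (F v - (k v' - k v)) = sum_list (map F (u # us)) - (k w - k v)"
    using v'(1) by simp
  ultimately show ?case by metis
qed simp

section \<open>Labelling towers by closed walks\<close>

context minsys
begin

lemma orbit_potential:
  fixes F k :: "'a \<Rightarrow> int"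
  assumes "\<And>x. x \<in> X \<Longrightarrow> F x = k (a x) - k x" "x \<in> X"
  shows "(\<Sum>j<n. F ((a ^^ j) x)) = k ((a ^^ n) x) - k x"
  by (induction n) (auto simp: assms(1)[OF funpow_in[OF assms(2)]])

lemma orbit_potential_parity:
  fixes F k :: "'a \<Rightarrow> int"
  assumes "\<And>x. x \<in> X \<Longrightarrow> even (F x - (k (a x) - k x))" "x \<in> X"
  shows "even ((\<Sum>j<n. F ((a ^^ j) x)) - (k ((a ^^ n) x) - k x))"
proof (induction n)
  case (Suc n)
  have "even (F ((a ^^ n) x) - (k (a ((a ^^ n) x)) - k ((a ^^ n) x)))"
    using assms(1)[OF funpow_in[OF assms(2)]] .
  with Suc show ?case by simp presburger
qed simp

lemma orbit_cyclic:
  assumes "\<And>x. x \<in> X \<Longrightarrow> int p dvd k (a x) - k x - 1" "x \<in> X"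
  shows "int p dvd k ((a ^^ n) x) - k x - int n"
proof (induction n)
  case (Suc n)
  have "int p dvd (k (a ((a ^^ n) x)) - k ((a ^^ n) x) - 1) + (k ((a ^^ n) x) - k x - int n)"
    by (rule dvd_add[OF assms(1)[OF funpow_in[OF assms(2)]] Suc])
  then show ?case by (simp add: algebra_simps)
qed simp

definition step :: "('a \<Rightarrow> 'v) \<Rightarrow> 'v \<Rightarrow> 'v \<Rightarrow> bool" where
  "step r v w \<longleftrightarrow> (\<exists>x\<in>X. r x = v \<and> r (a x) = w)"

lemma stepI: "x \<in> X \<Longrightarrow> step r (r x) (r (a x))"
  by (auto simp: step_def)

lemma walk_orbit: "x \<in> X \<Longrightarrow> walk (step r) (r x) (map (\<lambda>i. r ((a ^^ i) x)) [0..<n]) (r ((a ^^ n) x))"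
proof (induction n)
  case (Suc n)
  have "walk (step r) (r ((a ^^ n) x)) [r ((a ^^ n) x)] (r ((a ^^ Suc n) x))"
    using stepI[OF funpow_in[OF Suc.prems]] by auto
  from walk_append[OF Suc.IH[OF Suc.prems] this] show ?case by simp
qed simp

lemma walk_between:
  assumes "lc X r" "x \<in> X" "y \<in> X"
  obtains us where "walk (step r) (r x) us (r y)"
proof -
  have *: "lc X (\<lambda>z. z \<in> {z. r z = r y})"
    using lc_comp1[OF assms(1), of "\<lambda>c. c = r y"] by simp
  obtain n where "(a ^^ n) x \<in> {z. r z = r y}"
    using hits[OF * _ assms(2)] assms(3) by blast
  then show thesis using walk_orbit[OF assms(2), of r n] that by simp
qed

lemma closed_walk_through:
  assumes "lc X r" "x \<in> X" "z \<in> X"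
  obtains us where "walk (step r) (r x) us (r x)" "r z \<in> set us"
proof -
  obtain us where us: "walk (step r) (r x) us (r z)" by (fact walk_between[OF assms])
  obtain vs where vs: "walk (step r) (r (a z)) vs (r x)" by (fact walk_between[OF assms(1) aX[OF assms(3)] assms(2)])
  have "walk (step r) (r z) (r z # vs) (r x)" using stepI[OF assms(3), of r] vs by auto
  from walk_append[OF us this] show thesis using that by fastforce
qed

text \<open>Loops through the finitely many cells are concatenated. A tour contained in every label
  forces the labelling to attain every cell, which is needed for surjectivity onto the
  partition.\<close>

lemma closed_walk_tour:
  assumes "lc X r" "x \<in> X"
  obtains us where "walk (step r) (r x) us (r x)" "r ` X \<subseteq> set us"
proof -
  have "\<exists>us. walk (step r) (r x) us (r x) \<and> W \<subseteq> set us" if "finite W" "W \<subseteq> r ` X" for W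
    using that
  proof (induction W)
    case empty
    show ?case by (rule exI[of _ "[]"]) simp
  next
    case (insert v W)
    then obtain us where us: "walk (step r) (r x) us (r x)" "W \<subseteq> set us" by blast
    obtain z where z: "z \<in> X" "v = r z" using insert by blast
    obtain vs where vs: "walk (step r) (r x) vs (r x)" "r z \<in> set vs"
      by (fact closed_walk_through[OF assms z(1)])
    show ?case
      by (rule exI[of _ "us @ vs"]) (use walk_append[OF us(1) vs(1)] us vs z in auto)
  qed
  from this[OF lc_finite_image[OF cpt assms(1)]] show thesis using that by blast
qed

text \<open>The image of a top has level 0, so going back by \<open>b\<close> from a positive level
  stays in the same tower. One descends to level 0 and climbs to \<open>j\<close> with
  \<open>a\<close>.\<close>

lemma tower_levels:
  assumes T: "\<And>x. x \<in> X \<Longrightarrow> i x < length (T x)"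
    "\<And>x. x \<in> X \<Longrightarrow> Suc (i x) < length (T x) \<Longrightarrow> T (a x) = T x \<and> i (a x) = Suc (i x)"
    "\<And>x. x \<in> X \<Longrightarrow> Suc (i x) = length (T x) \<Longrightarrow> i (a x) = 0"
    and x: "x \<in> X" and j: "j < length (T x)"
  shows "\<exists>z\<in>X. T z = T x \<and> i z = j"
proof -
  have "\<exists>z\<in>X. T z = T x \<and> i z = i x - k" for k
  proof (induction k)
    case 0
    then show ?case using x by auto
  next
    case (Suc k)
    then obtain z where z: "z \<in> X" "T z = T x" "i z = i x - k" by blast
    show ?case
    proof (cases "i z")
      case 0
      then show ?thesis using z by (intro bexI[of _ z]) auto
    next
      case (Suc m)
      have bz: "b z \<in> X" "a (b z) = z" using z ab bX by auto
      have "Suc (i (b z)) \<noteq> length (T (b z))" using T(3)[OF bz(1)] bz(2) Suc by auto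
      then have "T z = T (b z)" "i z = Suc (i (b z))" using T(1,2)[OF bz(1)] bz(2) by auto
      then show ?thesis using z bz by (intro bexI[of _ "b z"]) auto
    qed
  qed
  from this[of "i x"] obtain y where y: "y \<in> X" "T y = T x" "i y = 0" by auto
  show ?thesis using j
  proof (induction j)
    case 0
    then show ?case using y by blast
  next
    case (Suc j)
    then obtain z where z: "z \<in> X" "T z = T x" "i z = j" by auto
    then show ?case using T(2)[OF z(1)] Suc.prems aX by (intro bexI[of _ "a z"]) auto
  qed
qed

text \<open>A tower is a return word to a fibre of \<open>F\<close>, so its length and the parity of
  its sum of \<open>p\<close> form a pair in \<open>A\<close>. Subtracting the tour leaves a pair in
  \<open>A\<close> of length at least \<open>N\<close>, which a closed walk realises; that walk
  followed by the tour labels the tower. As all labels start and end at \<open>v0\<close>, they fit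
  together across towers.\<close>

lemma tower_labelling:
  fixes E :: "'v \<Rightarrow> 'v \<Rightarrow> bool" and Q :: "'v \<Rightarrow> int" and p :: "'a \<Rightarrow> int"
  assumes p: "lc X p"
    and tour: "walk E v0 ws v0" "V \<subseteq> set ws"
    and A1: "\<And>us. walk E v0 us v0 \<Longrightarrow> A (length us) (odd (sum_list (map Q us)))"
    and A2: "\<And>L e. L \<ge> N \<Longrightarrow> A L e \<Longrightarrow> \<exists>us. walk E v0 us v0 \<and> length us = L \<and> odd (sum_list (map Q us)) = e"
    and A3: "\<And>L e M f. A (L + M) (e \<noteq> f) \<Longrightarrow> A M f \<Longrightarrow> A L e"
    and F: "lc X F" "\<And>y n. y \<in> X \<Longrightarrow> F ((a ^^ n) y) = F y \<Longrightarrow> A n (odd (\<Sum>j<n. p ((a ^^ j) y)))"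
  obtains P h where "lc X P" "lc X (h :: 'a \<Rightarrow> int)" "\<And>x. x \<in> X \<Longrightarrow> E (P x) (P (a x))"
    "\<And>x. x \<in> X \<Longrightarrow> even (Q (P x) - p x - (h (a x) - h x))" "V \<subseteq> P ` X"
proof -
  define F' where "F' x = (F x, p x)" for x
  have F': "lc X F'" unfolding F'_def using lc_comp2[OF F(1) p] .
  define M where "M = N + length ws + 1"
  obtain T i c where T: "lc X T" "lc X i"
    "\<And>x. x \<in> X \<Longrightarrow> i x < length (T x)" "\<And>x. x \<in> X \<Longrightarrow> M \<le> length (T x)" "\<And>x. x \<in> X \<Longrightarrow> T x ! i x = F' x"
    "\<And>x. x \<in> X \<Longrightarrow> Suc (i x) < length (T x) \<Longrightarrow> T (a x) = T x \<and> i (a x) = Suc (i x)"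
    "\<And>x. x \<in> X \<Longrightarrow> Suc (i x) = length (T x) \<Longrightarrow> i (a x) = 0"
    "\<And>x. x \<in> X \<Longrightarrow> \<exists>y\<in>X. F' y = c \<and> F' ((a ^^ length (T x)) y) = c \<and> (\<forall>j<length (T x). T x ! j = F' ((a ^^ j) y))"
    by (fact tower_code[OF F'])
  define good where "good us t \<longleftrightarrow> walk E v0 us v0 \<and> length us = length t \<and>
    even (sum_list (map Q us) - sum_list (map snd t)) \<and> V \<subseteq> set us" for us and t :: "('b \<times> int) list"
  have ex: "\<exists>us. good us (T x)" if x: "x \<in> X" for x
  proof -
    define L where "L = length (T x)"
    obtain y where y: "y \<in> X" "F' y = c" "F' ((a ^^ L) y) = c" "\<And>j. j < L \<Longrightarrow> T x ! j = F' ((a ^^ j) y)"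
      using T(8)[OF x] unfolding L_def by blast
    have "F ((a ^^ L) y) = F y" using y(2,3) by (auto simp: F'_def)
    then have A: "A L (odd (\<Sum>j<L. p ((a ^^ j) y)))" using F(2) y(1) by blast
    have "sum_list (map snd (T x)) = (\<Sum>j<L. snd (T x ! j))"
      by (simp add: sum_list_sum_nth L_def atLeast0LessThan)
    also have "\<dots> = (\<Sum>j<L. p ((a ^^ j) y))" by (rule sum.cong) (auto simp: y(4) F'_def)
    finally have sum: "sum_list (map snd (T x)) = (\<Sum>j<L. p ((a ^^ j) y))" .
    define e where "e = odd (sum_list (map snd (T x)))"
    define f where "f = odd (sum_list (map Q ws))"
    have LM: "L \<ge> N + length ws" using T(4)[OF x] by (simp add: L_def M_def)
    \<comment> \<open>Inequality of truth values is addition in the group of order two, so adding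
      \<open>f\<close> twice restores \<open>e\<close>.\<close>
    have "A ((L - length ws) + length ws) ((e \<noteq> f) \<noteq> f)" using A LM sum by (cases f) (auto simp: e_def)
    then have "A (L - length ws) (e \<noteq> f)" using A3 A1[OF tour(1)] unfolding f_def by blast
    moreover have "N \<le> L - length ws" using LM by simp
    ultimately obtain us where us: "walk E v0 us v0" "length us = L - length ws" "odd (sum_list (map Q us)) = (e \<noteq> f)"
      using A2 by blast
    have "good (us @ ws) (T x)"
      unfolding good_def
    proof (intro conjI)
      show "walk E v0 (us @ ws) v0" using walk_append[OF us(1) tour(1)] .
      show "length (us @ ws) = length (T x)" using us(2) LM by (simp add: L_def)
      show "V \<subseteq> set (us @ ws)" using tour(2) by auto
      show "even (sum_list (map Q (us @ ws)) - sum_list (map snd (T x)))"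
        using us(3) by (auto simp: e_def f_def)
    qed
    then show ?thesis by blast
  qed
  \<comment> \<open>One label for each tower word, not for each point: this makes \<open>P\<close>
    locally constant and consistent along a tower.\<close>
  define W where "W t = (SOME us. good us t)" for t
  have W: "good (W (T x)) (T x)" if "x \<in> X" for x
    unfolding W_def using ex[OF that] by (rule someI_ex)
  define P where "P x = W (T x) ! i x" for x
  \<comment> \<open>The discrepancy between \<open>Q\<close> and \<open>p\<close> accumulated below
    level \<open>n\<close>. It is even at the top, so restarting from 0 at the next foot is correct
    modulo two.\<close>
  define H where "H t n = (\<Sum>j<n. Q (W t ! j) - snd (t ! j))" for t and n :: nat
  have lenW: "length (W (T x)) = length (T x)" if "x \<in> X" for x using W[OF that] by (simp add: good_def)
  have H_top: "even (H (T x) (length (T x)))" if x: "x \<in> X" for x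
  proof -
    have "H (T x) (length (T x)) = sum_list (map Q (W (T x))) - sum_list (map snd (T x))"
      using lenW[OF x] by (simp add: H_def sum_subtractf sum_list_sum_nth atLeast0LessThan)
    then show ?thesis using W[OF x] by (simp add: good_def)
  qed
  show thesis
  proof (rule that[of P "\<lambda>x. H (T x) (i x)"])
    show "lc X P" unfolding P_def using lc_comp2[OF T(1,2), of "\<lambda>t i. W t ! i"] .
    show "lc X (\<lambda>x. H (T x) (i x))" using lc_comp2[OF T(1,2)] .
    show "V \<subseteq> P ` X"
    proof
      fix v assume v: "v \<in> V"
      obtain x where x: "x \<in> X" using ne by blast
      then have "v \<in> set (W (T x))" using W v by (auto simp: good_def)
      then obtain j where j: "j < length (T x)" "v = W (T x) ! j" using lenW[OF x] by (metis in_set_conv_nth)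
      obtain z where "z \<in> X" "T z = T x" "i z = j"
        using tower_levels[of i T, OF T(3,6,7) x j(1)] by blast
      then show "v \<in> P ` X" unfolding P_def using j by (intro image_eqI[of _ _ z]) auto
    qed
    fix x assume x: "x \<in> X"
    have wlk: "walk E v0 (W (T x)) v0" using W[OF x] by (simp add: good_def)
    have snd: "snd (T x ! i x) = p x" using T(5)[OF x] by (simp add: F'_def)
    show "E (P x) (P (a x))"
    proof (cases "Suc (i x) < length (T x)")
      case True
      then show ?thesis using walk_edge[OF wlk, of "i x"] T(6)[OF x True] lenW[OF x] by (simp add: P_def)
    next
      case False
      then have eq: "Suc (i x) = length (T x)" using T(3)[OF x] by simp
      have "W (T (a x)) \<noteq> []" using lenW[OF aX[OF x]] T(3)[OF aX[OF x]] by auto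
      then have "W (T (a x)) ! 0 = v0" using walk_hd W[OF aX[OF x]] by (metis good_def)
      then show ?thesis using walk_last_edge[OF wlk, of "i x"] T(7)[OF x eq] lenW[OF x] eq by (simp add: P_def)
    qed
    have Suc: "H (T x) (Suc (i x)) = H (T x) (i x) + (Q (P x) - p x)" by (simp add: H_def P_def snd)
    show "even (Q (P x) - p x - (H (T (a x)) (i (a x)) - H (T x) (i x)))"
    proof (cases "Suc (i x) < length (T x)")
      case True
      then show ?thesis using Suc T(6)[OF x True] by simp
    next
      case False
      then have eq: "Suc (i x) = length (T x)" using T(3)[OF x] by simp
      then have "H (T (a x)) (i (a x)) = 0" using T(7)[OF x eq] by (simp add: H_def)
      moreover have "even (H (T x) (i x) + (Q (P x) - p x))" using H_top[OF x] Suc eq by simp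
      ultimately show ?thesis by (simp add: algebra_simps)
    qed
  qed
qed

end

section \<open>From the invariants to approximate conjugacy of the base systems\<close>

definition coboundary2 :: "'a::metric_space set \<Rightarrow> ('a \<Rightarrow> 'a) \<Rightarrow> ('a \<Rightarrow> int) \<Rightarrow> bool" where
  "coboundary2 X a f \<longleftrightarrow> (\<exists>h::'a \<Rightarrow> int. lc X h \<and> (\<forall>x\<in>X. even (f x - (h (a x) - h x))))"

text \<open>The condition on the bases through which both implications pass. Orientations, being
  discrete, must match exactly up to a coboundary, while the dynamics match up to
  \<open>e\<close>.\<close>

definition approx_conjugate ::
  "'a::metric_space set \<Rightarrow> ('a \<Rightarrow> 'a) \<Rightarrow> ('a \<Rightarrow> int) \<Rightarrow> 'b::metric_space set \<Rightarrow> ('b \<Rightarrow> 'b) \<Rightarrow> ('b \<Rightarrow> int) \<Rightarrow> bool" where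
  "approx_conjugate X a p Y b q \<longleftrightarrow> (\<forall>e>0. \<exists>s. continuous_on X s \<and> s ` X = Y \<and> inj_on s X \<and>
     (\<forall>x\<in>X. dist (s (a x)) (b (s x)) < e) \<and> coboundary2 X a (\<lambda>x. q (s x) - p x))"

context minsys
begin

text \<open>\<open>U v\<close> is a fixed walk from the base vertex to \<open>v\<close>. The two
  closed walks share the return \<open>vs\<close> and differ in whether they use the edge from
  \<open>r x\<close> to \<open>r (a x)\<close>, so facts about closed walks turn into cohomological
  facts about single edges.\<close>

lemma closed_walk_pairs:
  assumes "lc X r" "x0 \<in> X"
  obtains U where "\<And>x. x \<in> X \<Longrightarrow> \<exists>vs. walk (step r) (r x0) (U (r x) @ r x # vs) (r x0) \<and>
    walk (step r) (r x0) (U (r (a x)) @ vs) (r x0)"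
proof -
  have "\<forall>v\<in>r ` X. \<exists>us. walk (step r) (r x0) us v"
  proof
    fix v assume "v \<in> r ` X"
    then obtain x where x: "x \<in> X" "v = r x" by blast
    obtain us where "walk (step r) (r x0) us (r x)" by (fact walk_between[OF assms x(1)])
    then show "\<exists>us. walk (step r) (r x0) us v" using x by blast
  qed
  then obtain U where U: "\<And>v. v \<in> r ` X \<Longrightarrow> walk (step r) (r x0) (U v) v" by metis
  show thesis
  proof (rule that[of U])
    fix x assume x: "x \<in> X"
    obtain vs where vs: "walk (step r) (r (a x)) vs (r x0)" by (fact walk_between[OF assms(1) aX[OF x] assms(2)])
    have "walk (step r) (r x) (r x # vs) (r x0)" using stepI[OF x, of r] vs by auto
    from walk_append[OF U[OF imageI[OF x]] this] walk_append[OF U[OF imageI[OF aX[OF x]]] vs]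
    show "\<exists>vs. walk (step r) (r x0) (U (r x) @ r x # vs) (r x0) \<and> walk (step r) (r x0) (U (r (a x)) @ vs) (r x0)"
      by blast
  qed
qed

end

text \<open>Length and orientation of the fixed walk to the cell of \<open>x\<close> give potentials
  \<open>K\<close> and \<open>C\<close>. Divisibility of closed walks by \<open>p\<close> makes
  \<open>K\<close> an eigenfunction modulo \<open>p\<close>; if all closed walks are even,
  \<open>C\<close> trivialises the orientation; in the linked case the quotient by \<open>p\<close>
  of the error of \<open>K\<close> has the parity of the error of \<open>C\<close>.\<close>

lemma (in minsys) closed_walk_cases:
  fixes r :: "'a \<Rightarrow> 'v" and Q :: "'v \<Rightarrow> int"
  assumes r: "lc X r" and x0: "x0 \<in> X"
  defines "E \<equiv> step r" and "v0 \<equiv> r x0"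
  obtains
    (even) p N where "p \<in> PS X a" "coboundary2 X a (\<lambda>x. Q (r x))"
      "\<And>us. walk E v0 us v0 \<Longrightarrow> p dvd length us \<and> even (sum_list (map Q us))"
      "\<And>L. L \<ge> N \<Longrightarrow> p dvd L \<Longrightarrow> \<exists>us. walk E v0 us v0 \<and> length us = L \<and> even (sum_list (map Q us))"
  | (free) p N where "p \<in> PS X a"
      "\<And>us. walk E v0 us v0 \<Longrightarrow> p dvd length us"
      "\<And>L e. L \<ge> N \<Longrightarrow> p dvd L \<Longrightarrow> \<exists>us. walk E v0 us v0 \<and> length us = L \<and> odd (sum_list (map Q us)) = e"
  | (linked) p N and K C :: "'a \<Rightarrow> int" where "p \<in> PS X a" "lc X K" "lc X C"
      "\<And>x. x \<in> X \<Longrightarrow> \<exists>j. K x + 1 - K (a x) = int p * j \<and> even (j - (C x + Q (r x) - C (a x)))"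
      "\<And>us. walk E v0 us v0 \<Longrightarrow> p dvd length us \<and> odd (sum_list (map Q us)) = odd (length us div p)"
      "\<And>L. L \<ge> N \<Longrightarrow> p dvd L \<Longrightarrow> \<exists>us. walk E v0 us v0 \<and> length us = L \<and> odd (sum_list (map Q us)) = odd (L div p)"
proof -
  define S where "S L e \<longleftrightarrow> (\<exists>us. walk E v0 us v0 \<and> length us = L \<and> odd (sum_list (map Q us)) = e)" for L e
  have SI: "S (length us) (odd (sum_list (map Q us)))" if "walk E v0 us v0" for us
    using that unfolding S_def by blast
  have S0: "S 0 False" unfolding S_def by (rule exI[of _ "[]"]) simp
  have Sadd: "S (L + M) (e \<noteq> f)" if "S L e" "S M f" for L e M f
  proof -
    obtain us vs where us: "walk E v0 us v0" "length us = L" "odd (sum_list (map Q us)) = e"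
      and vs: "walk E v0 vs v0" "length vs = M" "odd (sum_list (map Q vs)) = f"
      using \<open>S L e\<close> \<open>S M f\<close> unfolding S_def by blast
    show ?thesis unfolding S_def
      by (rule exI[of _ "us @ vs"]) (use us vs walk_append[OF us(1) vs(1)] in auto)
  qed
  obtain ws where ws: "walk E v0 ws v0" "v0 \<in> set ws"
    unfolding E_def v0_def by (fact closed_walk_through[OF r x0 x0])
  have wspos: "length ws > 0" using ws(2) by auto
  obtain U where U: "\<And>x. x \<in> X \<Longrightarrow> \<exists>vs. walk E v0 (U (r x) @ r x # vs) v0 \<and> walk E v0 (U (r (a x)) @ vs) v0"
    unfolding E_def v0_def by (fact closed_walk_pairs[OF r x0])
  define K where "K x = int (length (U (r x)))" for x
  define C where "C x = sum_list (map Q (U (r x)))" for x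
  have lcK: "lc X K" unfolding K_def using lc_comp1[OF r, of "\<lambda>v. int (length (U v))"] .
  have lcC: "lc X C" unfolding C_def using lc_comp1[OF r, of "\<lambda>v. sum_list (map Q (U v))"] .
  have PS: "p \<in> PS X a" if p: "p \<ge> 1" "\<And>us. walk E v0 us v0 \<Longrightarrow> p dvd length us" for p
  proof -
    have "int p dvd K (a x) - K x - 1" if x: "x \<in> X" for x
    proof -
      obtain vs where "walk E v0 (U (r x) @ r x # vs) v0" "walk E v0 (U (r (a x)) @ vs) v0" using U[OF x] by blast
      then have "p dvd length (U (r x) @ r x # vs)" "p dvd length (U (r (a x)) @ vs)" using p by blast+
      then have "int p dvd int (length (U (r (a x)) @ vs)) - int (length (U (r x) @ r x # vs))"
        by (intro dvd_diff) (simp_all only: int_dvd_int_iff)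
      then show ?thesis by (simp add: K_def algebra_simps)
    qed
    then show ?thesis using PS_base_iff p(1) lcK by blast
  qed
  show thesis
  proof (rule parity_semigroup_cases[of S, OF S0 Sadd SI[OF ws(1)] wspos])
    fix p N assume p: "1 \<le> p" "\<And>L e. S L e \<Longrightarrow> p dvd L \<and> \<not> e" "\<And>L. N \<le> L \<Longrightarrow> p dvd L \<Longrightarrow> S L False"
    show thesis
    proof (rule even)
      show 1: "p dvd length us \<and> even (sum_list (map Q us))" if "walk E v0 us v0" for us
        using p(2)[OF SI[OF that]] by blast
      then show "p \<in> PS X a" using PS p(1) by blast
      show "\<exists>us. walk E v0 us v0 \<and> length us = L \<and> even (sum_list (map Q us))" if "N \<le> L" "p dvd L" for L
        using p(3)[OF that] unfolding S_def by blast
      have "even (Q (r x) - (C (a x) - C x))" if x: "x \<in> X" for x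
      proof -
        obtain vs where "walk E v0 (U (r x) @ r x # vs) v0" "walk E v0 (U (r (a x)) @ vs) v0" using U[OF x] by blast
        then have "even (sum_list (map Q (U (r x) @ r x # vs)))" "even (sum_list (map Q (U (r (a x)) @ vs)))" using 1 by blast+
        then show ?thesis by (auto simp: C_def)
      qed
      then show "coboundary2 X a (\<lambda>x. Q (r x))" unfolding coboundary2_def using lcC by blast
    qed
  next
    fix p N assume p: "1 \<le> p" "\<And>L e. S L e \<Longrightarrow> p dvd L" "\<And>L e. N \<le> L \<Longrightarrow> p dvd L \<Longrightarrow> S L e"
    show thesis
    proof (rule free)
      show 1: "p dvd length us" if "walk E v0 us v0" for us
        using p(2)[OF SI[OF that]] by blast
      then show "p \<in> PS X a" using PS p(1) by blast
      show "\<exists>us. walk E v0 us v0 \<and> length us = L \<and> odd (sum_list (map Q us)) = e" if "N \<le> L" "p dvd L" for L e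
        using p(3)[OF that] unfolding S_def by blast
    qed
  next
    fix p N assume p: "1 \<le> p" "\<And>L e. S L e \<Longrightarrow> p dvd L \<and> e = odd (L div p)" "\<And>L. N \<le> L \<Longrightarrow> p dvd L \<Longrightarrow> S L (odd (L div p))"
    show thesis
    proof (rule linked[OF _ lcK lcC])
      show 1: "p dvd length us \<and> odd (sum_list (map Q us)) = odd (length us div p)" if "walk E v0 us v0" for us
        using p(2)[OF SI[OF that]] by blast
      then show "p \<in> PS X a" using PS p(1) by blast
      show "\<exists>us. walk E v0 us v0 \<and> length us = L \<and> odd (sum_list (map Q us)) = odd (L div p)" if "N \<le> L" "p dvd L" for L
        using p(3)[OF that] unfolding S_def by blast
      fix x assume x: "x \<in> X"
      obtain vs where w: "walk E v0 (U (r x) @ r x # vs) v0" "walk E v0 (U (r (a x)) @ vs) v0" using U[OF x] by blast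
      obtain k where k: "length (U (r x) @ r x # vs) = p * k" using 1[OF w(1)] by (auto simp: dvd_def)
      obtain l where l: "length (U (r (a x)) @ vs) = p * l" using 1[OF w(2)] by (auto simp: dvd_def)
      have "odd (sum_list (map Q (U (r x) @ r x # vs))) = odd k"
        "odd (sum_list (map Q (U (r (a x)) @ vs))) = odd l"
        using 1[OF w(1)] 1[OF w(2)] p(1) by (simp_all add: k l del: append.simps map_append length_append)
      then have "even (int k - int l - (C x + Q (r x) - C (a x)))" by (simp add: C_def) presburger
      moreover have "K x + 1 - K (a x) = int (length (U (r x) @ r x # vs)) - int (length (U (r (a x)) @ vs))"
        by (simp add: K_def)
      then have "K x + 1 - K (a x) = int p * (int k - int l)" unfolding k l by (simp add: algebra_simps)
      ultimately show "\<exists>j. K x + 1 - K (a x) = int p * j \<and> even (j - (C x + Q (r x) - C (a x)))" by blast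
    qed
  qed
qed

text \<open>If length determines orientation, then \<open>2 * p\<close> is a period of the double cover; it is not a period
  of the base, since the quotient of the two eigenfunctions would trivialise the orientation.\<close>
lemma (in minsys) linked_contradiction:
  assumes q: "lc X q" and lcK: "lc X K" and lcC: "lc X C"
    and rel: "\<And>x. x \<in> X \<Longrightarrow> \<exists>j. K x + 1 - K (a x) = int p * j \<and> even (j - (C x + q x - C (a x)))"
    and p: "p \<ge> 1" and PS: "PS (X \<times> {0,1}) (skew2 a q) \<subseteq> PS X a"
  shows "coboundary2 X a q"
proof -
  \<comment> \<open>\<open>K\<close> is an eigenfunction only modulo \<open>p\<close>. By the link,
    its error modulo \<open>2 * p\<close> is \<open>p\<close> times the orientation error of
    \<open>C\<close>, and the sheet coordinate \<open>snd z\<close> absorbs the orientation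
    itself.\<close>
  define \<kappa> where "\<kappa> z = K (fst z) + int p * (snd z + C (fst z))" for z
  have K: "lc (X \<times> {0::int,1}) (\<lambda>z. K (fst z))"
    by (rule lc_pullback[OF _ _ lcK]) (auto intro: continuous_intros)
  have C: "lc (X \<times> {0::int,1}) (\<lambda>z. C (fst z))"
    by (rule lc_pullback[OF _ _ lcC]) (auto intro: continuous_intros)
  have "lc (X \<times> {0,1}) (\<lambda>z. snd z :: int)"
    by (intro continuous_on_discrete_imp_lc continuous_intros)
  from lc_comp2[OF K lc_comp2[OF this C, of Pair], of "\<lambda>u (v, w). u + int p * (v + w)"]
  have "lc (X \<times> {0,1}) \<kappa>" by (simp add: \<kappa>_def[abs_def])
  moreover have "int (2 * p) dvd \<kappa> (skew2 a q z) - \<kappa> z - 1" if z: "z \<in> X \<times> {0,1}" for z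
  proof -
    obtain x k where xk: "z = (x,k)" "x \<in> X" using z by auto
    obtain j where j: "K x + 1 - K (a x) = int p * j" "even (j - (C x + q x - C (a x)))" using rel[OF xk(2)] by blast
    have "even ((k + q x) mod 2 + C (a x) - k - C x - j)" using j(2) by presburger
    then obtain t where t: "(k + q x) mod 2 + C (a x) - k - C x - j = 2 * t" by blast
    have "\<kappa> (skew2 a q z) - \<kappa> z - 1 = int p * ((k + q x) mod 2 + C (a x) - k - C x) - (K x + 1 - K (a x))"
      by (simp add: \<kappa>_def skew2_def xk algebra_simps)
    also have "\<dots> = int p * ((k + q x) mod 2 + C (a x) - k - C x - j)" unfolding j(1) by (simp add: algebra_simps)
    also have "\<dots> = int (2 * p) * t" unfolding t by simp
    finally show ?thesis by simp
  qed
  moreover have "2 * p \<ge> 1" using p by simp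
  ultimately have "2 * p \<in> PS (X \<times> {0,1}) (skew2 a q)" using PS_skew2_iff[OF q] by blast
  then have "2 * p \<in> PS X a" using PS by blast
  then obtain k where k: "lc X k" "\<And>x. x \<in> X \<Longrightarrow> int (2 * p) dvd k (a x) - k x - 1"
    using PS_base_iff by blast
  \<comment> \<open>Modulo \<open>2 * p\<close>, the function \<open>K + p * C\<close> grows by
    \<open>1 + p * q\<close> and \<open>k\<close> grows by 1. So \<open>D\<close> grows by
    \<open>p * q\<close>: it is constant modulo \<open>p\<close>, and its variation divided by
    \<open>p\<close> is a transfer function for \<open>q\<close>.\<close>
  define D where "D x = K x + int p * C x - k x" for x
  have "lc X (\<lambda>x. (K x, C x))" using lc_comp2[OF lcK lcC] .
  from lc_comp2[OF this k(1), of "\<lambda>(u,v) w. u + int p * v - w"] have lcD: "lc X D" by (simp add: D_def[abs_def])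
  have D: "\<exists>t. D (a x) - D x = int p * (q x + 2 * t)" if x: "x \<in> X" for x
  proof -
    obtain j where j: "K x + 1 - K (a x) = int p * j" "even (j - (C x + q x - C (a x)))" using rel[OF x] by blast
    obtain u where u: "k (a x) - k x - 1 = int (2 * p) * u" using k(2)[OF x] by (auto simp: dvd_def)
    have "even (C (a x) - C x - j - 2 * u - q x)" using j(2) by presburger
    then obtain t where t: "C (a x) - C x - j - 2 * u - q x = 2 * t" by blast
    have "D (a x) - D x = int p * (C (a x) - C x) - (K x + 1 - K (a x)) - (k (a x) - k x - 1)"
      by (simp add: D_def algebra_simps)
    also have "\<dots> = int p * (q x + (C (a x) - C x - j - 2 * u - q x))" unfolding j(1) u by (simp add: algebra_simps)
    finally show ?thesis unfolding t by blast
  qed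
  obtain x0 where x0: "x0 \<in> X" using ne by blast
  have "D x mod int p = D x0 mod int p" if x: "x \<in> X" for x
  proof (rule invariant_constant[OF _ _ x x0])
    show "lc X (\<lambda>x. D x mod int p)" using lc_comp1[OF lcD] .
    fix y assume "y \<in> X"
    then obtain t where "D (a y) - D y = int p * (q y + 2 * t)" using D by blast
    then show "D (a y) mod int p = D y mod int p" by (metis dvd_triv_left mod_eq_dvd_iff)
  qed
  then have dvd: "int p dvd D x - D x0" if "x \<in> X" for x using that by (simp add: mod_eq_dvd_iff)
  define h where "h x = (D x - D x0) div int p" for x
  have h: "D x = D x0 + int p * h x" if "x \<in> X" for x using dvd[OF that] by (simp add: h_def)
  have "even (q x - (h (a x) - h x))" if x: "x \<in> X" for x
  proof -
    obtain t where "D (a x) - D x = int p * (q x + 2 * t)" using D[OF x] by blast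
    then have "int p * (h (a x) - h x) = int p * (q x + 2 * t)" using h[OF x] h[OF aX[OF x]] by (simp add: algebra_simps)
    then have "h (a x) - h x = q x + 2 * t" using p by simp
    then show ?thesis by simp
  qed
  moreover have "lc X h" unfolding h_def using lc_comp1[OF lcD, of "\<lambda>d. (d - D x0) div int p"] .
  ultimately show ?thesis unfolding coboundary2_def by blast
qed

text \<open>\<open>A\<close> is a set of pairs (length, orientation) that agrees with the set of closed walks at \<open>v0\<close>
  from length \<open>N\<close> on, and contains those of all return words to a fibre of \<open>F\<close>.\<close>
definition admissible where
  "admissible X a (p :: _ \<Rightarrow> int) E v0 (Q :: _ \<Rightarrow> int) A (N::nat) F \<longleftrightarrow>
     (\<forall>us. walk E v0 us v0 \<longrightarrow> A (length us) (odd (sum_list (map Q us)))) \<and>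
     (\<forall>L e. L \<ge> N \<longrightarrow> A L e \<longrightarrow> (\<exists>us. walk E v0 us v0 \<and> length us = L \<and> odd (sum_list (map Q us)) = e)) \<and>
     (\<forall>L e M f. A (L + M) (e \<noteq> f) \<longrightarrow> A M f \<longrightarrow> A L e) \<and>
     lc X F \<and> (\<forall>y\<in>X. \<forall>n. F ((a ^^ n) y) = F y \<longrightarrow> A n (odd (\<Sum>j<n. p ((a ^^ j) y))))"

text \<open>\<open>G\<close> collects data on \<open>Y\<close> that the partition is required to
  resolve, so that they become functions on the vertices. The type of \<open>F\<close> is fixed
  because it is quantified inside a premise; its three places hold an eigenfunction and the transfer
  functions for length and orientation.\<close>

lemma approx_conjugateI:
  fixes X :: "'a::metric_space set" and Y :: "'b::metric_space set" and G :: "'b \<Rightarrow> 'g"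
    and p :: "'a \<Rightarrow> int" and q :: "'b \<Rightarrow> int"
  assumes X: "minsys X a a'" and Y: "minsys Y b b'" and p: "lc X p" and q: "lc Y q" and G: "lc Y G"
    and main: "\<And>(r :: 'b \<Rightarrow> nat) Q y0. lc Y r \<Longrightarrow> (\<And>y y'. y \<in> Y \<Longrightarrow> y' \<in> Y \<Longrightarrow> r y = r y' \<Longrightarrow> G y = G y') \<Longrightarrow>
      (\<And>y. y \<in> Y \<Longrightarrow> Q (r y) = q y) \<Longrightarrow> y0 \<in> Y \<Longrightarrow>
      \<exists>A N. \<exists>F :: 'a \<Rightarrow> int \<times> int \<times> int. admissible X a p (minsys.step Y b r) (r y0) Q A N F"
  shows "approx_conjugate X a p Y b q"
  unfolding approx_conjugate_def
proof (intro allI impI)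
  fix e :: real assume e: "e > 0"
  interpret X: minsys X a a' by fact
  interpret Y: minsys Y b b' by fact
  obtain d where d: "d > 0" "\<And>x y. x \<in> Y \<Longrightarrow> y \<in> Y \<Longrightarrow> dist x y < d \<Longrightarrow> dist (b x) (b y) < e/2"
    using compact_uniformly_continuous[OF Y.ca Y.cpt] e unfolding uniformly_continuous_on_def
    by (metis dist_commute half_gt_zero)
  have lqG: "lc Y (\<lambda>y. (q y, G y))" using lc_comp2[OF q G] .
  have pos: "min d (e/2) > 0" using d e by simp
  obtain r :: "'b \<Rightarrow> nat" and \<pi> where r: "lc Y r" "\<And>y. y \<in> Y \<Longrightarrow> \<pi> (r y) = (q y, G y)"
    "\<And>x y. x \<in> Y \<Longrightarrow> y \<in> Y \<Longrightarrow> r x = r y \<Longrightarrow> dist x y < min d (e/2)"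
    by (fact lc_fine_code[OF Y.cantor_axioms lqG pos])
  define Q where "Q v = fst (\<pi> v)" for v
  have Q: "Q (r y) = q y" if "y \<in> Y" for y using r(2)[OF that] by (simp add: Q_def)
  have rG: "G y = G y'" if "y \<in> Y" "y' \<in> Y" "r y = r y'" for y y'
    using r(2)[OF that(1)] r(2)[OF that(2)] that(3) by simp
  obtain y0 where y0: "y0 \<in> Y" using Y.ne by blast
  obtain A N and F :: "'a \<Rightarrow> int \<times> int \<times> int" where adm: "admissible X a p (Y.step r) (r y0) Q A N F"
    using main[of r Q y0, OF r(1) rG Q y0] by blast
  have A1: "A (length us) (odd (sum_list (map Q us)))" if "walk (Y.step r) (r y0) us (r y0)" for us
    using adm that unfolding admissible_def by blast
  have A2: "\<exists>us. walk (Y.step r) (r y0) us (r y0) \<and> length us = L \<and> odd (sum_list (map Q us)) = e" if "L \<ge> N" "A L e" for L e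
    using adm that unfolding admissible_def by blast
  have A3: "A L e" if "A (L + M) (e \<noteq> f)" "A M f" for L e M f
    using adm that unfolding admissible_def by blast
  have F: "A n (odd (\<Sum>j<n. p ((a ^^ j) y)))" if "y \<in> X" "F ((a ^^ n) y) = F y" for y n
    using adm that unfolding admissible_def by blast
  have lcF: "lc X F" using adm unfolding admissible_def by blast
  obtain ws where ws: "walk (Y.step r) (r y0) ws (r y0)" "r ` Y \<subseteq> set ws"
    by (fact Y.closed_walk_tour[OF r(1) y0])
  have "\<exists>P h. lc X P \<and> lc X (h :: 'a \<Rightarrow> int) \<and> (\<forall>x\<in>X. Y.step r (P x) (P (a x))) \<and>
    (\<forall>x\<in>X. even (Q (P x) - p x - (h (a x) - h x))) \<and> r ` Y \<subseteq> P ` X"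
    by (rule X.tower_labelling[of p "Y.step r" "r y0" ws "r ` Y" A Q N F])
      (rule p, rule ws(1), rule ws(2), erule A1, erule (1) A2, erule (1) A3, rule lcF, erule (1) F, blast)
  then obtain P and h :: "'a \<Rightarrow> int" where P: "lc X P" "lc X h" "\<And>x. x \<in> X \<Longrightarrow> Y.step r (P x) (P (a x))"
    "\<And>x. x \<in> X \<Longrightarrow> even (Q (P x) - p x - (h (a x) - h x))" "r ` Y \<subseteq> P ` X"
    by blast
  have "P x \<in> r ` Y" if "x \<in> X" for x using P(3)[OF that] unfolding Y.step_def by force
  then have im: "P ` X = r ` Y" using P(5) by auto
  obtain s where s: "continuous_on X s" "s ` X = Y" "inj_on s X" "\<And>x. x \<in> X \<Longrightarrow> r (s x) = P x"
    by (fact cantor_homeomorphism[OF X.cantor_axioms Y.cantor_axioms P(1) r(1) im])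
  have sY: "s x \<in> Y" if "x \<in> X" for x using s(2) that by blast
  have "dist (s (a x)) (b (s x)) < e" if x: "x \<in> X" for x
  proof -
    \<comment> \<open>The edge used by the labelling comes from an actual point \<open>y\<close>. It
      lies in the cell of \<open>s x\<close>, so \<open>b y\<close> is close to
      \<open>b (s x)\<close> by uniform continuity, and \<open>b y\<close> lies in the cell of
      \<open>s (a x)\<close>.\<close>
    obtain y where y: "y \<in> Y" "r y = P x" "r (b y) = P (a x)" using P(3)[OF x] unfolding Y.step_def by blast
    have "dist y (s x) < min d (e/2)" using r(3)[OF y(1) sY[OF x]] y(2) s(4)[OF x] by simp
    then have "dist (b y) (b (s x)) < e/2" using d(2)[OF y(1) sY[OF x]] by simp
    moreover have "dist (b y) (s (a x)) < min d (e/2)"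
      using r(3)[OF Y.aX[OF y(1)] sY[OF X.aX[OF x]]] y(3) s(4)[OF X.aX[OF x]] by simp
    ultimately show ?thesis using dist_triangle3[of "s (a x)" "b (s x)" "b y"] by simp
  qed
  moreover have "even (q (s x) - p x - (h (a x) - h x))" if x: "x \<in> X" for x
    using P(4)[OF x] Q[OF sY[OF x]] s(4)[OF x] by simp
  then have "coboundary2 X a (\<lambda>x. q (s x) - p x)" unfolding coboundary2_def using P(2) by blast
  ultimately show "\<exists>s. continuous_on X s \<and> s ` X = Y \<and> inj_on s X \<and>
     (\<forall>x\<in>X. dist (s (a x)) (b (s x)) < e) \<and> coboundary2 X a (\<lambda>x. q (s x) - p x)"
    using s by blast
qed

section \<open>Admissible pairs for the three types of closed walks\<close>

context minsys
begin

lemma cyclic_return: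
  assumes "\<And>x. x \<in> X \<Longrightarrow> int n dvd k (a x) - k x - 1" "y \<in> X" "k ((a ^^ m) y) = k y"
  shows "n dvd m"
proof -
  have "int n dvd k ((a ^^ m) y) - k y - int m"
    by (rule orbit_cyclic[OF _ assms(2)]) (rule assms(1))
  then show ?thesis using assms(3) by simp
qed

text \<open>Closed walks constrain the length alone, so it suffices that return times to a fibre of
  an eigenfunction of \<open>X\<close> are multiples of \<open>n\<close>.\<close>

lemma admissible_free:
  assumes "n \<in> PS X a" "\<And>us. walk E v0 us v0 \<Longrightarrow> n dvd length us"
    "\<And>L e. L \<ge> N \<Longrightarrow> n dvd L \<Longrightarrow> \<exists>us. walk E v0 us v0 \<and> length us = L \<and> odd (sum_list (map Q us)) = e"
  shows "\<exists>A N. \<exists>F :: 'a \<Rightarrow> int \<times> int \<times> int. admissible X a p E v0 Q A N F"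
proof -
  obtain k where k: "lc X k" "\<And>x. x \<in> X \<Longrightarrow> int n dvd k (a x) - k x - 1"
    using assms(1) PS_base_iff by blast
  have "admissible X a p E v0 Q (\<lambda>L e. n dvd L) N (\<lambda>x. (k x, 0::int, 0::int))"
    unfolding admissible_def
  proof (intro conjI allI impI ballI)
    show "lc X (\<lambda>x. (k x, 0::int, 0::int))" using lc_comp1[OF k(1)] .
    fix y m assume "y \<in> X" "(k ((a ^^ m) y), 0::int, 0::int) = (k y, 0, 0)"
    then show "n dvd m" using cyclic_return[of n k, OF k(2)] by simp
  next
    fix L M assume "n dvd L + M" "n dvd M"
    then show "n dvd L" using dvd_add_left_iff by blast
  qed (use assms(2,3) in blast)+
  then show ?thesis by blast
qed

lemma admissible_even:
  assumes "n \<in> PS X a" "\<And>us. walk E v0 us v0 \<Longrightarrow> n dvd length us \<and> even (sum_list (map Q us))"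
    "\<And>L. L \<ge> N \<Longrightarrow> n dvd L \<Longrightarrow> \<exists>us. walk E v0 us v0 \<and> length us = L \<and> even (sum_list (map Q us))"
    and "coboundary2 X a p"
  shows "\<exists>A N. \<exists>F :: 'a \<Rightarrow> int \<times> int \<times> int. admissible X a p E v0 Q A N F"
proof -
  obtain k where k: "lc X k" "\<And>x. x \<in> X \<Longrightarrow> int n dvd k (a x) - k x - 1"
    using assms(1) PS_base_iff by blast
  obtain h :: "'a \<Rightarrow> int" where h: "lc X h" "\<And>x. x \<in> X \<Longrightarrow> even (p x - (h (a x) - h x))"
    using assms(4) unfolding coboundary2_def by blast
  have "admissible X a p E v0 Q (\<lambda>L e. n dvd L \<and> \<not> e) N (\<lambda>x. (k x, h x, 0::int))"
    unfolding admissible_def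
  proof (intro conjI[where P = "\<forall>us. _ us"] conjI[where P = "\<forall>L. _ L"] conjI[where P = "lc _ _"] allI impI ballI)
    show "lc X (\<lambda>x. (k x, h x, 0::int))" using lc_comp2[OF k(1) h(1)] .
    fix y m assume y: "y \<in> X" "(k ((a ^^ m) y), h ((a ^^ m) y), 0::int) = (k y, h y, 0)"
    have "even ((\<Sum>j<m. p ((a ^^ j) y)) - (h ((a ^^ m) y) - h y))"
      by (rule orbit_potential_parity[OF _ y(1)]) (rule h(2))
    then show "n dvd m \<and> \<not> odd (\<Sum>j<m. p ((a ^^ j) y))"
      using cyclic_return[of n k, OF k(2)] y by simp
  next
    fix L M :: nat and e f assume "n dvd L + M \<and> \<not> (e \<noteq> f)" "n dvd M \<and> \<not> f"
    then show "n dvd L \<and> \<not> e" using dvd_add_left_iff by blast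
  next
    fix L e assume "N \<le> L" "n dvd L \<and> \<not> e"
    then show "\<exists>us. walk E v0 us v0 \<and> length us = L \<and> odd (sum_list (map Q us)) = e"
      using assms(3)[of L] by blast
  next
    fix us assume "walk E v0 us v0"
    then show "n dvd length us \<and> \<not> odd (sum_list (map Q us))" using assms(2) by blast
  qed
  then show ?thesis by blast
qed

text \<open>Along a return word of length \<open>l\<close> to a fibre of \<open>(k, c, h)\<close>,
  telescoping \<open>c\<close> gives \<open>l = m * S\<close> with \<open>S\<close> the sum of
  \<open>f\<close>, and telescoping \<open>h\<close> gives \<open>S\<close> the parity of the sum of
  \<open>p\<close>. The hypothesis \<open>par\<close> converts the quotient by \<open>m\<close> into
  the quotient by \<open>n\<close>, the period of the closed walks.\<close>

lemma admissible_linked: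
  fixes f c h :: "'a \<Rightarrow> int"
  assumes "n \<in> PS X a" "\<And>us. walk E v0 us v0 \<Longrightarrow> n dvd length us \<and> odd (sum_list (map Q us)) = odd (length us div n)"
    "\<And>L. L \<ge> N \<Longrightarrow> n dvd L \<Longrightarrow> \<exists>us. walk E v0 us v0 \<and> length us = L \<and> odd (sum_list (map Q us)) = odd (L div n)"
    and f: "lc X c" "lc X h" "\<And>x. x \<in> X \<Longrightarrow> m * f x - 1 = c (a x) - c x" "\<And>x. x \<in> X \<Longrightarrow> even (f x - p x - (h (a x) - h x))"
    and par: "\<And>L S. n dvd L \<Longrightarrow> int L = m * S \<Longrightarrow> odd S = odd (L div n)"
  shows "\<exists>A N. \<exists>F :: 'a \<Rightarrow> int \<times> int \<times> int. admissible X a p E v0 Q A N F"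
proof -
  have n1: "n \<ge> 1" using assms(1) PS_base_iff by blast
  obtain k where k: "lc X k" "\<And>x. x \<in> X \<Longrightarrow> int n dvd k (a x) - k x - 1"
    using assms(1) PS_base_iff by blast
  have "admissible X a p E v0 Q (\<lambda>L e. n dvd L \<and> e = odd (L div n)) N (\<lambda>x. (k x, c x, h x))"
    unfolding admissible_def
  proof (intro conjI[where P = "\<forall>us. _ us"] conjI[where P = "\<forall>L. _ L"] conjI[where P = "lc _ _"] allI impI ballI)
    show "lc X (\<lambda>x. (k x, c x, h x))" using lc_comp2[OF k(1) lc_comp2[OF f(1,2), of Pair], of Pair] .
    fix y l assume y: "y \<in> X" "(k ((a ^^ l) y), c ((a ^^ l) y), h ((a ^^ l) y)) = (k y, c y, h y)"
    have "(\<Sum>j<l. (\<lambda>x. m * f x - 1) ((a ^^ j) y)) = c ((a ^^ l) y) - c y"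
      by (rule orbit_potential[OF _ y(1)]) (rule f(3))
    then have "int l = m * (\<Sum>j<l. f ((a ^^ j) y))" using y(2) by (simp add: sum_subtractf sum_distrib_left)
    moreover have n: "n dvd l" using cyclic_return[of n k, OF k(2)] y by simp
    ultimately have "odd (\<Sum>j<l. f ((a ^^ j) y)) = odd (l div n)" using par by blast
    moreover have "even ((\<Sum>j<l. (\<lambda>x. f x - p x) ((a ^^ j) y)) - (h ((a ^^ l) y) - h y))"
      by (rule orbit_potential_parity[OF _ y(1)]) (rule f(4))
    then have "even ((\<Sum>j<l. f ((a ^^ j) y)) - (\<Sum>j<l. p ((a ^^ j) y)))" using y(2) by (simp add: sum_subtractf)
    ultimately show "n dvd l \<and> odd (\<Sum>j<l. p ((a ^^ j) y)) = odd (l div n)" using n by auto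
  next
    fix L M :: nat and e e' assume A: "n dvd L + M \<and> (e \<noteq> e') = odd ((L + M) div n)" "n dvd M \<and> e' = odd (M div n)"
    then have "n dvd L" using dvd_add_left_iff by blast
    then obtain i j where "L = n * i" "M = n * j" using A by (auto simp: dvd_def)
    then show "n dvd L \<and> e = odd (L div n)" using A n1 by (auto simp: distrib_left[symmetric])
  next
    fix L e assume "N \<le> L" "n dvd L \<and> e = odd (L div n)"
    then show "\<exists>us. walk E v0 us v0 \<and> length us = L \<and> odd (sum_list (map Q us)) = e"
      using assms(3)[of L] by blast
  next
    fix us assume "walk E v0 us v0"
    then show "n dvd length us \<and> odd (sum_list (map Q us)) = odd (length us div n)" using assms(2) by blast
  qed
  then show ?thesis by blast
qed

end

lemma factor_through:
  assumes "\<And>y y'. y \<in> Y \<Longrightarrow> y' \<in> Y \<Longrightarrow> r y = r y' \<Longrightarrow> G y = G y'"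
  obtains k where "\<And>y. y \<in> Y \<Longrightarrow> k (r y) = G y"
proof (rule that)
  fix y assume y: "y \<in> Y"
  let ?z = "SOME z. z \<in> Y \<and> r z = r y"
  have "?z \<in> Y \<and> r ?z = r y" by (rule someI[of _ y]) (use y in simp)
  then show "(\<lambda>v. G (SOME z. z \<in> Y \<and> r z = v)) (r y) = G y" using assms[of ?z y] y by blast
qed

text \<open>In \<open>K^0\<close> the class of \<open>f\<close> is an \<open>m\<close>-th part of
  the unit class and reduces modulo two to the class of \<open>p\<close>. Alternative (b) is the
  case of a power of two.\<close>

definition divisible_class ::
  "'a::metric_space set \<Rightarrow> ('a \<Rightarrow> 'a) \<Rightarrow> ('a \<Rightarrow> int) \<Rightarrow> int \<Rightarrow> ('a \<Rightarrow> int) \<Rightarrow> bool" where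
  "divisible_class X a p m f \<longleftrightarrow> lc X f \<and> (\<exists>c::'a \<Rightarrow> int. lc X c \<and> (\<forall>x\<in>X. m * f x - 1 = c (a x) - c x)) \<and>
     coboundary2 X a (\<lambda>x. f x - p x)"

theorem approx_conjugate_of_invariants:
  fixes X :: "'a::metric_space set" and Y :: "'b::metric_space set"
    and p :: "'a \<Rightarrow> int" and q :: "'b \<Rightarrow> int"
  assumes X: "minsys X a a'" and Y: "minsys Y b b'" and p: "lc X p" and q: "lc Y q"
    and PS: "PS Y b \<subseteq> PS X a"
    and inv: "(coboundary2 Y b q \<and> coboundary2 X a p) \<or>
      (\<not> coboundary2 Y b q \<and> (\<exists>m f g. m > 0 \<and> divisible_class X a p m f \<and> divisible_class Y b q m g)) \<or>
      (\<not> coboundary2 Y b q \<and> PS (Y \<times> {0,1}) (skew2 b q) = PS Y b)"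
  shows "approx_conjugate X a p Y b q"
proof -
  interpret X: minsys X a a' by fact
  interpret Y: minsys Y b b' by fact
  consider (a) "coboundary2 Y b q" "coboundary2 X a p"
    | (b) m f g where "\<not> coboundary2 Y b q" "m > 0" "divisible_class X a p m f" "divisible_class Y b q m g"
    | (c) "\<not> coboundary2 Y b q" "PS (Y \<times> {0,1}) (skew2 b q) = PS Y b"
    using inv by blast
  then show ?thesis
  proof cases
    case a
    obtain h where h: "lc Y h" "\<And>y. y \<in> Y \<Longrightarrow> even (q y - (h (b y) - h y))"
      using a(1) unfolding coboundary2_def by blast
    show ?thesis
    proof (rule approx_conjugateI[OF X Y p q h(1)])
      fix r :: "'b \<Rightarrow> nat" and Q y0
      assume r: "lc Y r" "\<And>y y'. y \<in> Y \<Longrightarrow> y' \<in> Y \<Longrightarrow> r y = r y' \<Longrightarrow> h y = h y'"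
        and Q: "\<And>y. y \<in> Y \<Longrightarrow> Q (r y) = q y" and y0: "y0 \<in> Y"
      obtain k where k: "\<And>y. y \<in> Y \<Longrightarrow> k (r y) = h y" by (rule factor_through[of Y r h]) (use r(2) in blast)+
      have ev: "even (sum_list (map Q us))" if us: "walk (Y.step r) (r y0) us (r y0)" for us
      proof -
        have "even (sum_list (map Q us) - (k (r y0) - k (r y0)))"
        proof (rule walk_potential_parity[OF _ us])
          fix v w assume "Y.step r v w"
          then obtain y where y: "y \<in> Y" "v = r y" "w = r (b y)" unfolding Y.step_def by blast
          then show "even (Q v - (k w - k v))" using h(2)[OF y(1)] k Q Y.aX by simp
        qed
        then show ?thesis by simp
      qed
      from r(1) y0 show "\<exists>A N. \<exists>F :: 'a \<Rightarrow> int \<times> int \<times> int. admissible X a p (Y.step r) (r y0) Q A N F"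
      proof (cases rule: Y.closed_walk_cases[of r y0 Q])
        case (even n N)
        then show ?thesis using X.admissible_even[of n "Y.step r" "r y0" Q N p] a(2) PS by blast
      next
        case (free n N)
        then show ?thesis using X.admissible_free[of n "Y.step r" "r y0" N Q p] PS by blast
      next
        case (linked n N K C)
        have "n \<ge> 1" using linked(1) Y.PS_base_iff by blast
        \<comment> \<open>A multiple of \<open>n\<close> beyond \<open>N\<close> with odd quotient:
          the linked type yields a closed walk of odd orientation there, against
          \<open>ev\<close>.\<close>
        then have "N \<le> n * (2 * N + 1)" by (simp add: le_add1 trans_le_add2)
        then obtain us where us: "walk (Y.step r) (r y0) us (r y0)" "odd (sum_list (map Q us)) = odd (n * (2 * N + 1) div n)"
          using linked(6)[of "n * (2 * N + 1)"] by auto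
        then have "odd (sum_list (map Q us))" using \<open>n \<ge> 1\<close> by simp
        then show ?thesis using ev[OF us(1)] by blast
      qed
    qed
  next
    case b
    obtain cX hX where fX: "lc X cX" "\<And>x. x \<in> X \<Longrightarrow> m * f x - 1 = cX (a x) - cX x"
      "lc X hX" "\<And>x. x \<in> X \<Longrightarrow> even (f x - p x - (hX (a x) - hX x))"
      using b(3) unfolding divisible_class_def coboundary2_def by blast
    obtain cY hY where gY: "lc Y g" "lc Y cY" "\<And>x. x \<in> Y \<Longrightarrow> m * g x - 1 = cY (b x) - cY x"
      "lc Y hY" "\<And>x. x \<in> Y \<Longrightarrow> even (g x - q x - (hY (b x) - hY x))"
      using b(4) unfolding divisible_class_def coboundary2_def by blast
    \<comment> \<open>Resolving \<open>g\<close> and both of its transfer functions makes them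
      potentials on the graph, so every closed walk has length \<open>m\<close> times an integer
      with the parity of its orientation.\<close>
    define G where "G y = (g y, cY y, hY y)" for y
    have lcG: "lc Y G" unfolding G_def using lc_comp2[OF gY(1) lc_comp2[OF gY(2,4), of Pair], of Pair] .
    show ?thesis
    proof (rule approx_conjugateI[OF X Y p q lcG])
      fix r :: "'b \<Rightarrow> nat" and Q y0
      assume r: "lc Y r" "\<And>y y'. y \<in> Y \<Longrightarrow> y' \<in> Y \<Longrightarrow> r y = r y' \<Longrightarrow> G y = G y'"
        and Q: "\<And>y. y \<in> Y \<Longrightarrow> Q (r y) = q y" and y0: "y0 \<in> Y"
      obtain k where k: "\<And>y. y \<in> Y \<Longrightarrow> k (r y) = G y" by (rule factor_through[of Y r G]) (use r(2) in blast)+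
      define kg kc kh where "kg v = fst (k v)" and "kc v = fst (snd (k v))" and "kh v = snd (snd (k v))" for v
      have kk: "kg (r y) = g y" "kc (r y) = cY y" "kh (r y) = hY y" if "y \<in> Y" for y
        using k[OF that] by (simp_all add: kg_def kc_def kh_def G_def)
      have len: "int (length us) = m * sum_list (map kg us) \<and> odd (sum_list (map kg us)) = odd (sum_list (map Q us))"
        if us: "walk (Y.step r) (r y0) us (r y0)" for us
      proof -
        have "sum_list (map (\<lambda>v. m * kg v - 1) us) = kc (r y0) - kc (r y0)"
        proof (rule walk_potential[OF _ us])
          fix v w assume "Y.step r v w"
          then obtain y where y: "y \<in> Y" "v = r y" "w = r (b y)" unfolding Y.step_def by blast
          then show "m * kg v - 1 = kc w - kc v" using gY(3)[OF y(1)] kk Y.aX by simp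
        qed
        moreover have "sum_list (map (\<lambda>v. m * kg v - 1) us) = m * sum_list (map kg us) - int (length us)"
          by (induction us) (auto simp: algebra_simps)
        moreover have "even (sum_list (map (\<lambda>v. kg v - Q v) us) - (kh (r y0) - kh (r y0)))"
        proof (rule walk_potential_parity[OF _ us])
          fix v w assume "Y.step r v w"
          then obtain y where y: "y \<in> Y" "v = r y" "w = r (b y)" unfolding Y.step_def by blast
          then show "even (kg v - Q v - (kh w - kh v))" using gY(5)[OF y(1)] kk Q Y.aX by simp
        qed
        moreover have "sum_list (map (\<lambda>v. kg v - Q v) us) = sum_list (map kg us) - sum_list (map Q us)"
          by (induction us) auto
        ultimately show ?thesis by auto
      qed
      from r(1) y0 show "\<exists>A N. \<exists>F :: 'a \<Rightarrow> int \<times> int \<times> int. admissible X a p (Y.step r) (r y0) Q A N F"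
      proof (cases rule: Y.closed_walk_cases[of r y0 Q])
        case (even n N)
        then have "coboundary2 Y b q" using Q unfolding coboundary2_def by auto
        then show ?thesis using b(1) by blast
      next
        case (free n N)
        then show ?thesis using X.admissible_free[of n "Y.step r" "r y0" N Q p] PS by blast
      next
        case (linked n N K C)
        have n1: "n \<ge> 1" using linked(1) Y.PS_base_iff by blast
        then have "N \<le> n * (2 * N + 1)" by (simp add: le_add1 trans_le_add2)
        then obtain us where us: "walk (Y.step r) (r y0) us (r y0)" "length us = n * (2 * N + 1)"
          "odd (sum_list (map Q us)) = odd (n * (2 * N + 1) div n)"
          using linked(6)[of "n * (2 * N + 1)"] by auto
        \<comment> \<open>An odd multiple of \<open>n\<close> equals \<open>m * t\<close> with
          \<open>t\<close> odd. Hence \<open>n\<close> and \<open>m\<close> contain the same power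
          of two, and quotients by \<open>n\<close> and by \<open>m\<close> have equal
          parity.\<close>
        define t where "t = sum_list (map kg us)"
        have "odd (sum_list (map Q us))" using us(3) n1 by simp
        then have t: "odd t" "int n * (2 * int N + 1) = m * t" using len[OF us(1)] us(2) by (auto simp: t_def algebra_simps)
        have par: "odd S = odd (L div n)" if L: "n dvd L" "int L = m * S" for L S
        proof -
          obtain l where l: "L = n * l" using L(1) by (auto simp: dvd_def)
          have "m * ((2 * int N + 1) * S) = (2 * int N + 1) * int L" unfolding L(2) by (simp add: algebra_simps)
          also have "\<dots> = int n * (2 * int N + 1) * int l" unfolding l by (simp add: algebra_simps)
          also have "\<dots> = m * (t * int l)" unfolding t(2) by simp
          finally have "(2 * int N + 1) * S = t * int l" using b(2) by simp
          then have "even ((2 * int N + 1) * S) = even (t * int l)" by simp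
          then have "even S = even l" using t(1) by simp
          then show ?thesis using l n1 by simp
        qed
        show ?thesis
          by (rule X.admissible_linked[of n "Y.step r" "r y0" Q N cX hX m f p])
            (use linked PS fX par in blast)+
      qed
    qed
  next
    case c
    show ?thesis
    \<comment> \<open>There is no witness to resolve here: the even and the linked type are both
      excluded because they would make \<open>q\<close> a coboundary.\<close>
    proof (rule approx_conjugateI[OF X Y p q lc_const[of Y "()"]])
      fix r :: "'b \<Rightarrow> nat" and Q y0
      assume r: "lc Y r" and Q: "\<And>y. y \<in> Y \<Longrightarrow> Q (r y) = q y" and y0: "y0 \<in> Y"
      from r y0 show "\<exists>A N. \<exists>F :: 'a \<Rightarrow> int \<times> int \<times> int. admissible X a p (Y.step r) (r y0) Q A N F"
      proof (cases rule: Y.closed_walk_cases[of r y0 Q])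
        case (even n N)
        then have "coboundary2 Y b q" using Q unfolding coboundary2_def by auto
        then show ?thesis using c(1) by blast
      next
        case (free n N)
        then show ?thesis using X.admissible_free[of n "Y.step r" "r y0" N Q p] PS by blast
      next
        case (linked n N K C)
        have n1: "n \<ge> 1" using linked(1) Y.PS_base_iff by blast
        have "coboundary2 Y b q"
          by (rule Y.linked_contradiction[OF q linked(2,3) _ n1]) (use linked(4) Q c(2) in auto)
        then show ?thesis using c(1) by blast
      qed
    qed
  qed
qed

section \<open>From approximate conjugacy of the base systems to the invariants\<close>

lemma approx_conjugate_exact:
  assumes Y: "minsys Y b b'" and "approx_conjugate X a p Y b q" and F: "lc Y F"
    and aX: "\<And>x. x \<in> X \<Longrightarrow> a x \<in> X"
  obtains s where "continuous_on X s" "\<And>x. x \<in> X \<Longrightarrow> s x \<in> Y" "\<And>x. x \<in> X \<Longrightarrow> F (s (a x)) = F (b (s x))"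
    "coboundary2 X a (\<lambda>x. q (s x) - p x)"
proof -
  interpret Y: minsys Y b b' by fact
  obtain d where d: "d > 0" "\<And>x y. x \<in> Y \<Longrightarrow> y \<in> Y \<Longrightarrow> dist x y < d \<Longrightarrow> F x = F y"
    by (fact lc_uniform[OF Y.cpt F])
  obtain s where s: "continuous_on X s" "s ` X = Y" "\<And>x. x \<in> X \<Longrightarrow> dist (s (a x)) (b (s x)) < d"
    "coboundary2 X a (\<lambda>x. q (s x) - p x)"
    using assms(2) d(1) unfolding approx_conjugate_def by blast
  have sY: "s x \<in> Y" if "x \<in> X" for x using s(2) that by blast
  show thesis
    by (rule that[OF s(1) sY _ s(4)]) (use d(2) s(3) sY aX Y.aX in auto)
qed

lemma coboundary2_diff:
  assumes "coboundary2 X a f" "coboundary2 X a (\<lambda>x. f x - g x)"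
  shows "coboundary2 X a g"
proof -
  obtain h :: "_ \<Rightarrow> int" where h: "lc X h" "\<And>x. x \<in> X \<Longrightarrow> even (f x - (h (a x) - h x))"
    using assms(1) unfolding coboundary2_def by blast
  obtain h' :: "_ \<Rightarrow> int" where h': "lc X h'" "\<And>x. x \<in> X \<Longrightarrow> even (f x - g x - (h' (a x) - h' x))"
    using assms(2) unfolding coboundary2_def by blast
  have "even (g x - ((h (a x) - h' (a x)) - (h x - h' x)))" if "x \<in> X" for x
    using h(2)[OF that] h'(2)[OF that] by presburger
  moreover have "lc X (\<lambda>x. h x - h' x)" using lc_comp2[OF h(1) h'(1)] .
  ultimately show ?thesis unfolding coboundary2_def by blast
qed

text \<open>The values of the eigenfunction on the two sheets of the cover differ by \<open>n / 2\<close>.\<close>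
lemma (in minsys) new_period_of_double_cover:
  assumes q: "lc X q" and nc: "\<not> coboundary2 X a q"
    and n: "n \<in> PS (X \<times> {0,1}) (skew2 a q)" "n \<notin> PS X a"
  obtains P :: nat and c g :: "'a \<Rightarrow> int" where "P > 0" "lc X c" "lc X g"
    "\<And>x. x \<in> X \<Longrightarrow> int P * g x - 1 = c (a x) - c x" "\<And>x. x \<in> X \<Longrightarrow> even (g x - q x)"
proof -
  obtain \<kappa> where n1: "n \<ge> 1" and \<kappa>: "lc (X \<times> {0,1}) \<kappa>" "\<And>z. z \<in> X \<times> {0,1} \<Longrightarrow> int n dvd \<kappa> (skew2 a q z) - \<kappa> z - 1"
    using n(1) PS_skew2_iff[OF q] by blast
  define u where "u x = \<kappa> (x, 0)" for x
  define v where "v x = \<kappa> (x, 1)" for x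
  have lcu: "lc X u" unfolding u_def by (rule lc_pullback[OF _ _ \<kappa>(1)]) (auto intro: continuous_intros)
  have lcv: "lc X v" unfolding v_def by (rule lc_pullback[OF _ _ \<kappa>(1)]) (auto intro: continuous_intros)
  have ev: "int n dvd u (a x) - u x - 1" "int n dvd v (a x) - v x - 1" if "x \<in> X" "even (q x)" for x
  proof -
    have "q x mod 2 = 0" "(1 + q x) mod 2 = 1" using that(2) by presburger+
    then show "int n dvd u (a x) - u x - 1" "int n dvd v (a x) - v x - 1"
      using \<kappa>(2)[of "(x,0)"] \<kappa>(2)[of "(x,1)"] that(1) by (simp_all add: skew2_def u_def v_def)
  qed
  have od: "int n dvd v (a x) - u x - 1" "int n dvd u (a x) - v x - 1" if "x \<in> X" "odd (q x)" for x
  proof -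
    have "q x mod 2 = 1" "(1 + q x) mod 2 = 0" using that(2) by presburger+
    then show "int n dvd v (a x) - u x - 1" "int n dvd u (a x) - v x - 1"
      using \<kappa>(2)[of "(x,0)"] \<kappa>(2)[of "(x,1)"] that(1) by (simp_all add: skew2_def u_def v_def)
  qed
  \<comment> \<open>The difference between the two sheets. Modulo \<open>n\<close> it is preserved
    where \<open>q\<close> is even and changes sign where \<open>q\<close> is odd; by minimality it
    takes only the values \<open>e0\<close> and \<open>- e0\<close>.\<close>
  define e where "e x = v x - u x" for x
  have lce: "lc X e" unfolding e_def using lc_comp2[OF lcv lcu] .
  have e_even: "int n dvd e (a x) - e x" if "x \<in> X" "even (q x)" for x
    using dvd_diff[OF ev(2,1)[OF that]] by (simp add: e_def algebra_simps)
  have e_odd: "int n dvd e (a x) + e x" if "x \<in> X" "odd (q x)" for x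
    using dvd_diff[OF od[OF that]] by (simp add: e_def algebra_simps)
  obtain x0 where x0: "x0 \<in> X" using ne by blast
  define e0 where "e0 = e x0"
  have flip: "int n dvd e (a x) - s \<longleftrightarrow> int n dvd e x + s" if "x \<in> X" "odd (q x)" for x s
  proof -
    have "e (a x) - s = (e (a x) + e x) - (e x + s)" by simp
    then show ?thesis using e_odd[OF that] by (metis dvd_diff_right_iff dvd_minus_iff minus_diff_eq)
  qed
  have keep: "int n dvd e (a x) - s \<longleftrightarrow> int n dvd e x - s" if "x \<in> X" "even (q x)" for x s
  proof -
    have "e (a x) - s = (e (a x) - e x) + (e x - s)" by simp
    then show ?thesis using e_even[OF that] by (metis dvd_add_right_iff)
  qed
  have pm: "int n dvd e x - e0 \<or> int n dvd e x + e0" if x: "x \<in> X" for x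
  proof -
    define R where "R x \<longleftrightarrow> int n dvd e x - e0 \<or> int n dvd e x + e0" for x
    have "R x = R x0"
    proof (rule invariant_constant[OF _ _ x x0])
      show "lc X R" unfolding R_def using lc_comp1[OF lce, of "\<lambda>t. int n dvd t - e0 \<or> int n dvd t + e0"] .
      fix y assume y: "y \<in> X"
      show "R (a y) = R y"
      proof (cases "even (q y)")
        case True
        then show ?thesis using keep[OF y True, of e0] keep[OF y True, of "- e0"] by (simp add: R_def)
      next
        case False
        then show ?thesis using flip[OF y False, of e0] flip[OF y False, of "- e0"] by (auto simp: R_def)
      qed
    qed
    moreover have "R x0" by (simp add: R_def e0_def)
    ultimately show ?thesis by (simp add: R_def)
  qed
  \<comment> \<open>If \<open>e0\<close> and \<open>- e0\<close> were distinct modulo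
    \<open>n\<close>, the indicator of the points where \<open>e\<close> equals \<open>e0\<close>
    would be a transfer function for \<open>q\<close>.\<close>
  have two: "int n dvd 2 * e0"
  proof (rule ccontr)
    assume not2: "\<not> int n dvd 2 * e0"
    define h where "h x = (if int n dvd e x - e0 then 1 else 0::int)" for x
    have excl: "int n dvd e x + e0 \<longleftrightarrow> \<not> int n dvd e x - e0" if "x \<in> X" for x
    proof -
      have "\<not> (int n dvd e x - e0 \<and> int n dvd e x + e0)"
      proof
        assume "int n dvd e x - e0 \<and> int n dvd e x + e0"
        then have "int n dvd (e x + e0) - (e x - e0)" using dvd_diff by blast
        then show False using not2 by simp
      qed
      then show ?thesis using pm[OF that] by blast
    qed
    have "even (q x - (h (a x) - h x))" if x: "x \<in> X" for x
    proof (cases "even (q x)")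
      case True
      then show ?thesis using keep[OF x True, of e0] by (simp add: h_def)
    next
      case False
      then show ?thesis using flip[OF x False, of e0] excl[OF x] by (simp add: h_def)
    qed
    moreover have "lc X h" unfolding h_def using lc_comp1[OF lce, of "\<lambda>t. if int n dvd t - e0 then 1 else 0::int"] .
    ultimately show False using nc unfolding coboundary2_def by blast
  qed
  \<comment> \<open>If the sheets agreed modulo \<open>n\<close>, the eigenfunction would descend to
    the base, where \<open>n\<close> is not a period.\<close>
  have one: "\<not> int n dvd e0"
  proof
    assume e0: "int n dvd e0"
    have ex: "int n dvd e x" if "x \<in> X" for x
      using pm[OF that] e0 by (metis add_diff_cancel_right' diff_add_cancel dvd_add dvd_diff)
    have "int n dvd u (a x) - u x - 1" if x: "x \<in> X" for x
    proof (cases "even (q x)")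
      case False
      have "int n dvd (v (a x) - u x - 1) - e (a x)" using od(1)[OF x False] ex[OF aX[OF x]] by (rule dvd_diff)
      then show ?thesis by (simp add: e_def algebra_simps)
    qed (use ev x in blast)
    then show False using n(2) n1 lcu PS_base_iff by blast
  qed
  obtain t where t: "2 * e0 = int n * t" using two by (auto simp: dvd_def)
  have "odd t"
  proof
    assume "even t"
    then obtain w where "t = 2 * w" by blast
    then have "e0 = int n * w" using t by simp
    then show False using one by simp
  qed
  \<comment> \<open>So \<open>e0\<close> is the element of order two modulo \<open>n\<close>, that
    is, \<open>P = n / 2\<close>.\<close>
  then have "even (int n)" using t by (metis even_mult_iff dvd_triv_left)
  then have "even n" by simp
  then obtain P where P: "n = 2 * P" by blast
  have P0: "P > 0" using n1 P by simp
  have "e0 = int P * t" using t P by simp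
  then have e0P: "int n dvd e0 - int P" "int n dvd e0 + int P"
  proof -
    obtain w where w: "t = 2 * w + 1" using \<open>odd t\<close> by (rule oddE)
    have "e0 - int P = int n * w" "e0 + int P = int n * (w + 1)"
      using \<open>e0 = int P * t\<close> unfolding w P by (simp_all add: algebra_simps)
    then show "int n dvd e0 - int P" "int n dvd e0 + int P" by simp_all
  qed
  have eP: "int n dvd e x - int P" if "x \<in> X" for x
    using pm[OF that]
  proof
    assume "int n dvd e x - e0"
    from dvd_add[OF this e0P(1)] show ?thesis by simp
  next
    assume "int n dvd e x + e0"
    from dvd_diff[OF this e0P(2)] show ?thesis by simp
  qed
  have key: "int n dvd 1 - (u (a x) - u x) - int P * q x" if x: "x \<in> X" for x
  proof (cases "even (q x)")
    case True
    then obtain w where w: "q x = 2 * w" by blast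
    have "1 - (u (a x) - u x) - int P * q x = - (u (a x) - u x - 1) - int n * w" unfolding w P by (simp add: algebra_simps)
    moreover have "int n dvd - (u (a x) - u x - 1) - int n * w" using ev(1)[OF x True] by (intro dvd_diff) (simp_all only: dvd_minus_iff dvd_triv_left)
    ultimately show ?thesis by metis
  next
    case False
    then obtain w where w: "q x = 2 * w + 1" by (rule oddE)
    have "1 - (u (a x) - u x) - int P * q x = (e (a x) - int P) - (v (a x) - u x - 1) - int n * w"
      unfolding w P by (simp add: e_def algebra_simps)
    moreover have "int n dvd (e (a x) - int P) - (v (a x) - u x - 1) - int n * w"
      by (rule dvd_diff[OF dvd_diff[OF eP[OF aX[OF x]] od(1)[OF x False]] dvd_triv_left])
    ultimately show ?thesis by metis
  qed
  \<comment> \<open>By \<open>key\<close>, \<open>u\<close> grows by \<open>1 - P * q\<close> modulo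
    \<open>2 * P\<close>. So the division by \<open>P\<close> is exact, and the quotient has the
    parity of \<open>q\<close>.\<close>
  define g where "g x = (1 - (u (a x) - u x)) div int P" for x
  have g: "int P * g x = 1 - (u (a x) - u x)" "even (g x - q x)" if x: "x \<in> X" for x
  proof -
    obtain w where w: "1 - (u (a x) - u x) - int P * q x = int n * w" using key[OF x] by (auto simp: dvd_def)
    then have eq: "1 - (u (a x) - u x) = int P * (q x + 2 * w)" unfolding P by (simp add: algebra_simps)
    then have "g x = q x + 2 * w" unfolding g_def using P0 by simp
    then show "int P * g x = 1 - (u (a x) - u x)" "even (g x - q x)" using eq by simp_all
  qed
  show thesis
  proof (rule that[OF P0, of "\<lambda>x. - u x" g])
    show "lc X (\<lambda>x. - u x)" using lc_comp1[OF lcu] .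
    show "lc X g" unfolding g_def using lc_comp2[OF lc_shift[OF lcu] lcu, of "\<lambda>s t. (1 - (s - t)) div int P"] .
  qed (use g in auto)
qed

theorem invariants_of_approx_conjugate:
  fixes X :: "'a::metric_space set" and Y :: "'b::metric_space set"
    and p :: "'a \<Rightarrow> int" and q :: "'b \<Rightarrow> int"
  assumes X: "minsys X a a'" and Y: "minsys Y b b'" and p: "lc X p" and q: "lc Y q"
    and conj: "approx_conjugate X a p Y b q"
  shows "PS Y b \<subseteq> PS X a \<and> ((coboundary2 Y b q \<and> coboundary2 X a p) \<or>
      (\<not> coboundary2 Y b q \<and> (\<exists>n\<ge>1. \<exists>f g. divisible_class X a p (2 ^ (n - 1)) f \<and> divisible_class Y b q (2 ^ (n - 1)) g)) \<or>
      (\<not> coboundary2 Y b q \<and> PS (Y \<times> {0,1}) (skew2 b q) = PS Y b))"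
proof -
  interpret X: minsys X a a' by fact
  interpret Y: minsys Y b b' by fact
  have exact: "\<exists>s. continuous_on X s \<and> (\<forall>x\<in>X. s x \<in> Y) \<and> (\<forall>x\<in>X. F (s (a x)) = F (b (s x))) \<and>
    coboundary2 X a (\<lambda>x. q (s x) - p x)" if "lc Y F" for F :: "'b \<Rightarrow> int"
    by (rule approx_conjugate_exact[OF Y conj that]) (use X.aX in blast)+
  have pull: "lc X (\<lambda>x. F (s x))" if "continuous_on X s" "\<And>x. x \<in> X \<Longrightarrow> s x \<in> Y" "lc Y F" for s and F :: "'b \<Rightarrow> int"
    using that by (intro lc_pullback[of X s Y F]) auto
  have "PS Y b \<subseteq> PS X a"
  proof
    fix n assume "n \<in> PS Y b"
    then obtain k where n: "n \<ge> 1" and k: "lc Y k" "\<And>y. y \<in> Y \<Longrightarrow> int n dvd k (b y) - k y - 1"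
      using Y.PS_base_iff by blast
    obtain s where s: "continuous_on X s" "\<And>x. x \<in> X \<Longrightarrow> s x \<in> Y" "\<And>x. x \<in> X \<Longrightarrow> k (s (a x)) = k (b (s x))"
      "coboundary2 X a (\<lambda>x. q (s x) - p x)" using exact[OF k(1)] by blast
    have "int n dvd k (s (a x)) - k (s x) - 1" if "x \<in> X" for x using k(2)[OF s(2)[OF that]] s(3)[OF that] by simp
    then show "n \<in> PS X a" using X.PS_base_iff n pull[OF s(1,2) k(1)] by blast
  qed
  moreover have "coboundary2 X a p" if "coboundary2 Y b q"
  proof -
    obtain h :: "'b \<Rightarrow> int" where h: "lc Y h" "\<And>y. y \<in> Y \<Longrightarrow> even (q y - (h (b y) - h y))"
      using \<open>coboundary2 Y b q\<close> unfolding coboundary2_def by blast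
    obtain s where s: "continuous_on X s" "\<And>x. x \<in> X \<Longrightarrow> s x \<in> Y" "\<And>x. x \<in> X \<Longrightarrow> h (s (a x)) = h (b (s x))"
      "coboundary2 X a (\<lambda>x. q (s x) - p x)" using exact[OF h(1)] by blast
    have "even (q (s x) - (h (s (a x)) - h (s x)))" if "x \<in> X" for x using h(2)[OF s(2)[OF that]] s(3)[OF that] by simp
    then have "coboundary2 X a (\<lambda>x. q (s x))" unfolding coboundary2_def using pull[OF s(1,2) h(1)] by blast
    then show ?thesis using coboundary2_diff s(4) by blast
  qed
  moreover have "\<exists>n\<ge>1. \<exists>f g. divisible_class X a p (2 ^ (n - 1)) f \<and> divisible_class Y b q (2 ^ (n - 1)) g"
    if nc: "\<not> coboundary2 Y b q" and PS: "PS (Y \<times> {0,1}) (skew2 b q) \<noteq> PS Y b"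
  proof -
    have "PS Y b \<subseteq> PS (Y \<times> {0,1}) (skew2 b q)"
    proof
      fix n assume "n \<in> PS Y b"
      then obtain k where n: "n \<ge> 1" and k: "lc Y k" "\<And>y. y \<in> Y \<Longrightarrow> int n dvd k (b y) - k y - 1"
        using Y.PS_base_iff by blast
      have "lc (Y \<times> {0::int,1}) (\<lambda>z. k (fst z))"
        by (rule lc_pullback[OF _ _ k(1)]) (auto intro: continuous_intros)
      moreover have "\<forall>z\<in>Y \<times> {0,1}. int n dvd k (fst (skew2 b q z)) - k (fst z) - 1"
        using k(2) by (auto simp: skew2_def)
      ultimately show "n \<in> PS (Y \<times> {0,1}) (skew2 b q)" using Y.PS_skew2_iff[OF q] n by blast
    qed
    then obtain n where n: "n \<in> PS (Y \<times> {0,1}) (skew2 b q)" "n \<notin> PS Y b" using PS by blast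
    obtain P :: nat and c g :: "'b \<Rightarrow> int" where P: "P > 0" "lc Y c" "lc Y g"
      "\<And>y. y \<in> Y \<Longrightarrow> int P * g y - 1 = c (b y) - c y" "\<And>y. y \<in> Y \<Longrightarrow> even (g y - q y)"
      by (fact Y.new_period_of_double_cover[OF q nc n])
    \<comment> \<open>The odd factor \<open>w\<close> goes into the function
      \<open>g' = w * g\<close>, whose values keep the parity of those of \<open>g\<close>; the
      remaining multiplier is a power of two.\<close>
    obtain k w where kw: "P = 2 ^ k * w" "odd w"
      using multiplicity_decompose'[of P 2] P(1) by (metis bits_one_mod_two_eq_one not_is_unit_0 odd_one gr_implies_not0)
    define g' where "g' y = int w * g y" for y
    have lcg': "lc Y g'" unfolding g'_def using lc_comp1[OF P(3)] .
    have g'1: "2 ^ k * g' y - 1 = c (b y) - c y" if "y \<in> Y" for y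
      using P(4)[OF that] unfolding kw(1) by (simp add: g'_def mult.assoc)
    have g'2: "even (g' y - q y)" if "y \<in> Y" for y
      using P(5)[OF that] kw(2) by (simp add: g'_def)
    have Ydiv: "divisible_class Y b q (2 ^ k) g'"
      unfolding divisible_class_def coboundary2_def
    proof (intro conjI lcg')
      show "\<exists>c::'b \<Rightarrow> int. lc Y c \<and> (\<forall>x\<in>Y. 2 ^ k * g' x - 1 = c (b x) - c x)" using P(2) g'1 by blast
      show "\<exists>h::'b \<Rightarrow> int. lc Y h \<and> (\<forall>x\<in>Y. even (g' x - q x - (h (b x) - h x)))"
        by (rule exI[of _ "\<lambda>_. 0"]) (use g'2 in auto)
    qed
    obtain s where s: "continuous_on X s" "\<And>x. x \<in> X \<Longrightarrow> s x \<in> Y" "\<And>x. x \<in> X \<Longrightarrow> c (s (a x)) = c (b (s x))"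
      "coboundary2 X a (\<lambda>x. q (s x) - p x)" using exact[OF P(2)] by blast
    have "divisible_class X a p (2 ^ k) (\<lambda>x. g' (s x))"
      unfolding divisible_class_def
    proof (intro conjI)
      show "lc X (\<lambda>x. g' (s x))" by (rule pull[OF s(1,2) lcg'])
      have "2 ^ k * g' (s x) - 1 = c (s (a x)) - c (s x)" if "x \<in> X" for x
        using g'1[OF s(2)[OF that]] s(3)[OF that] by simp
      then show "\<exists>c::'a \<Rightarrow> int. lc X c \<and> (\<forall>x\<in>X. 2 ^ k * g' (s x) - 1 = c (a x) - c x)"
        using pull[OF s(1,2) P(2)] by (intro exI[of _ "\<lambda>x. c (s x)"]) blast
      obtain h :: "'a \<Rightarrow> int" where h: "lc X h" "\<And>x. x \<in> X \<Longrightarrow> even (q (s x) - p x - (h (a x) - h x))"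
        using s(4) unfolding coboundary2_def by blast
      have "even (g' (s x) - p x - (h (a x) - h x))" if "x \<in> X" for x
        using h(2)[OF that] g'2[OF s(2)[OF that]] by presburger
      then show "coboundary2 X a (\<lambda>x. g' (s x) - p x)" unfolding coboundary2_def using h(1) by blast
    qed
    then show ?thesis using Ydiv by (intro exI[of _ "Suc k"]) auto
  qed
  ultimately show ?thesis by blast
qed

section \<open>The degree of a circle map\<close>

text \<open>\<open>g\<close> is a lift of \<open>f\<close> to the line in the angle coordinate.
  Degree is a relation; uniqueness is the case of two equal maps in
  \<open>has_degree_close\<close>.\<close>

definition has_degree :: "(complex \<Rightarrow> complex) \<Rightarrow> int \<Rightarrow> bool" where
  "has_degree f n \<longleftrightarrow> (\<exists>g :: real \<Rightarrow> real. continuous_on UNIV g \<and> (\<forall>t. f (cis t) = cis (g t)) \<and>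
     (\<forall>t. g (t + 2 * pi) = g t + 2 * pi * of_int n))"

lemma circle_cis:
  assumes "z \<in> circle"
  shows "z = cis (Arg z)"
proof -
  have "z \<noteq> 0" using assms by auto
  then show ?thesis using cis_Arg[of z] assms by (simp add: sgn_eq)
qed

lemma cis_circle: "cis t \<in> circle"
  by simp

lemma cis_eq_iff_int: "cis s = cis t \<longleftrightarrow> (\<exists>n::int. s = t + 2 * pi * of_int n)"
proof -
  have "cis s = cis t \<longleftrightarrow> sin s = sin t \<and> cos s = cos t" by (auto simp: complex_eq_iff)
  also have "\<dots> \<longleftrightarrow> (\<exists>n::int. s = t + 2 * pi * of_int n)"
    unfolding sin_cos_eq_iff by (auto simp: algebra_simps)
  finally show ?thesis .
qed

text \<open>The line is contractible, so \<open>f (cis t)\<close> has a continuous logarithm, purely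
  imaginary because \<open>f\<close> has modulus 1. Its increment over a period is a continuous
  integer multiple of \<open>2 * pi\<close>, hence constant.\<close>

lemma has_degree_exists:
  assumes "continuous_on circle f" "f ` circle \<subseteq> circle"
  obtains n where "has_degree f n"
proof -
  have "continuous_on UNIV (\<lambda>t. f (cis t))"
    by (rule continuous_on_compose2[OF assms(1)]) (auto intro: continuous_intros)
  moreover have nz: "cmod (f (cis t)) = 1" for t using assms(2) by (auto simp: image_subset_iff)
  then have "f (cis t) \<noteq> 0" for t by (metis norm_zero zero_neq_one)
  ultimately obtain G where G: "continuous_on UNIV G" "\<And>t. f (cis t) = exp (G t)"
    using continuous_logarithm_on_contractible[of UNIV "\<lambda>t. f (cis t)"] contractible_UNIV by (metis UNIV_I)
  define g where "g t = Im (G t)" for t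
  have g: "f (cis t) = cis (g t)" for t
  proof -
    have "Re (G t) = 0" using nz[of t] unfolding G(2) by simp
    then show ?thesis unfolding G(2) g_def by (simp add: exp_eq_polar)
  qed
  have gc: "continuous_on UNIV g" unfolding g_def using G(1) by (intro continuous_intros)
  define k where "k t = (g (t + 2 * pi) - g t) / (2 * pi)" for t
  have kint: "\<exists>n::int. k t = of_int n" for t
  proof -
    have "cis (t + 2 * pi) = cis t" by (simp add: cis_mult[symmetric])
    then have "cis (g (t + 2 * pi)) = cis (g t)" by (metis g)
    then obtain n :: int where "g (t + 2 * pi) = g t + 2 * pi * of_int n" unfolding cis_eq_iff_int by blast
    then show ?thesis by (intro exI[of _ n]) (simp add: k_def)
  qed
  have "continuous_on UNIV k"
    unfolding k_def by (intro continuous_intros continuous_on_compose2[OF gc]) auto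
  moreover have "\<exists>e>0. \<forall>y. y \<in> UNIV \<and> k y \<noteq> k x \<longrightarrow> e \<le> norm (k y - k x)" for x
  proof (intro exI[of _ 1] conjI allI impI)
    fix y assume "y \<in> UNIV \<and> k y \<noteq> k x"
    moreover obtain m n :: int where "k y = of_int m" "k x = of_int n" using kint by metis
    ultimately have "m \<noteq> n" by auto
    then have "1 \<le> \<bar>m - n\<bar>" by simp
    then have "(1::real) \<le> \<bar>of_int m - of_int n\<bar>" by linarith
    then show "1 \<le> norm (k y - k x)" using \<open>k y = of_int m\<close> \<open>k x = of_int n\<close> by simp
  qed simp
  ultimately have "k constant_on UNIV"
    using continuous_discrete_range_constant[of UNIV k] connected_UNIV by blast
  then obtain c where c: "\<And>t. k t = c" unfolding constant_on_def by blast
  obtain n :: int where n: "c = of_int n" using kint c by metis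
  have "g (t + 2 * pi) = g t + 2 * pi * of_int n" for t
    using c[of t] unfolding n k_def by (simp add: field_simps)
  then have "has_degree f n" unfolding has_degree_def using g gc by blast
  then show thesis by (rule that)
qed

text \<open>If \<open>n > m\<close>, the difference of the lifts grows by at least
  \<open>2 * pi\<close> over a period and therefore meets an odd multiple of \<open>pi\<close>. At
  such a point the two values are antipodal, at distance 2. The index \<open>j\<close> selects the
  first odd multiple not below \<open>d 0\<close>.\<close>

lemma has_degree_close_le:
  assumes "has_degree f n" "has_degree f' m" "\<And>z. z \<in> circle \<Longrightarrow> cmod (f z - f' z) < 2"
  shows "n \<le> m"
proof (rule ccontr)
  assume "\<not> n \<le> m"
  then have nm: "(1::real) \<le> of_int n - of_int m" by linarith
  obtain g where g: "continuous_on UNIV g" "\<And>t. f (cis t) = cis (g t)" "\<And>t. g (t + 2 * pi) = g t + 2 * pi * of_int n"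
    using assms(1) unfolding has_degree_def by blast
  obtain g' where g': "continuous_on UNIV g'" "\<And>t. f' (cis t) = cis (g' t)" "\<And>t. g' (t + 2 * pi) = g' t + 2 * pi * of_int m"
    using assms(2) unfolding has_degree_def by blast
  define d where "d t = g t - g' t" for t
  define j where "j = \<lceil>(d 0 - pi) / (2 * pi)\<rceil>"
  define y where "y = pi + 2 * pi * of_int j"
  have "(d 0 - pi) / (2 * pi) \<le> of_int j" "of_int j < (d 0 - pi) / (2 * pi) + 1"
    unfolding j_def by linarith+
  then have "d 0 \<le> y" "y \<le> d 0 + 2 * pi" by (simp_all add: y_def field_simps)
  moreover have "d (2 * pi) = d 0 + 2 * pi * (of_int n - of_int m)"
    using g(3)[of 0] g'(3)[of 0] by (simp add: d_def algebra_simps)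
  moreover have "2 * pi * 1 \<le> 2 * pi * (of_int n - of_int m)" using nm by (intro mult_left_mono) auto
  ultimately have "d 0 \<le> y" "y \<le> d (2 * pi)" by linarith+
  moreover have "continuous_on {0..2*pi} d"
    unfolding d_def using g(1) g'(1) continuous_on_subset by (intro continuous_intros) blast+
  ultimately obtain t where "d t = y" using IVT'[of d 0 y "2 * pi"] by auto
  then have "g t = g' t + pi + 2 * pi * of_int j" by (simp add: d_def y_def)
  then have "cis (g t) = cis (g' t + pi)" unfolding cis_eq_iff_int by blast
  then have "f (cis t) = - f' (cis t)" unfolding g(2) g'(2) by (simp add: cis_mult[symmetric])
  then have "cmod (f (cis t) - f' (cis t)) = 2 * cmod (f' (cis t))" by (metis norm_minus_cancel norm_mult norm_numeral mult_2 minus_diff_eq diff_minus_eq_add minus_minus)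
  then have "cmod (f (cis t) - f' (cis t)) = 2" unfolding g'(2) by simp
  then show False using assms(3)[OF cis_circle, of t] by simp
qed

lemma has_degree_close:
  assumes "has_degree f n" "has_degree f' m" "\<And>z. z \<in> circle \<Longrightarrow> cmod (f z - f' z) < 2"
  shows "n = m"
proof (rule antisym)
  show "n \<le> m" using assms by (rule has_degree_close_le)
  show "m \<le> n" by (rule has_degree_close_le[OF assms(2,1)]) (metis assms(3) norm_minus_commute)
qed

lemma has_degree_compose:
  assumes "has_degree f n" "has_degree f' m"
  shows "has_degree (\<lambda>z. f (f' z)) (n * m)"
proof -
  obtain g where g: "continuous_on UNIV g" "\<And>t. f (cis t) = cis (g t)" "\<And>t. g (t + 2 * pi) = g t + 2 * pi * of_int n"
    using assms(1) unfolding has_degree_def by blast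
  obtain g' where g': "continuous_on UNIV g'" "\<And>t. f' (cis t) = cis (g' t)" "\<And>t. g' (t + 2 * pi) = g' t + 2 * pi * of_int m"
    using assms(2) unfolding has_degree_def by blast
  have nat: "g (t + 2 * pi * of_nat k) = g t + 2 * pi * of_int n * of_nat k" for t and k :: nat
  proof (induction k)
    case (Suc k)
    have "g (t + 2 * pi * of_nat (Suc k)) = g ((t + 2 * pi * of_nat k) + 2 * pi)" by (simp add: algebra_simps)
    also have "\<dots> = g t + 2 * pi * of_int n * of_nat (Suc k)" unfolding g(3) Suc by (simp add: algebra_simps)
    finally show ?case .
  qed simp
  have int: "g (t + 2 * pi * of_int k) = g t + 2 * pi * of_int (n * k)" for t k
  proof (cases "k \<ge> 0")
    case True
    then show ?thesis using nat[of t "nat k"] by (simp add: algebra_simps)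
  next
    case False
    then show ?thesis using nat[of "t + 2 * pi * of_int k" "nat (- k)"] by (simp add: algebra_simps)
  qed
  show ?thesis
    unfolding has_degree_def
  proof (intro exI[of _ "\<lambda>t. g (g' t)"] conjI allI)
    show "continuous_on UNIV (\<lambda>t. g (g' t))" by (rule continuous_on_compose2[OF g(1) g'(1)]) auto
  qed (simp_all add: g(2) g'(2,3) int)
qed

lemma has_degree_cong: "has_degree f n \<Longrightarrow> (\<And>z. z \<in> circle \<Longrightarrow> f z = f' z) \<Longrightarrow> has_degree f' n"
  unfolding has_degree_def using cis_circle by simp

lemma has_degree_rotation:
  assumes "cmod c = 1"
  shows "has_degree (\<lambda>z. c * z) 1" "has_degree (\<lambda>z. c * cnj z) (- 1)"
proof -
  have c: "c = cis (Arg c)" using circle_cis assms by simp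
  show "has_degree (\<lambda>z. c * z) 1"
    unfolding has_degree_def
    by (rule exI[of _ "\<lambda>t. Arg c + t"]) (auto intro: continuous_intros simp: cis_mult[symmetric] simp flip: c)
  show "has_degree (\<lambda>z. c * cnj z) (- 1)"
    unfolding has_degree_def
  proof (intro exI[of _ "\<lambda>t. Arg c - t"] conjI allI)
    show "c * cnj (cis t) = cis (Arg c - t)" for t
      by (subst c) (simp add: cis_cnj cis_mult)
  qed (auto intro!: continuous_intros)
qed

text \<open>Degrees multiply under composition, so the degree divides that of the identity.\<close>

lemma has_degree_invertible:
  assumes "has_degree f n" "continuous_on circle f'" "f' ` circle \<subseteq> circle" "\<And>z. z \<in> circle \<Longrightarrow> f (f' z) = z"
  shows "n = 1 \<or> n = - 1"
proof -
  obtain m where m: "has_degree f' m" by (fact has_degree_exists[OF assms(2,3)])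
  have "has_degree (\<lambda>z. z) (n * m)" by (rule has_degree_cong[OF has_degree_compose[OF assms(1) m] assms(4)])
  moreover have "has_degree (\<lambda>z. z) 1" using has_degree_rotation(1)[of 1] by simp
  ultimately have "n * m = 1" using has_degree_close[of "\<lambda>z. z" "n * m" "\<lambda>z. z" 1] by simp
  then show ?thesis using zmult_eq_1_iff by blast
qed

section \<open>Isometric circle extensions\<close>

text \<open>The \<open>k\<close>-th power of complex conjugation. An isometry becomes a rotation
  times \<open>cj\<close>, and composing reflections becomes adding exponents.\<close>

definition cj :: "int \<Rightarrow> complex \<Rightarrow> complex" where
  "cj k z = (if odd k then cnj z else z)"

lemma norm_cj [simp]: "cmod (cj k z) = cmod z"
  by (simp add: cj_def)

lemma cj_mult: "cj k (z * w) = cj k z * cj k w"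
  by (simp add: cj_def)

lemma cj_cj: "cj k (cj l z) = cj (k + l) z"
  by (auto simp: cj_def)

lemma cj_cong: "even (k - l) \<Longrightarrow> cj k z = cj l z"
  by (auto simp: cj_def)

lemma continuous_on_cj:
  assumes "lc X k" "continuous_on X f"
  shows "continuous_on X (\<lambda>x. cj (k x) (f x))"
proof -
  have "lc X (\<lambda>x. of_bool (odd (k x)) :: complex)" using lc_comp1[OF assms(1)] .
  then have "continuous_on X (\<lambda>x. of_bool (odd (k x)) * cnj (f x) + (1 - of_bool (odd (k x))) * f x)"
    using assms(2) lc_imp_continuous_on by (intro continuous_intros) blast+
  moreover have "of_bool (odd (k x)) * cnj (f x) + (1 - of_bool (odd (k x))) * f x = cj (k x) (f x)" for x
    by (simp add: cj_def)
  ultimately show ?thesis by simp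
qed

lemma Isom_T_eq:
  assumes "f \<in> Isom_T"
  shows "f z = f 1 * cj (if orient_pres f then 0 else 1) z" "cmod (f 1) = 1"
proof -
  obtain c where c: "cmod c = 1" "f = (\<lambda>z. c * z) \<or> f = (\<lambda>z. c * cnj z)" using assms by (auto simp: Isom_T_def)
  show "cmod (f 1) = 1" using c by auto
  show "f z = f 1 * cj (if orient_pres f then 0 else 1) z"
  proof (cases "orient_pres f")
    case True
    then obtain d where "f = (\<lambda>z. d * z)" by (auto simp: orient_pres_def)
    then show ?thesis using True by (simp add: cj_def)
  next
    case False
    then have "f = (\<lambda>z. c * cnj z)" using c by (auto simp: orient_pres_def)
    then show ?thesis using False by (simp add: cj_def)
  qed
qed

lemma isom_cocycle_eq:
  assumes "isom_cocycle X \<phi>" "x \<in> X"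
  shows "\<phi> x z = \<phi> x 1 * cj (orient \<phi> x) z" "cmod (\<phi> x 1) = 1"
proof -
  have "\<phi> x \<in> Isom_T" using assms by (auto simp: isom_cocycle_def)
  then show "\<phi> x z = \<phi> x 1 * cj (orient \<phi> x) z" "cmod (\<phi> x 1) = 1"
    unfolding orient_def by (fact Isom_T_eq)+
qed

lemma isom_cocycle_degree:
  assumes "isom_cocycle X \<phi>" "x \<in> X"
  shows "has_degree (\<phi> x) (if odd (orient \<phi> x) then - 1 else 1)"
proof -
  have "\<phi> x = (\<lambda>z. \<phi> x 1 * cj (orient \<phi> x) z)" using isom_cocycle_eq(1)[OF assms] by blast
  then show ?thesis
    using has_degree_rotation[OF isom_cocycle_eq(2)[OF assms]] by (auto simp: cj_def split: if_splits)
qed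

lemma isom_cocycle_continuous:
  assumes "isom_cocycle X \<phi>"
  shows "continuous_on X (\<lambda>x. \<phi> x 1)"
  unfolding continuous_on_iff
proof (intro ballI allI impI)
  fix x and e :: real assume "x \<in> X" "e > 0"
  then obtain d where "d > 0" "\<forall>x'\<in>X. dist x' x < d \<longrightarrow> (\<forall>z\<in>circle. dist (\<phi> x' z) (\<phi> x z) < e)"
    using assms unfolding isom_cocycle_def by blast
  then show "\<exists>d>0. \<forall>x'\<in>X. dist x' x < d \<longrightarrow> dist (\<phi> x' 1) (\<phi> x 1) < e" by auto
qed

text \<open>Orientation is the sign of the degree, and circle maps at distance less than 2 have
  equal degree.\<close>

lemma lc_orient:
  assumes "isom_cocycle X \<phi>"
  shows "lc X (orient \<phi>)"
proof (rule lcI)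
  fix x assume x: "x \<in> X"
  obtain d where d: "d > 0" "\<forall>x'\<in>X. dist x' x < d \<longrightarrow> (\<forall>z\<in>circle. dist (\<phi> x' z) (\<phi> x z) < 2)"
    using assms x unfolding isom_cocycle_def by (meson zero_less_numeral)
  show "\<exists>U. open U \<and> x \<in> U \<and> (\<forall>x'\<in>U \<inter> X. orient \<phi> x' = orient \<phi> x)"
  proof (intro exI[of _ "ball x d"] conjI ballI)
    fix x' assume x': "x' \<in> ball x d \<inter> X"
    then have "dist (\<phi> x' z) (\<phi> x z) < 2" if "z \<in> circle" for z using d(2) that by (auto simp: dist_commute)
    then have "(if odd (orient \<phi> x') then - 1 else 1) = (if odd (orient \<phi> x) then - 1 else 1::int)"
      using has_degree_close[OF isom_cocycle_degree[OF assms, of x'] isom_cocycle_degree[OF assms x]] x'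
      by (simp add: dist_norm)
    then show "orient \<phi> x' = orient \<phi> x" by (auto simp: orient_def split: if_splits)
  qed (use d in auto)
qed

section \<open>Lifting a conjugacy of the bases to the circle extensions\<close>

lemma homeomorphism_inv_into:
  assumes "homeomorphism S T f g"
  shows "homeomorphism S T f (inv_into S f)"
proof (rule homeomorphism_cong[OF assms])
  fix y assume y: "y \<in> T"
  have "inj_on f S" using assms by (metis homeomorphism_def inj_on_inverseI)
  then show "inv_into S f y = g y" using y assms
    by (metis homeomorphism_def image_eqI inv_into_f_f)
qed auto

text \<open>The lift has the form \<open>(s x, u x * cj (h x) z)\<close>. The reflections
  \<open>h\<close> are taken from the coboundary, so that both ways around the square conjugate
  \<open>z\<close> equally often modulo two; only an equation for the rotation part \<open>u\<close>
  remains.\<close>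

theorem approx_conjugate_imp_skew:
  fixes X :: "'a::metric_space set" and Y :: "'b::metric_space set"
  assumes X: "minsys X a a'" and Y: "minsys Y b b'" and \<phi>: "isom_cocycle X \<phi>" and \<psi>: "isom_cocycle Y \<psi>"
    and conj: "approx_conjugate X a (orient \<phi>) Y b (orient \<psi>)" and e: "e > 0"
  obtains \<sigma> where "homeomorphism (X \<times> circle) (Y \<times> circle) \<sigma> (inv_into (X \<times> circle) \<sigma>)"
    "\<And>w. w \<in> Y \<times> circle \<Longrightarrow> dist ((\<sigma> \<circ> skew a \<phi> \<circ> inv_into (X \<times> circle) \<sigma>) w) (skew b \<psi> w) < e"
proof -
  interpret X: minsys X a a' by fact
  interpret Y: minsys Y b b' by fact
  have e2: "e/2 > 0" using e by simp
  obtain s where s: "continuous_on X s" "s ` X = Y" "inj_on s X" "\<And>x. x \<in> X \<Longrightarrow> dist (s (a x)) (b (s x)) < e/2"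
    and cob: "coboundary2 X a (\<lambda>x. orient \<psi> (s x) - orient \<phi> x)"
    using conj e2 unfolding approx_conjugate_def by blast
  obtain h :: "'a \<Rightarrow> int" where h: "lc X h" "\<And>x. x \<in> X \<Longrightarrow> even (orient \<psi> (s x) - orient \<phi> x - (h (a x) - h x))"
    using cob unfolding coboundary2_def by blast
  have sY: "s x \<in> Y" if "x \<in> X" for x using s(2) that by blast
  \<comment> \<open>Equating the rotation parts of both ways around the square and solving for
    \<open>u (a x)\<close> gives the factor \<open>d x\<close>; the conjugate is the inverse of a
    number of modulus 1.\<close>
  define d where "d x = \<psi> (s x) 1 * cnj (cj (h (a x)) (\<phi> x 1))" for x
  have "continuous_on X (\<lambda>x. \<psi> (s x) 1)"
    by (rule continuous_on_compose2[OF isom_cocycle_continuous[OF \<psi>] s(1)]) (use s(2) in simp)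
  then have d1: "continuous_on X d"
    unfolding d_def by (intro continuous_intros continuous_on_cj X.lc_shift[OF h(1)] isom_cocycle_continuous[OF \<phi>])
  have d2: "cmod (d x) = 1" if "x \<in> X" for x
    using isom_cocycle_eq(2)[OF \<phi> that] isom_cocycle_eq(2)[OF \<psi> sY[OF that]] by (simp add: d_def norm_mult)
  have lq: "lc X (\<lambda>x. orient \<psi> (s x))" by (rule lc_pullback[OF s(1) _ lc_orient[OF \<psi>]]) (use s(2) in simp)
  have c: "lc X (\<lambda>x. odd (orient \<psi> (s x)))" using lc_comp1[OF lq] .
  obtain u where u: "lc X u" "\<And>x. x \<in> X \<Longrightarrow> cmod (u x) = 1"
    "\<And>x. x \<in> X \<Longrightarrow> cmod (u (a x) - d x * (if odd (orient \<psi> (s x)) then cnj (u x) else u x)) < e/2"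
    by (rule X.approximate_cohomological_equation[OF d1 _ c e2]) (use d2 in auto)
  define \<sigma> where "\<sigma> w = (s (fst w), u (fst w) * cj (h (fst w)) (snd w))" for w :: "'a \<times> complex"
  have cont: "continuous_on (X \<times> circle) \<sigma>"
    unfolding \<sigma>_def
  proof (intro continuous_on_Pair continuous_on_mult)
    show "continuous_on (X \<times> circle) (\<lambda>w. s (fst w))"
      by (rule continuous_on_compose2[OF s(1)]) (auto intro: continuous_intros)
    show "continuous_on (X \<times> circle) (\<lambda>w. u (fst w))"
      by (rule continuous_on_compose2[OF lc_imp_continuous_on[OF u(1)]]) (auto intro: continuous_intros)
    show "continuous_on (X \<times> circle) (\<lambda>w. cj (h (fst w)) (snd w))"
    proof (rule continuous_on_cj)
      show "lc (X \<times> circle) (\<lambda>w. h (fst w))" by (rule lc_pullback[OF _ _ h(1)]) (auto intro: continuous_intros)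
    qed (intro continuous_intros)
  qed
  have uu: "cnj (u x) * u x = 1" if "x \<in> X" for x
    using u(2)[OF that] complex_norm_square[of "u x"] by (simp add: mult.commute)
  have inj: "inj_on \<sigma> (X \<times> circle)"
  proof (rule inj_onI)
    fix v w assume vw: "v \<in> X \<times> circle" "w \<in> X \<times> circle" "\<sigma> v = \<sigma> w"
    then have fst: "fst v = fst w" using s(3) by (auto simp: \<sigma>_def inj_on_def)
    have "fst v \<in> X" using vw by auto
    then have "u (fst v) \<noteq> 0" using u(2) by force
    then have "cj (h (fst v)) (snd v) = cj (h (fst v)) (snd w)" using vw(3) fst by (simp add: \<sigma>_def)
    then have "snd v = snd w" by (auto simp: cj_def split: if_splits)
    with fst show "v = w" by (rule prod_eqI)
  qed
  have img: "\<sigma> ` (X \<times> circle) = Y \<times> circle"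
  proof
    show "\<sigma> ` (X \<times> circle) \<subseteq> Y \<times> circle" using sY u(2) by (auto simp: \<sigma>_def norm_mult)
    show "Y \<times> circle \<subseteq> \<sigma> ` (X \<times> circle)"
    proof
      fix w assume w: "w \<in> Y \<times> circle"
      then obtain x where x: "x \<in> X" "s x = fst w" using s(2) by force
      let ?z = "cj (h x) (cnj (u x) * snd w)"
      have "u x * cj (h x) ?z = u x * (cnj (u x) * snd w)" by (simp add: cj_cj cj_def)
      also have "\<dots> = (cnj (u x) * u x) * snd w" by (simp add: mult_ac)
      also have "\<dots> = snd w" unfolding uu[OF x(1)] by simp
      finally have "\<sigma> (x, ?z) = w" using x by (simp add: \<sigma>_def)
      moreover have "(x, ?z) \<in> X \<times> circle" using x w u(2)[OF x(1)] by (auto simp: norm_mult)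
      ultimately show "w \<in> \<sigma> ` (X \<times> circle)" by (metis image_eqI)
    qed
  qed
  have cmp: "compact (X \<times> circle)" using X.cpt compact_sphere by (rule compact_Times)
  obtain g where "homeomorphism (X \<times> circle) (Y \<times> circle) \<sigma> g"
    using homeomorphism_compact[OF cmp cont img inj] by blast
  then have hom: "homeomorphism (X \<times> circle) (Y \<times> circle) \<sigma> (inv_into (X \<times> circle) \<sigma>)"
    by (rule homeomorphism_inv_into)
  show thesis
  proof (rule that[OF hom])
    fix w assume "w \<in> Y \<times> circle"
    then obtain v where v: "v \<in> X \<times> circle" "w = \<sigma> v" using img by blast
    obtain x z where xz: "v = (x, z)" "x \<in> X" "cmod z = 1" using v(1) by auto
    have inv: "inv_into (X \<times> circle) \<sigma> w = (x, z)" using v inj xz by (simp add: inv_into_f_f)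
    let ?k = "orient \<psi> (s x) + h x"
    have 1: "(\<sigma> \<circ> skew a \<phi> \<circ> inv_into (X \<times> circle) \<sigma>) w = (s (a x), u (a x) * cj (h (a x)) (\<phi> x z))"
      using inv by (simp add: skew_def \<sigma>_def)
    have 2: "skew b \<psi> w = (b (s x), \<psi> (s x) (u x * cj (h x) z))" using v xz by (simp add: skew_def \<sigma>_def)
    have "cj (h (a x)) (\<phi> x z) = cj (h (a x)) (\<phi> x 1) * cj (h (a x) + orient \<phi> x) z"
      by (subst isom_cocycle_eq(1)[OF \<phi> xz(2)]) (simp add: cj_mult cj_cj)
    also have "cj (h (a x) + orient \<phi> x) z = cj ?k z" by (rule cj_cong) (use h(2)[OF xz(2)] in presburger)
    finally have 3: "cj (h (a x)) (\<phi> x z) = cj (h (a x)) (\<phi> x 1) * cj ?k z" .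
    have 4: "\<psi> (s x) (u x * cj (h x) z) = \<psi> (s x) 1 * cj (orient \<psi> (s x)) (u x) * cj ?k z"
      by (subst isom_cocycle_eq(1)[OF \<psi> sY[OF xz(2)]]) (simp add: cj_mult cj_cj)
    let ?c = "cj (h (a x)) (\<phi> x 1)"
    have c1: "cmod ?c = 1" using isom_cocycle_eq(2)[OF \<phi> xz(2)] by simp
    then have cc: "cnj ?c * ?c = 1" using complex_norm_square[of ?c] by (simp add: mult.commute)
    have "dist (u (a x) * cj (h (a x)) (\<phi> x z)) (\<psi> (s x) (u x * cj (h x) z))
        = cmod ((u (a x) * ?c - \<psi> (s x) 1 * cj (orient \<psi> (s x)) (u x)) * cj ?k z)"
      unfolding 3 4 dist_norm by (simp add: algebra_simps)
    also have "u (a x) * ?c - \<psi> (s x) 1 * cj (orient \<psi> (s x)) (u x)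
        = u (a x) * ?c - \<psi> (s x) 1 * cj (orient \<psi> (s x)) (u x) * (cnj ?c * ?c)" unfolding cc by simp
    also have "\<dots> = (u (a x) - d x * cj (orient \<psi> (s x)) (u x)) * ?c" by (simp add: d_def algebra_simps)
    also have "cmod (\<dots> * cj ?k z) = cmod (u (a x) - d x * cj (orient \<psi> (s x)) (u x))"
      using c1 xz(3) by (simp add: norm_mult)
    also have "\<dots> < e/2" using u(3)[OF xz(2)] by (simp add: cj_def)
    finally have "dist (u (a x) * cj (h (a x)) (\<phi> x z)) (\<psi> (s x) (u x * cj (h x) z)) < e/2" .
    moreover have "dist (s (a x)) (b (s x)) < e/2" using s(4)[OF xz(2)] .
    moreover have "dist (s (a x), u (a x) * cj (h (a x)) (\<phi> x z)) (b (s x), \<psi> (s x) (u x * cj (h x) z))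
      \<le> dist (s (a x)) (b (s x)) + dist (u (a x) * cj (h (a x)) (\<phi> x z)) (\<psi> (s x) (u x * cj (h x) z))"
      unfolding dist_Pair_Pair by (rule sqrt_sum_squares_le_sum) auto
    ultimately show "dist ((\<sigma> \<circ> skew a \<phi> \<circ> inv_into (X \<times> circle) \<sigma>) w) (skew b \<psi> w) < e"
      unfolding 1 2 by linarith
  qed
qed

section \<open>Descent from the circle extensions to the bases\<close>

lemma (in cantor) circle_bundle_map_fibre:
  assumes "continuous_on (U \<times> circle) f" "f ` (U \<times> circle) \<subseteq> X \<times> circle" "x \<in> U" "z \<in> circle"
  shows "fst (f (x, z)) = fst (f (x, 1))"
proof -
  have "continuous_on circle (\<lambda>z. f (x, z))"
    using assms(3) by (intro continuous_on_compose2[OF assms(1)]) (auto intro!: continuous_intros)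
  then have "continuous_on circle (\<lambda>z. fst (f (x, z)))" by (rule continuous_on_fst)
  moreover have "connected circle" using connected_sphere[of "0::complex" 1] by simp
  ultimately have "connected ((\<lambda>z. fst (f (x, z))) ` circle)" by (rule connected_continuous_image)
  moreover have "(\<lambda>z. fst (f (x, z))) ` circle \<subseteq> X" using assms(2,3) by force
  ultimately show ?thesis
    by (rule connected_subset_point) (use assms(4) in auto)
qed

theorem skew_imp_approx_conjugate:
  fixes X :: "'a::metric_space set" and Y :: "'b::metric_space set"
  assumes X: "minsys X a a'" and Y: "minsys Y b b'" and \<phi>: "isom_cocycle X \<phi>" and \<psi>: "isom_cocycle Y \<psi>"
    and main: "\<And>e::real. e > 0 \<Longrightarrow> \<exists>\<sigma>. homeomorphism (X \<times> circle) (Y \<times> circle) \<sigma> (inv_into (X \<times> circle) \<sigma>) \<and>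
      (\<forall>w\<in>Y \<times> circle. dist ((\<sigma> \<circ> skew a \<phi> \<circ> inv_into (X \<times> circle) \<sigma>) w) (skew b \<psi> w) < e)"
  shows "approx_conjugate X a (orient \<phi>) Y b (orient \<psi>)"
  unfolding approx_conjugate_def
proof (intro allI impI)
  fix e :: real assume e: "e > 0"
  interpret X: minsys X a a' by fact
  interpret Y: minsys Y b b' by fact
  \<comment> \<open>The bound 1 keeps the fibre maps at distance less than 2, so that their degrees
    can be compared.\<close>
  have pos: "min e 1 > 0" using e by simp
  obtain \<sigma> where hom: "homeomorphism (X \<times> circle) (Y \<times> circle) \<sigma> (inv_into (X \<times> circle) \<sigma>)"
    and close: "\<And>w. w \<in> Y \<times> circle \<Longrightarrow> dist ((\<sigma> \<circ> skew a \<phi> \<circ> inv_into (X \<times> circle) \<sigma>) w) (skew b \<psi> w) < min e 1"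
    using main[OF pos] by blast
  define \<rho> where "\<rho> = inv_into (X \<times> circle) \<sigma>"
  have cs: "continuous_on (X \<times> circle) \<sigma>" "continuous_on (Y \<times> circle) \<rho>"
    using hom unfolding homeomorphism_def \<rho>_def by blast+
  have in1: "\<sigma> w \<in> Y \<times> circle" "\<rho> (\<sigma> w) = w" if "w \<in> X \<times> circle" for w
    using hom that unfolding homeomorphism_def \<rho>_def by blast+
  have in2: "\<rho> w \<in> X \<times> circle" "\<sigma> (\<rho> w) = w" if "w \<in> Y \<times> circle" for w
    using hom that unfolding homeomorphism_def \<rho>_def by blast+
  define s where "s x = fst (\<sigma> (x, 1))" for x
  define t where "t y = fst (\<rho> (y, 1))" for y
  define \<tau> where "\<tau> x z = snd (\<sigma> (x, z))" for x z
  have \<sigma>eq: "\<sigma> (x, z) = (s x, \<tau> x z)" if "x \<in> X" "z \<in> circle" for x z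
    using Y.circle_bundle_map_fibre[OF cs(1) _ that] in1(1) by (auto simp: s_def \<tau>_def prod_eq_iff)
  have \<rho>eq: "fst (\<rho> (y, z)) = t y" if "y \<in> Y" "z \<in> circle" for y z
    using X.circle_bundle_map_fibre[OF cs(2) _ that] in2(1) by (auto simp: t_def)
  have one: "(1::complex) \<in> circle" by simp
  have sY: "s x \<in> Y" and \<tau>C: "z \<in> circle \<Longrightarrow> \<tau> x z \<in> circle" if "x \<in> X" for x z
    using in1(1)[of "(x, 1)"] in1(1)[of "(x, z)"] \<sigma>eq[OF that] that one by auto
  have ts: "t (s x) = x" if x: "x \<in> X" for x
    using \<rho>eq[OF sY[OF x] \<tau>C[OF x one]] \<sigma>eq[OF x one] in1(2)[of "(x,1)"] x by simp
  have tX: "t y \<in> X" if "y \<in> Y" for y using in2(1)[of "(y, 1)"] that by (auto simp: t_def)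
  have st: "s (t y) = y" if y: "y \<in> Y" for y
  proof -
    have p: "\<rho> (y, 1) \<in> X \<times> circle" "\<sigma> (\<rho> (y, 1)) = (y, 1)" using in2[of "(y,1)"] y by auto
    obtain x z where xz: "\<rho> (y, 1) = (x, z)" by fastforce
    then have "t y = x" by (simp add: t_def)
    then show ?thesis using p \<sigma>eq[of x z] xz by auto
  qed
  have "continuous_on X s"
    unfolding s_def by (intro continuous_on_fst continuous_on_compose2[OF cs(1)]) (auto intro!: continuous_intros)
  moreover have "s ` X = Y" using sY tX st by (metis image_subset_iff subsetI subset_antisym image_eqI)
  moreover have "inj_on s X" using ts by (metis inj_on_inverseI)
  moreover have est: "dist (s (a x)) (b (s x)) < e \<and> cmod (\<tau> (a x) (\<phi> x z) - \<psi> (s x) (\<tau> x z)) < 1"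
    if x: "x \<in> X" and z: "z \<in> circle" for x z
  proof -
    have \<phi>C: "\<phi> x z \<in> circle" using isom_cocycle_eq(1)[OF \<phi> x, of z] isom_cocycle_eq(2)[OF \<phi> x] z by (simp add: norm_mult)
    have "dist ((\<sigma> \<circ> skew a \<phi> \<circ> \<rho>) (\<sigma> (x, z))) (skew b \<psi> (\<sigma> (x, z))) < min e 1"
      unfolding \<rho>_def using close in1(1) x z by blast
    moreover have "(\<sigma> \<circ> skew a \<phi> \<circ> \<rho>) (\<sigma> (x, z)) = (s (a x), \<tau> (a x) (\<phi> x z))"
      using in1(2)[of "(x, z)"] x z \<sigma>eq[OF X.aX[OF x] \<phi>C] by (simp add: skew_def)
    moreover have "skew b \<psi> (\<sigma> (x, z)) = (b (s x), \<psi> (s x) (\<tau> x z))" using \<sigma>eq[OF x z] by (simp add: skew_def)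
    ultimately have "dist (s (a x), \<tau> (a x) (\<phi> x z)) (b (s x), \<psi> (s x) (\<tau> x z)) < min e 1" by simp
    then show ?thesis
      using dist_fst_le[of "(s (a x), \<tau> (a x) (\<phi> x z))" "(b (s x), \<psi> (s x) (\<tau> x z))"]
        dist_snd_le[of "(s (a x), \<tau> (a x) (\<phi> x z))" "(b (s x), \<psi> (s x) (\<tau> x z))"]
      by (simp add: dist_norm)
  qed
  moreover have "coboundary2 X a (\<lambda>x. orient \<psi> (s x) - orient \<phi> x)"
  proof -
    have \<tau>cont: "continuous_on circle (\<tau> x)" if "x \<in> X" for x
      unfolding \<tau>_def using that by (intro continuous_on_snd continuous_on_compose2[OF cs(1)]) (auto intro!: continuous_intros)
    \<comment> \<open>The degree of the fibre map over \<open>x\<close> is 1 or -1, since the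
      inverse of \<open>\<sigma>\<close> restricts to a right inverse on the fibre, and it is
      locally constant by uniform continuity of \<open>\<sigma>\<close>.\<close>
    have "\<exists>n. has_degree (\<tau> x) n" if "x \<in> X" for x
      using has_degree_exists[OF \<tau>cont[OF that]] \<tau>C[OF that] by blast
    then obtain D where D: "\<And>x. x \<in> X \<Longrightarrow> has_degree (\<tau> x) (D x)" by metis
    have D1: "D x = 1 \<or> D x = - 1" if x: "x \<in> X" for x
    proof (rule has_degree_invertible[OF D[OF x]])
      show "continuous_on circle (\<lambda>w. snd (\<rho> (s x, w)))"
        using sY[OF x] by (intro continuous_on_snd continuous_on_compose2[OF cs(2)]) (auto intro!: continuous_intros)
      show "(\<lambda>w. snd (\<rho> (s x, w))) ` circle \<subseteq> circle" using in2(1) sY[OF x] by force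
      fix z :: complex assume z: "z \<in> circle"
      have r: "\<rho> (s x, z) \<in> X \<times> circle" "\<sigma> (\<rho> (s x, z)) = (s x, z)" using in2[of "(s x, z)"] sY[OF x] z by auto
      have "fst (\<rho> (s x, z)) = x" using \<rho>eq[OF sY[OF x] z] ts[OF x] by simp
      then have "\<rho> (s x, z) = (x, snd (\<rho> (s x, z)))" by (metis prod.collapse)
      then show "\<tau> x (snd (\<rho> (s x, z))) = z" using r(2) by (metis \<tau>_def snd_conv)
    qed
    have "lc X D"
    proof (rule lcI)
      fix x assume x: "x \<in> X"
      have "uniformly_continuous_on (X \<times> circle) \<sigma>"
        using compact_uniformly_continuous[OF cs(1)] compact_Times[OF X.cpt compact_sphere] by blast
      then obtain d where d: "d > 0" "\<And>v w. v \<in> X \<times> circle \<Longrightarrow> w \<in> X \<times> circle \<Longrightarrow> dist w v < d \<Longrightarrow> dist (\<sigma> w) (\<sigma> v) < 2"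
        unfolding uniformly_continuous_on_def by (meson zero_less_numeral)
      have "D x' = D x" if x': "x' \<in> ball x d \<inter> X" for x'
      proof (rule has_degree_close[OF D D[OF x]])
        show "x' \<in> X" using x' by simp
        fix z :: complex assume z: "z \<in> circle"
        have "dist (\<sigma> (x', z)) (\<sigma> (x, z)) < 2"
          using d(2)[of "(x, z)" "(x', z)"] x x' z by (simp add: dist_Pair_Pair dist_commute)
        then show "cmod (\<tau> x' z - \<tau> x z) < 2"
          using dist_snd_le[of "\<sigma> (x', z)" "\<sigma> (x, z)"] by (simp add: \<tau>_def dist_norm)
      qed
      then show "\<exists>U. open U \<and> x \<in> U \<and> (\<forall>x'\<in>U \<inter> X. D x' = D x)"
        using d(1) by (intro exI[of _ "ball x d"]) auto
    qed
    \<comment> \<open>\<open>D\<close> relates the degrees of \<open>\<phi>\<close> and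
      \<open>\<psi>\<close> multiplicatively; rewriting the signs additively modulo two turns it
      into the required transfer function.\<close>
    define h where "h x = (if D x = 1 then 0 else 1::int)" for x
    have "even (orient \<psi> (s x) - orient \<phi> x - (h (a x) - h x))" if x: "x \<in> X" for x
    proof -
      have "D (a x) * (if odd (orient \<phi> x) then - 1 else 1) = (if odd (orient \<psi> (s x)) then - 1 else 1) * D x"
      proof (rule has_degree_close[OF has_degree_compose[OF D[OF X.aX[OF x]] isom_cocycle_degree[OF \<phi> x]]
            has_degree_compose[OF isom_cocycle_degree[OF \<psi> sY[OF x]] D[OF x]]])
        fix z :: complex assume "z \<in> circle"
        then show "cmod (\<tau> (a x) (\<phi> x z) - \<psi> (s x) (\<tau> x z)) < 2" using est[OF x] by fastforce
      qed
      then show ?thesis using D1[OF x] D1[OF X.aX[OF x]] by (auto simp: h_def split: if_splits)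
    qed
    moreover have "lc X h" unfolding h_def using lc_comp1[OF \<open>lc X D\<close>, of "\<lambda>d. if d = 1 then 0 else 1::int"] .
    ultimately show ?thesis unfolding coboundary2_def by blast
  qed
  ultimately show "\<exists>s. continuous_on X s \<and> s ` X = Y \<and> inj_on s X \<and>
     (\<forall>x\<in>X. dist (s (a x)) (b (s x)) < e) \<and> coboundary2 X a (\<lambda>x. orient \<psi> (s x) - orient \<phi> x)"
    using one by blast
qed

section \<open>Translation between the definitions of the theorem and locally constant data\<close>

lemma cantor_minimal_imp_minsys:
  assumes "cantor_minimal X a"
  shows "minsys X a (inv_into X a)"
proof -
  have h: "homeomorphism X X a (inv_into X a)" and c: "cantor_set X"
    and m: "\<And>C. closed C \<Longrightarrow> C \<subseteq> X \<Longrightarrow> a ` C = C \<Longrightarrow> C = {} \<or> C = X"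
    using assms unfolding cantor_minimal_def by blast+
  show ?thesis
  proof
    show "compact X" "X \<noteq> {}" using c by (auto simp: cantor_set_def)
    show "x islimpt X" "connected_component_set X x = {x}" if "x \<in> X" for x
      using c that unfolding cantor_set_def by blast+
    show "continuous_on X a" "continuous_on X (inv_into X a)" using h unfolding homeomorphism_def by blast+
    show "a x \<in> X" "inv_into X a x \<in> X" "a (inv_into X a x) = x" "inv_into X a (a x) = x" if "x \<in> X" for x
      using h that unfolding homeomorphism_def by blast+
    show "C = {} \<or> C = X" if "closed C" "C \<subseteq> X" "a ` C = C" for C using m that by blast
  qed
qed

context minsys
begin

lemma K0mod2_zero_iff: "lc X p \<Longrightarrow> K0mod2_eq X a p (\<lambda>_. 0) \<longleftrightarrow> coboundary2 X a p"
  using K0mod2_eq_iff[of p "\<lambda>_. 0"] by (simp add: coboundary2_def)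

lemma divisible_class_iff:
  assumes "lc X p"
  shows "divisible_class X a p m f \<longleftrightarrow> continuous_on X f \<and> K0_eq X a (\<lambda>x. m * f x) (\<lambda>_. 1) \<and> K0mod2_eq X a f p"
proof (cases "lc X f")
  case True
  have "lc X (\<lambda>x. m * f x)" using lc_comp1[OF True] .
  then show ?thesis
    unfolding divisible_class_def coboundary2_def
    using K0_eq_iff[of "\<lambda>x. m * f x" "\<lambda>_. 1"] K0mod2_eq_iff[OF True assms] True lc_imp_continuous_on[OF True] by simp
next
  case False
  then show ?thesis unfolding divisible_class_def lc_iff_continuous_on_int by blast
qed

end

theorem theorem4p9:
  fixes X :: "'a::metric_space set" and \<alpha> :: "'a \<Rightarrow> 'a"
    and Y :: "'b::metric_space set" and \<beta> :: "'b \<Rightarrow> 'b"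
    and \<phi> :: "'a \<Rightarrow> complex \<Rightarrow> complex" and \<psi> :: "'b \<Rightarrow> complex \<Rightarrow> complex"
  assumes "cantor_minimal X \<alpha>" and "cantor_minimal Y \<beta>"
    and "isom_cocycle X \<phi>" and "isom_cocycle Y \<psi>"
  shows "(\<exists>\<sigma> :: nat \<Rightarrow> 'a \<times> complex \<Rightarrow> 'b \<times> complex.
            (\<forall>n. homeomorphism (X \<times> circle) (Y \<times> circle) (\<sigma> n) (inv_into (X \<times> circle) (\<sigma> n))) \<and>
            uniform_limit (Y \<times> circle)
              (\<lambda>n. \<sigma> n \<circ> skew \<alpha> \<phi> \<circ> inv_into (X \<times> circle) (\<sigma> n))
              (skew \<beta> \<psi>) sequentially)
     \<longleftrightarrow>
     (PS Y \<beta> \<subseteq> PS X \<alpha> \<and>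
      ((K0mod2_eq Y \<beta> (orient \<psi>) (\<lambda>_. 0) \<and> K0mod2_eq X \<alpha> (orient \<phi>) (\<lambda>_. 0))
       \<or> (\<not> K0mod2_eq Y \<beta> (orient \<psi>) (\<lambda>_. 0) \<and>
          (\<exists>n::nat. \<exists>f::'a \<Rightarrow> int. \<exists>g::'b \<Rightarrow> int. n \<ge> 1 \<and>
             continuous_on X f \<and> continuous_on Y g \<and>
             K0_eq X \<alpha> (\<lambda>x. 2 ^ (n - 1) * f x) (\<lambda>_. 1) \<and>
             K0mod2_eq X \<alpha> f (orient \<phi>) \<and>
             K0_eq Y \<beta> (\<lambda>y. 2 ^ (n - 1) * g y) (\<lambda>_. 1) \<and>
             K0mod2_eq Y \<beta> g (orient \<psi>)))
       \<or> (\<not> K0mod2_eq Y \<beta> (orient \<psi>) (\<lambda>_. 0) \<and>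
          PS (Y \<times> {0, 1}) (skew2 \<beta> (orient \<psi>)) = PS Y \<beta>)))"
proof -
  interpret X: minsys X \<alpha> "inv_into X \<alpha>" by (rule cantor_minimal_imp_minsys[OF assms(1)])
  interpret Y: minsys Y \<beta> "inv_into Y \<beta>" by (rule cantor_minimal_imp_minsys[OF assms(2)])
  note X = X.minsys_axioms and Y = Y.minsys_axioms
  let ?p = "orient \<phi>" and ?q = "orient \<psi>"
  have p: "lc X ?p" and q: "lc Y ?q" using lc_orient assms(3,4) by blast+
  note inv = X.K0mod2_zero_iff[OF p] Y.K0mod2_zero_iff[OF q]
  let ?hom = "\<lambda>\<sigma>. homeomorphism (X \<times> circle) (Y \<times> circle) \<sigma> (inv_into (X \<times> circle) \<sigma>)"
  let ?conj = "\<lambda>\<sigma>. \<sigma> \<circ> skew \<alpha> \<phi> \<circ> inv_into (X \<times> circle) \<sigma>"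
  have b: "(\<exists>n::nat. \<exists>f::'a \<Rightarrow> int. \<exists>g::'b \<Rightarrow> int. n \<ge> 1 \<and>
             continuous_on X f \<and> continuous_on Y g \<and>
             K0_eq X \<alpha> (\<lambda>x. 2 ^ (n - 1) * f x) (\<lambda>_. 1) \<and>
             K0mod2_eq X \<alpha> f (orient \<phi>) \<and>
             K0_eq Y \<beta> (\<lambda>y. 2 ^ (n - 1) * g y) (\<lambda>_. 1) \<and>
             K0mod2_eq Y \<beta> g (orient \<psi>)) \<longleftrightarrow>
      (\<exists>n\<ge>1. \<exists>f g. divisible_class X \<alpha> ?p (2 ^ (n - 1)) f \<and> divisible_class Y \<beta> ?q (2 ^ (n - 1)) g)"
    unfolding X.divisible_class_iff[OF p] Y.divisible_class_iff[OF q] by blast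
  have "(\<exists>\<sigma> :: nat \<Rightarrow> 'a \<times> complex \<Rightarrow> 'b \<times> complex. (\<forall>n. ?hom (\<sigma> n)) \<and>
      uniform_limit (Y \<times> circle) (\<lambda>n. ?conj (\<sigma> n)) (skew \<beta> \<psi>) sequentially)
    \<longleftrightarrow> approx_conjugate X \<alpha> ?p Y \<beta> ?q" (is "?lhs \<longleftrightarrow> _")
  proof
    assume ?lhs
    then obtain \<sigma> where \<sigma>: "\<And>n::nat. ?hom (\<sigma> n)"
      "uniform_limit (Y \<times> circle) (\<lambda>n. ?conj (\<sigma> n)) (skew \<beta> \<psi>) sequentially" by blast
    show "approx_conjugate X \<alpha> ?p Y \<beta> ?q"
    proof (rule skew_imp_approx_conjugate[OF X Y assms(3,4)])
      fix e :: real assume "e > 0"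
      then have "\<forall>\<^sub>F n in sequentially. \<forall>w\<in>Y \<times> circle. dist (?conj (\<sigma> n) w) (skew \<beta> \<psi> w) < e"
        using \<sigma>(2) unfolding uniform_limit_iff by blast
      then obtain n where "\<forall>w\<in>Y \<times> circle. dist (?conj (\<sigma> n) w) (skew \<beta> \<psi> w) < e"
        unfolding eventually_sequentially by blast
      then show "\<exists>\<sigma>. ?hom \<sigma> \<and> (\<forall>w\<in>Y \<times> circle. dist (?conj \<sigma> w) (skew \<beta> \<psi> w) < e)"
        using \<sigma>(1) by blast
    qed
  next
    assume ac: "approx_conjugate X \<alpha> ?p Y \<beta> ?q"
    \<comment> \<open>One homeomorphism for each error \<open>1 / (n + 1)\<close> gives the
      sequence.\<close>
    have "\<exists>\<sigma>. ?hom \<sigma> \<and> (\<forall>w\<in>Y \<times> circle. dist (?conj \<sigma> w) (skew \<beta> \<psi> w) < 1 / (real n + 1))" for n :: nat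
      by (rule approx_conjugate_imp_skew[OF X Y assms(3,4) ac, of "1 / (real n + 1)"]) (simp, blast)
    then obtain \<sigma> where \<sigma>: "\<And>n. ?hom (\<sigma> n)"
      "\<And>n w. w \<in> Y \<times> circle \<Longrightarrow> dist (?conj (\<sigma> n) w) (skew \<beta> \<psi> w) < 1 / (real n + 1)"
      by metis
    have "uniform_limit (Y \<times> circle) (\<lambda>n. ?conj (\<sigma> n)) (skew \<beta> \<psi>) sequentially"
      unfolding uniform_limit_iff
    proof (intro allI impI)
      fix e :: real assume "e > 0"
      then obtain N where N: "1 / (real N + 1) < e"
        using reals_Archimedean by (metis Suc_eq_plus1 inverse_eq_divide of_nat_Suc add.commute)
      have "dist (?conj (\<sigma> n) w) (skew \<beta> \<psi> w) < e" if "n \<ge> N" "w \<in> Y \<times> circle" for n w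
      proof -
        have "1 / (real n + 1) \<le> 1 / (real N + 1)" using that(1) by (intro divide_left_mono) auto
        then show ?thesis using \<sigma>(2)[OF that(2), of n] N by linarith
      qed
      then show "\<forall>\<^sub>F n in sequentially. \<forall>w\<in>Y \<times> circle. dist (?conj (\<sigma> n) w) (skew \<beta> \<psi> w) < e"
        unfolding eventually_sequentially by blast
    qed
    then show ?lhs using \<sigma>(1) by blast
  qed
  moreover have "approx_conjugate X \<alpha> ?p Y \<beta> ?q" if "PS Y \<beta> \<subseteq> PS X \<alpha>"
    "(coboundary2 Y \<beta> ?q \<and> coboundary2 X \<alpha> ?p) \<or>
      (\<not> coboundary2 Y \<beta> ?q \<and> (\<exists>n\<ge>1. \<exists>f g. divisible_class X \<alpha> ?p (2 ^ (n - 1)) f \<and> divisible_class Y \<beta> ?q (2 ^ (n - 1)) g)) \<or>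
      (\<not> coboundary2 Y \<beta> ?q \<and> PS (Y \<times> {0,1}) (skew2 \<beta> ?q) = PS Y \<beta>)"
  proof (rule approx_conjugate_of_invariants[OF X Y p q that(1)])
    have "(2::int) ^ (n - 1) > 0" for n by simp
    then show "(coboundary2 Y \<beta> ?q \<and> coboundary2 X \<alpha> ?p) \<or>
      (\<not> coboundary2 Y \<beta> ?q \<and> (\<exists>m f g. m > 0 \<and> divisible_class X \<alpha> ?p m f \<and> divisible_class Y \<beta> ?q m g)) \<or>
      (\<not> coboundary2 Y \<beta> ?q \<and> PS (Y \<times> {0,1}) (skew2 \<beta> ?q) = PS Y \<beta>)"
      using that(2) by metis
  qed
  moreover note invariants_of_approx_conjugate[OF X Y p q]
  ultimately show ?thesis unfolding inv b by blast
qed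

end
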